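(* Let $M\subset\mathbb{R}^{N+1}$ be a smooth strictly convex hypersurface with volume distance $v$, and let $D$ be a half-neighborhood of $M$ on which the minimizing direction $n(p)$ is unique and smooth and $\frac{\partial^2V}{\partial n^2}(n(p),p)$ is positive definite. For $p\in D$ let $b(p)$ be the $N$-dimensional volume of the region $R(n(p),p)$, let $H(p)=H(n(p),p)$, and let $$Q(p)=\frac{1}{b(p)}\frac{\partial^2V}{\partial n^2}(n(p),p).$$ Then for every $p\in D$, $$-\frac{1}{b(p)}\,D^2v(p)\big|_{H(p)}=Q^{-1}(p),$$ where $D^2v(p)|_{H(p)}$ is the restriction of the hessian of $v$ at $p$ to (the direction space of) $H(p)$.
   Context: $M\subset\mathbb{R}^{N+1}$ is a smooth embedded strictly convex hypersurface (positive definite second fundamental form with respect to the normal pointing to the convex side), possibly with boundary $\partial M$. $\xi$ denotes the affine (Blaschke) normal vector field, pointing to the convex side of $M$. For $p\in\mathbb{R}^{N+1}$ and $n\in S^N$, $H(n,p)$ is the hyperplane through $p$ orthogonal to $n$. $E(p)\subset S^N$ is the set of $n$ such that $H(n,p)$ intersects $M-\partial M$ transversally in a closed hypersurface $\Gamma(n,p)$ of $H(n,p)$ bounding a region $R(n,p)\subset H(n,p)$ containing $p$ in its interior, and such that the region $U(n,p)$ bounded by $R(n,p)$ and $M$, with $n$ pointing outwards from $U(n,p)$ along $R(n,p)$, has finite volume $V(n,p)$. $D_1$ is the set of $p$ with $E(p)\ne\emptyset$ for which $\inf\{V(n,p): n\in E(p)\}$ is attained in $E(p)$; the pair $(n,p)$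 is called minimizing if $n\in E(p)$ attains it, and the volume distance is $v(p)=V(n,p)$ for a minimizing pair. A half-neighborhood of $M$ is a set $\{q+t\xi(q): q\in M-\partial M,\ 0<t<T(q)\}$ with $T>0$ a smooth function. $D\subset D_1$ is a fixed open half-neighborhood of $M$ such that every $p\in D$ has a unique minimizing $n(p)$, the map $p\mapsto n(p)$ is smooth, and $\frac{\partial^2V}{\partial n^2}(n(p),p)$ is positive definite; hence $v(p)=V(n(p),p)$ is smooth on $D$. Here $\frac{\partial^2V}{\partial n^2}(n(p),p)$ is the hessian at the critical point $n(p)$ of $n\mapsto V(n,p)$ on $S^N$, a self-adjoint linear operator of $T_{n(p)}S^N$ (via the Euclidean inner product). $T_{n(p)}S^N$ is identified with the direction space of $H(p)$, both being the orthogonal complement of $n(p)$, and the restricted hessian $D^2v(p)|_{H(p)}$ is likewise regarded as a self-adjoint operator of this space. *)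

theory Defs
  imports "HOL-Analysis.Analysis"
begin

section \<open>The ambient space and smooth maps\<close>

text \<open>
  \<open>'n space\<close> is $\mathbb{R}^{N+1}$ with $N = $ \<open>CARD('n)\<close> $\ge 1$. The index \<open>None\<close> is the additional
  coordinate, so families indexed by \<open>'n\<close> are exactly families of $N$ vectors.
\<close>

type_synonym 'n space = "(real, 'n option) vec"

text \<open>\<open>C_on k S f\<close>: \<open>f\<close> is of class $C^k$ on \<open>S\<close>. Only meant for open \<open>S\<close>.\<close>

primrec C_on :: "nat \<Rightarrow> 'a::real_normed_vector set \<Rightarrow> ('a \<Rightarrow> 'b::real_normed_vector) \<Rightarrow> bool" where
  "C_on 0 S f \<longleftrightarrow> continuous_on S f"
| "C_on (Suc k) S f \<longleftrightarrow>
     (\<forall>x\<in>S. f differentiable at x) \<and> (\<forall>v. C_on k S (\<lambda>x. frechet_derivative f (at x) v))"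

definition smooth_on :: "'a::real_normed_vector set \<Rightarrow> ('a \<Rightarrow> 'b::real_normed_vector) \<Rightarrow> bool" where
  "smooth_on S f \<longleftrightarrow> (\<forall>k. C_on k S f)"

text \<open>Smoothness on a subset that need not be open: existence of local smooth extensions.\<close>

definition smooth_along :: "'a::real_normed_vector set \<Rightarrow> ('a \<Rightarrow> 'b::real_normed_vector) \<Rightarrow> bool" where
  "smooth_along S f \<longleftrightarrow>
     (\<forall>x\<in>S. \<exists>W g. open W \<and> x \<in> W \<and> smooth_on W g \<and> (\<forall>y\<in>S \<inter> W. g y = f y))"

definition diffeo_on :: "'a::real_normed_vector set \<Rightarrow> ('a \<Rightarrow> 'b::real_normed_vector) \<Rightarrow> bool" where
  "diffeo_on W \<phi> \<longleftrightarrow> open W \<and> open (\<phi> ` W) \<and> inj_on \<phi> W \<and>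
     smooth_on W \<phi> \<and> smooth_on (\<phi> ` W) (inv_into W \<phi>)"

text \<open>\<open>second_derivative f x X Y\<close> is $D^2f(x)(X,Y)$, meaningful if \<open>f\<close> is twice differentiable at \<open>x\<close>.\<close>

definition second_derivative ::
    "('a::real_normed_vector \<Rightarrow> 'b::real_normed_vector) \<Rightarrow> 'a \<Rightarrow> 'a \<Rightarrow> 'a \<Rightarrow> 'b" where
  "second_derivative f x X Y =
     frechet_derivative (\<lambda>y. frechet_derivative f (at y) X) (at x) Y"

definition twice_differentiable_at ::
    "('a::real_normed_vector \<Rightarrow> 'b::real_normed_vector) \<Rightarrow> 'a \<Rightarrow> bool" where
  "twice_differentiable_at f x \<longleftrightarrow>
     (\<forall>\<^sub>F y in nhds x. f differentiable at y) \<and>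
     (\<forall>X. (\<lambda>y. frechet_derivative f (at y) X) differentiable at x)"

text \<open>The operator of a subspace \<open>T\<close> that represents a bilinear form through the inner product.\<close>

definition form_operator :: "'a::real_inner set \<Rightarrow> ('a \<Rightarrow> 'a \<Rightarrow> real) \<Rightarrow> 'a \<Rightarrow> 'a" where
  "form_operator T B X = (THE Z. Z \<in> T \<and> (\<forall>Y\<in>T. Z \<bullet> Y = B X Y))"


section \<open>Strictly convex hypersurfaces and the affine normal\<close>

definition interior_chart :: "'n::finite space set \<Rightarrow> 'n space \<Rightarrow> bool" where
  "interior_chart M q \<longleftrightarrow>
     (\<exists>W (\<phi> :: 'n space \<Rightarrow> 'n space). diffeo_on W \<phi> \<and> q \<in> W \<and>
        M \<inter> W = {x\<in>W. \<phi> x $ None = 0})"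

definition boundary_chart :: "'n::finite space set \<Rightarrow> 'n space \<Rightarrow> bool" where
  "boundary_chart M q \<longleftrightarrow>
     (\<exists>W (\<phi> :: 'n space \<Rightarrow> 'n space) i. diffeo_on W \<phi> \<and> q \<in> W \<and> \<phi> q $ Some i = 0 \<and>
        M \<inter> W = {x\<in>W. \<phi> x $ None = 0 \<and> 0 \<le> \<phi> x $ Some i})"

definition smooth_hypersurface :: "'n::finite space set \<Rightarrow> bool" where
  "smooth_hypersurface M \<longleftrightarrow> (\<forall>q\<in>M. interior_chart M q \<or> boundary_chart M q)"

definition mboundary :: "'n::finite space set \<Rightarrow> 'n space set" where
  "mboundary M = {q\<in>M. boundary_chart M q}"

text \<open>
  One-sided velocities form the whole tangent space at interior points of \<open>M\<close>, but only a half-space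
  of it at boundary points; hence the span.
\<close>

definition tangent_space :: "'n::finite space set \<Rightarrow> 'n space \<Rightarrow> 'n space set" where
  "tangent_space M q = span {X. \<exists>\<gamma> \<epsilon>. 0 < \<epsilon> \<and> \<gamma> 0 = q \<and> (\<forall>t\<in>{0..<\<epsilon>}. \<gamma> t \<in> M) \<and>
     (\<gamma> has_vector_derivative X) (at 0 within {0..<\<epsilon>})}"

text \<open>
  The derivative of a map smooth along \<open>M\<close>. A derivative within \<open>M\<close> is not unique as a linear map on the
  ambient space, but its values on \<open>tangent_space M q\<close> are.
\<close>

definition deriv_along ::
    "'n::finite space set \<Rightarrow> ('n space \<Rightarrow> 'n space) \<Rightarrow> 'n space \<Rightarrow> 'n space \<Rightarrow> 'n space" where
  "deriv_along M f q X = frechet_derivative f (at q within M) X"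

definition unit_normal :: "'n::finite space set \<Rightarrow> ('n space \<Rightarrow> 'n space) \<Rightarrow> bool" where
  "unit_normal M \<nu> \<longleftrightarrow> smooth_along M \<nu> \<and>
     (\<forall>q\<in>M. norm (\<nu> q) = 1 \<and> (\<forall>X\<in>tangent_space M q. \<nu> q \<bullet> X = 0))"

definition second_fundamental_form ::
    "'n::finite space set \<Rightarrow> ('n space \<Rightarrow> 'n space) \<Rightarrow> 'n space \<Rightarrow> 'n space \<Rightarrow> 'n space \<Rightarrow> real" where
  "second_fundamental_form M \<nu> q X Y = - (deriv_along M \<nu> q X \<bullet> Y)"

text \<open>
  The field \<open>\<nu>\<close> is determined by \<open>M\<close>: it is the unit normal pointing to the convex side, the opposite
  normal having negative definite second fundamental form.
\<close>

definition strictly_convex_hypersurface ::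
    "'n::finite space set \<Rightarrow> ('n space \<Rightarrow> 'n space) \<Rightarrow> bool" where
  "strictly_convex_hypersurface M \<nu> \<longleftrightarrow> smooth_hypersurface M \<and> unit_normal M \<nu> \<and>
     (\<forall>q\<in>M. \<forall>X\<in>tangent_space M q. X \<noteq> 0 \<longrightarrow> 0 < second_fundamental_form M \<nu> q X X)"

text \<open>
  For a transversal field \<open>\<xi>\<close> the affine fundamental form $h$ is defined by the Gauss formula
  $D_XY = \nabla_XY + h(X,Y)\,\xi$; taking inner products with \<open>\<nu>\<close> gives the quotient below.
\<close>

definition affine_form ::
    "'n::finite space set \<Rightarrow> ('n space \<Rightarrow> 'n space) \<Rightarrow> ('n space \<Rightarrow> 'n space) \<Rightarrow> 'n space
      \<Rightarrow> 'n space \<Rightarrow> 'n space \<Rightarrow> real" where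
  "affine_form M \<nu> \<xi> q X Y = second_fundamental_form M \<nu> q X Y / (\<xi> q \<bullet> \<nu> q)"

text \<open>
  The Blaschke normal: transversal to \<open>M\<close> and pointing to the convex side, equiaffine ($D_X\xi$ is
  tangent), and with induced volume $\det(X_1,\dots,X_N,\xi)$ equal, up to sign, to the volume
  $\sqrt{\det h(X_i,X_j)}$ of the affine metric.
\<close>

definition affine_normal ::
    "'n::finite space set \<Rightarrow> ('n space \<Rightarrow> 'n space) \<Rightarrow> ('n space \<Rightarrow> 'n space) \<Rightarrow> bool" where
  "affine_normal M \<nu> \<xi> \<longleftrightarrow> smooth_along M \<xi> \<and>
     (\<forall>q\<in>M. 0 < \<xi> q \<bullet> \<nu> q \<and>
        (\<forall>X\<in>tangent_space M q. deriv_along M \<xi> q X \<in> tangent_space M q) \<and>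
        (\<forall>X :: 'n \<Rightarrow> 'n space. (\<forall>i. X i \<in> tangent_space M q) \<longrightarrow>
           \<bar>det (\<chi> k. case k of None \<Rightarrow> \<xi> q | Some i \<Rightarrow> X i)\<bar>
             = sqrt (det (\<chi> i j. affine_form M \<nu> \<xi> q (X i) (X j)))))"

definition half_neighborhood ::
    "'n::finite space set \<Rightarrow> ('n space \<Rightarrow> 'n space) \<Rightarrow> 'n space set \<Rightarrow> bool" where
  "half_neighborhood M \<xi> D \<longleftrightarrow>
     (\<exists>T :: 'n space \<Rightarrow> real. smooth_along (M - mboundary M) T \<and> (\<forall>q\<in>M - mboundary M. 0 < T q) \<and>
        D = {q + t *\<^sub>R \<xi> q | q t. q \<in> M - mboundary M \<and> 0 < t \<and> t < T q})"


section \<open>The volume distance\<close>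

definition perp :: "'a::real_inner \<Rightarrow> 'a set" where
  "perp n = {X. n \<bullet> X = 0}"

definition hyperplane :: "'a::real_inner \<Rightarrow> 'a \<Rightarrow> 'a set" where
  "hyperplane n p = {x. n \<bullet> (x - p) = 0}"

definition slice :: "'n::finite space set \<Rightarrow> 'n space \<Rightarrow> 'n space \<Rightarrow> 'n space set" where
  "slice M n p = hyperplane n p \<inter> (M - mboundary M)"

text \<open>
  The set of points of the hyperplane enclosed by the slice. It is open in the hyperplane, so
  \<open>p \<in> enclosed M n p\<close> says that \<open>p\<close> is an interior point of the region.
\<close>

definition enclosed :: "'n::finite space set \<Rightarrow> 'n space \<Rightarrow> 'n space \<Rightarrow> 'n space set" where
  "enclosed M n p = {x \<in> hyperplane n p - slice M n p.
     bounded (connected_component_set (hyperplane n p - slice M n p) x)}"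

text \<open>
  An open region \<open>U\<close> bounded by \<open>enclosed M n p\<close> and \<open>M\<close>, with \<open>n\<close> pointing outwards along the former.
  There is at most one: it is the component of the complement of \<open>closure (enclosed M n p) \<union> M\<close>
  that contains \<open>p - t *\<^sub>R n\<close> for small \<open>t > 0\<close>.
\<close>

definition bounded_by :: "'n::finite space set \<Rightarrow> 'n space \<Rightarrow> 'n space \<Rightarrow> 'n space set \<Rightarrow> bool" where
  "bounded_by M n p U \<longleftrightarrow> open U \<and> connected U \<and>
     U \<inter> (closure (enclosed M n p) \<union> M) = {} \<and>
     frontier U \<subseteq> closure (enclosed M n p) \<union> M \<and>
     (\<forall>x\<in>enclosed M n p. \<exists>\<epsilon>>0. \<forall>t. 0 < t \<and> t < \<epsilon> \<longrightarrow> x - t *\<^sub>R n \<in> U \<and> x + t *\<^sub>R n \<notin> U)"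

definition cut_region :: "'n::finite space set \<Rightarrow> 'n space \<Rightarrow> 'n space \<Rightarrow> 'n space set" where
  "cut_region M n p = (THE U. bounded_by M n p U)"

definition cut_volume :: "'n::finite space set \<Rightarrow> 'n space \<Rightarrow> 'n space \<Rightarrow> real" where
  "cut_volume M n p = measure lebesgue (cut_region M n p)"

text \<open>
  The set $E(p)$. By transversality the slice is a hypersurface of \<open>hyperplane n p\<close> without boundary,
  so it is closed (in the sense of manifolds) iff it is compact.
\<close>

definition admissible_directions :: "'n::finite space set \<Rightarrow> 'n space \<Rightarrow> 'n space set" where
  "admissible_directions M p = {n. norm n = 1 \<and>
     (\<forall>q\<in>slice M n p. \<not> tangent_space M q \<subseteq> perp n) \<and>
     compact (slice M n p) \<and>
     connected (enclosed M n p) \<and> p \<in> enclosed M n p \<and>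
     closure (enclosed M n p) - enclosed M n p = slice M n p \<and>
     (\<exists>U. bounded_by M n p U \<and> emeasure lebesgue U < \<infinity>)}"

definition minimizing :: "'n::finite space set \<Rightarrow> 'n space \<Rightarrow> 'n space \<Rightarrow> bool" where
  "minimizing M n p \<longleftrightarrow> n \<in> admissible_directions M p \<and>
     (\<forall>m\<in>admissible_directions M p. cut_volume M n p \<le> cut_volume M m p)"

definition minimizable :: "'n::finite space set \<Rightarrow> 'n space set" where
  "minimizable M = {p. \<exists>n. minimizing M n p}"

definition volume_distance :: "'n::finite space set \<Rightarrow> 'n space \<Rightarrow> real" where
  "volume_distance M p = cut_volume M (SOME n. minimizing M n p) p"

definition min_dir :: "'n::finite space set \<Rightarrow> 'n space \<Rightarrow> 'n space" where
  "min_dir M p = (THE n. minimizing M n p)"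

text \<open>
  $N$-dimensional Lebesgue measure of a subset of \<open>hyperplane n p\<close>, computed in an isometric
  parametrization of the hyperplane; by invariance of Lebesgue measure the choice is irrelevant.
\<close>

definition hyperplane_measure :: "'n::finite space \<Rightarrow> 'n space \<Rightarrow> 'n space set \<Rightarrow> real" where
  "hyperplane_measure n p S =
     (let L = (SOME L :: real ^ 'n \<Rightarrow> 'n space.
                 linear L \<and> (\<forall>y. norm (L y) = norm y) \<and> range L = perp n)
      in measure lebesgue {y. p + L y \<in> S})"

definition section_volume :: "'n::finite space set \<Rightarrow> 'n space \<Rightarrow> real" where
  "section_volume M p = hyperplane_measure (min_dir M p) p (enclosed M (min_dir M p) p)"


section \<open>The hessian on the unit sphere and the operator Q\<close>

text \<open>
  A function on (part of) the unit sphere is extended to be constant along rays from the origin.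
  Restricted to the tangent space \<open>perp n\<close> of the sphere, the second derivative at \<open>n\<close> of the extension
  is the hessian of the function on the sphere.
\<close>

definition radial_extension :: "('a::real_inner \<Rightarrow> real) \<Rightarrow> 'a \<Rightarrow> real" where
  "radial_extension f x = f (x /\<^sub>R norm x)"

text \<open>
  Twice differentiability at \<open>n\<close> of a function that is only defined on the subset \<open>S\<close> of the unit
  sphere; this requires \<open>S\<close> to contain a neighborhood of \<open>n\<close> in the sphere.
\<close>

definition twice_differentiable_on_sphere_at ::
    "'a::real_inner set \<Rightarrow> ('a \<Rightarrow> real) \<Rightarrow> 'a \<Rightarrow> bool" where
  "twice_differentiable_on_sphere_at S f n \<longleftrightarrow>
     (\<exists>W. open W \<and> n \<in> W \<and> W \<inter> sphere 0 1 \<subseteq> S) \<and>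
     twice_differentiable_at (radial_extension f) n"

definition sphere_hessian :: "('a::real_inner \<Rightarrow> real) \<Rightarrow> 'a \<Rightarrow> 'a \<Rightarrow> 'a" where
  "sphere_hessian f n = form_operator (perp n) (second_derivative (radial_extension f) n)"

definition V_nn :: "'n::finite space set \<Rightarrow> 'n space \<Rightarrow> 'n space \<Rightarrow> 'n space" where
  "V_nn M p = sphere_hessian (\<lambda>n. cut_volume M n p) (min_dir M p)"

definition Q_op :: "'n::finite space set \<Rightarrow> 'n space \<Rightarrow> 'n space \<Rightarrow> 'n space" where
  "Q_op M p X = (1 / section_volume M p) *\<^sub>R V_nn M p X"

definition restricted_hessian :: "'n::finite space set \<Rightarrow> 'n space \<Rightarrow> 'n space \<Rightarrow> 'n space" where
  "restricted_hessian M p =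
     form_operator (perp (min_dir M p)) (second_derivative (volume_distance M) p)"

end

theory Submission
  imports Defs
begin

text \<open>
  Write $n = n(p)$, $b = b(p)$, $A = Dn(p)$. The volume $V(n,p)$ depends only on the hyperplane $H(n,p)$, and
  under a parallel displacement of the hyperplane it changes at the rate $b$, with an error that is uniform
  for nearby hyperplanes. Hence $Dv = b\,n$ and $b$ is continuous, and since $n(p)$ annihilates $H(p)$ this
  gives $D^2v(X,Y) = b\,\langle AY, X\rangle$ on $H(p)$. If $q$ is near $p$ and $H(q)$ passes through $p$, then
  at $n(q)$ the derivative of $V(\cdot,q)$ vanishes and differs from that of $V(\cdot,p)$ by
  $b\,\langle X, q-p\rangle$ to first order; letting $q \to p$ yields $V_{nn}A = -b$ on $H(p)$.

  The uniform rate needs the region cut off by a hyperplane close to $H(p)$ to be the old region plus a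
  thin slab over $R$, although \<open>M\<close> need be neither closed nor connected and could a priori accumulate at $R$ or be
  met far away. The hyperplanes through $p$ with directions near $n(p)$ are admissible and sweep out
  everything near $H(p)$ except points close to $p$. If one of them met \<open>M\<close> at a point that is not near the
  boundary of $R$, its slice would contain a compact hypersurface with the region on both sides; but this
  separates the hyperplane, by an index function obtained as a continuous logarithm.
\<close>

section \<open>Charts with oriented sides\<close>

text \<open>For fixed \<open>p\<close> the volume is known to be twice differentiable in the
  direction only; no regularity in \<open>p\<close> and no mixed derivative is given. The rate
  estimate therefore compares two volumes for the same direction \<open>m\<close>, with one error
  constant for all \<open>m\<close> near n(p) and all pairs of points near \<open>p\<close>. This
  uniformity stands in for joint smoothness: it yields the derivative of \<open>v\<close>, the
  continuity of b, and the comparison of two gradients at the moving direction n(q).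

  The geometric obstacle is that a cut-off region is a component of a complement, so when the plane
  moves, the region might leak through the part of the plane outside \<open>R\<close>. Finiteness of
  the volume excludes this: each point of a nearby plane outside the barrier is joined, inside the
  wedge and off \<open>M\<close>, to an infinite cone. That all directions near n(p) are admissible
  is part of twice differentiability on the sphere. The hole of the wedge at \<open>p\<close> is
  filled by a ball contained in \<open>D\<close>, since the open set \<open>D\<close> cannot meet
  \<open>M\<close>.\<close>

lemma smooth_on_has_derivative:
  assumes "smooth_on S f" "x \<in> S"
  shows "(f has_derivative frechet_derivative f (at x)) (at x)"
proof -
  have "C_on (Suc 0) S f" using assms(1) unfolding smooth_on_def by blast
  then show ?thesis using assms(2) by (simp add: frechet_derivative_works)
qed

lemma smooth_on_continuous_derivative:
  assumes "smooth_on S f"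
  shows "continuous_on S (\<lambda>x. frechet_derivative f (at x) v)"
proof -
  have "C_on (Suc 0) S f" using assms(1) unfolding smooth_on_def by blast
  then show ?thesis by simp
qed

lemma smooth_on_continuous:
  assumes "smooth_on S f"
  shows "continuous_on S f"
proof -
  have "C_on 0 S f" using assms(1) unfolding smooth_on_def by blast
  then show ?thesis by simp
qed

section \<open>One-sided velocities, and charts as seen by curves\<close>

text \<open>The generators of \<open>tangent_space\<close>, named separately because, unlike their
  span, they need not be closed under negation at a boundary point. That asymmetry is what tells
  boundary points from interior ones.\<close>

definition velocity :: "'n::finite space set \<Rightarrow> 'n space \<Rightarrow> 'n space \<Rightarrow> bool" where
  "velocity M q X \<longleftrightarrow> (\<exists>\<gamma> \<epsilon>. 0 < \<epsilon> \<and> \<gamma> 0 = q \<and> (\<forall>t\<in>{0..<\<epsilon>}. \<gamma> t \<in> M) \<and>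
     (\<gamma> has_vector_derivative X) (at 0 within {0..<\<epsilon>}))"

lemma Int_eq_Collect_iff: "A \<inter> S = {x\<in>S. P x} \<Longrightarrow> x \<in> S \<Longrightarrow> x \<in> A \<longleftrightarrow> P x"
  by blast

lemma velocityI:
  assumes "0 < \<epsilon>" "\<gamma> (0::real) = q" "\<And>t. 0 \<le> t \<Longrightarrow> t < \<epsilon> \<Longrightarrow> \<gamma> t \<in> M"
    "(\<gamma> has_vector_derivative X) (at 0)"
  shows "velocity M q X"
  unfolding velocity_def
  by (rule exI[of _ \<gamma>], rule exI[of _ \<epsilon>])
    (use assms has_vector_derivative_at_within in auto)

lemma tangent_space_velocity: "tangent_space M q = span {X. velocity M q X}"
  by (simp add: tangent_space_def velocity_def)

lemma image_has_vector_derivative: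
  fixes f :: "'a::real_normed_vector \<Rightarrow> real"
  assumes \<gamma>: "(\<gamma> has_vector_derivative X) (at (0::real) within T)"
    and f: "(f has_derivative f') (at (\<gamma> 0))"
  shows "((\<lambda>t. f (\<gamma> t)) has_vector_derivative f' X) (at 0 within T)"
  using vector_derivative_diff_chain_within[OF \<gamma> has_derivative_at_withinI[OF f]]
  by (simp add: comp_def)

text \<open>Makes one-sided derivatives at \<open>0\<close> unique, and turns an eventually
  contradictory property into a contradiction.\<close>

lemma at_0_within_half_open_nontrivial:
  assumes "0 < (\<epsilon>::real)" shows "at 0 within {0..<\<epsilon>} \<noteq> bot"
proof -
  have "at 0 within {0..\<epsilon>/2} \<le> at 0 within {0..<\<epsilon>}"
    using assms by (intro at_le) auto
  moreover have "at 0 within {0..\<epsilon>/2} \<noteq> bot"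
    using assms at_within_Icc_at_right[of 0 "\<epsilon>/2"] trivial_limit_at_right_real[of 0] by simp
  ultimately show ?thesis by (metis bot.extremum_uniqueI)
qed

lemma has_vector_derivative_eventually:
  assumes "(\<gamma> has_vector_derivative X) (at 0 within {0..<\<epsilon>})" "open W" "\<gamma> (0::real) \<in> W"
  shows "\<forall>\<^sub>F t in at 0 within {0..<\<epsilon>}. \<gamma> t \<in> W \<and> t \<in> {0..<\<epsilon>} \<and> t \<noteq> 0"
proof -
  have "(\<gamma> \<longlongrightarrow> \<gamma> 0) (at 0 within {0..<\<epsilon>})"
    using has_vector_derivative_continuous[OF assms(1)] by (simp add: continuous_within)
  then have "\<forall>\<^sub>F t in at 0 within {0..<\<epsilon>}. \<gamma> t \<in> W"
    using assms topological_tendstoD by blast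
  then show ?thesis by (simp add: eventually_at_filter eventually_mono)
qed

text \<open>Along the curve \<open>f\<close> vanishes near time \<open>0\<close>, so its one-sided
  derivative, which is \<open>f' X\<close> by the chain rule, must be zero.\<close>

lemma velocity_annihilates:
  fixes f :: "'n::finite space \<Rightarrow> real"
  assumes v: "velocity M q X" and W: "open W" "q \<in> W"
    and f: "(f has_derivative f') (at q)" and f0: "\<And>x. x \<in> M \<inter> W \<Longrightarrow> f x = 0"
  shows "f' X = 0"
proof -
  obtain \<gamma> \<epsilon> where \<gamma>: "0 < \<epsilon>" "\<gamma> 0 = q" "\<And>t. t \<in> {0..<\<epsilon>} \<Longrightarrow> \<gamma> t \<in> M"
      "(\<gamma> has_vector_derivative X) (at 0 within {0..<\<epsilon>})"
    using v unfolding velocity_def by blast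
  have d: "((\<lambda>t. f (\<gamma> t)) has_vector_derivative f' X) (at 0 within {0..<\<epsilon>})"
    using image_has_vector_derivative[OF \<gamma>(4)] f \<gamma>(2) by simp
  have ev: "\<forall>\<^sub>F t in at 0 within {0..<\<epsilon>}. f (\<gamma> t) = 0"
    by (rule eventually_mono[OF has_vector_derivative_eventually[OF \<gamma>(4) W(1)]])
      (use W(2) \<gamma>(2,3) f0 in auto)
  have f0': "f (\<gamma> 0) = 0" using f0[of q] W(2) \<gamma>(1,2) \<gamma>(3)[of 0] by auto
  have "((\<lambda>t. 0) has_vector_derivative f' X) (at 0 within {0..<\<epsilon>})"
  proof -
    have "((\<lambda>t. f (\<gamma> t)) has_derivative (\<lambda>h. h *\<^sub>R f' X)) (at 0 within {0..<\<epsilon>})"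
      using d by (simp add: has_vector_derivative_def)
    then show ?thesis unfolding has_vector_derivative_def
      by (rule has_derivative_transform_eventually[THEN has_derivative_eq_rhs])
        (use ev f0' \<gamma>(1) in simp_all)
  qed
  from vector_derivative_unique_within[OF at_0_within_half_open_nontrivial[OF \<gamma>(1)] this has_vector_derivative_const]
  show ?thesis .
qed

lemma diffeo_on_derivative_inverse:
  fixes \<phi> :: "'n::finite space \<Rightarrow> 'n space"
  assumes "diffeo_on W \<phi>" "x \<in> W"
  shows "frechet_derivative (inv_into W \<phi>) (at (\<phi> x)) (frechet_derivative \<phi> (at x) X) = X"
    and "frechet_derivative \<phi> (at x) (frechet_derivative (inv_into W \<phi>) (at (\<phi> x)) X) = X"
proof -
  let ?\<psi> = "inv_into W \<phi>"
  have W: "open W" "open (\<phi> ` W)" "inj_on \<phi> W" "smooth_on W \<phi>" "smooth_on (\<phi> ` W) ?\<psi>"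
    using assms(1) unfolding diffeo_on_def by auto
  have d1: "(\<phi> has_derivative frechet_derivative \<phi> (at x)) (at x)"
    using smooth_on_has_derivative[OF W(4) assms(2)] .
  have d2: "(?\<psi> has_derivative frechet_derivative ?\<psi> (at (\<phi> x))) (at (\<phi> x))"
    using smooth_on_has_derivative[OF W(5)] assms(2) by blast
  have inv: "?\<psi> (\<phi> x) = x" using assms(2) W(3) by simp
  have "((?\<psi> \<circ> \<phi>) has_derivative (frechet_derivative ?\<psi> (at (\<phi> x)) \<circ> frechet_derivative \<phi> (at x))) (at x)"
    using diff_chain_at[OF d1 d2] .
  moreover have "((?\<psi> \<circ> \<phi>) has_derivative (\<lambda>h. h)) (at x)"
    by (rule has_derivative_transform_within_open[OF has_derivative_ident W(1) assms(2)])
      (simp add: W(3))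
  ultimately have "frechet_derivative ?\<psi> (at (\<phi> x)) \<circ> frechet_derivative \<phi> (at x) = (\<lambda>h. h)"
    using has_derivative_unique by blast
  then show "frechet_derivative ?\<psi> (at (\<phi> x)) (frechet_derivative \<phi> (at x) X) = X"
    by (metis comp_apply)
  have d1': "(\<phi> has_derivative frechet_derivative \<phi> (at x)) (at (?\<psi> (\<phi> x)))" using d1 inv by simp
  have "((\<phi> \<circ> ?\<psi>) has_derivative (frechet_derivative \<phi> (at x) \<circ> frechet_derivative ?\<psi> (at (\<phi> x)))) (at (\<phi> x))"
    using diff_chain_at[OF d2 d1'] .
  moreover have "((\<phi> \<circ> ?\<psi>) has_derivative (\<lambda>h. h)) (at (\<phi> x))"
    by (rule has_derivative_transform_within_open[OF has_derivative_ident W(2)])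
      (auto simp: assms(2) f_inv_into_f)
  ultimately have "frechet_derivative \<phi> (at x) \<circ> frechet_derivative ?\<psi> (at (\<phi> x)) = (\<lambda>h. h)"
    using has_derivative_unique by blast
  then show "frechet_derivative \<phi> (at x) (frechet_derivative ?\<psi> (at (\<phi> x)) X) = X"
    by (metis comp_apply)
qed

text \<open>The curve is the preimage under \<open>\<phi>\<close> of a straight line. Its
  coordinates are thus exactly affine in \<open>t\<close>, so membership in a set described by
  coordinates can be read off without error terms.\<close>

lemma diffeo_on_curve:
  fixes \<phi> :: "'n::finite space \<Rightarrow> 'n space"
  assumes "diffeo_on W \<phi>" and S: "open S" "S \<subseteq> W" "y \<in> S"
  obtains \<gamma> \<epsilon> where "0 < \<epsilon>" "\<gamma> (0::real) = y" "\<And>t. \<bar>t\<bar> < \<epsilon> \<Longrightarrow> \<gamma> t \<in> S"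
    "\<And>t. \<bar>t\<bar> < \<epsilon> \<Longrightarrow> \<phi> (\<gamma> t) = \<phi> y + t *\<^sub>R frechet_derivative \<phi> (at y) X"
    "(\<gamma> has_vector_derivative X) (at 0)"
proof -
  let ?\<psi> = "inv_into W \<phi>" and ?Z = "frechet_derivative \<phi> (at y) X"
  have W: "open W" "open (\<phi> ` W)" "inj_on \<phi> W" "smooth_on W \<phi>" "smooth_on (\<phi> ` W) ?\<psi>"
    using assms(1) unfolding diffeo_on_def by auto
  have y: "y \<in> W" using S by auto
  have opn: "open (\<phi> ` W \<inter> ?\<psi> -` S)"
    using continuous_open_preimage[OF smooth_on_continuous[OF W(5)] W(2) S(1)] .
  have "\<phi> y \<in> \<phi> ` W \<inter> ?\<psi> -` S" using S W(3) by auto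
  then obtain r where r: "0 < r" "ball (\<phi> y) r \<subseteq> \<phi> ` W \<inter> ?\<psi> -` S"
    using opn openE by blast
  define \<gamma> where "\<gamma> t = ?\<psi> (\<phi> y + t *\<^sub>R ?Z)" for t
  \<comment> \<open>The \<open>+ 1\<close> keeps the quotient meaningful when \<open>?Z\<close> is
    zero.\<close>
  define \<epsilon> where "\<epsilon> = r / (norm ?Z + 1)"
  have \<epsilon>: "0 < \<epsilon>" using r by (simp add: \<epsilon>_def add_nonneg_pos)
  have inb: "\<phi> y + t *\<^sub>R ?Z \<in> ball (\<phi> y) r" if "\<bar>t\<bar> < \<epsilon>" for t
  proof -
    have "\<bar>t\<bar> * norm ?Z \<le> \<bar>t\<bar> * (norm ?Z + 1)" by (intro mult_left_mono) auto
    also have "\<dots> < \<epsilon> * (norm ?Z + 1)" using that by (intro mult_strict_right_mono) (auto simp: add_nonneg_pos)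
    also have "\<dots> = r" by (simp add: \<epsilon>_def add_nonneg_eq_0_iff)
    finally show ?thesis by (simp add: dist_norm)
  qed
  have d2: "(?\<psi> has_derivative frechet_derivative ?\<psi> (at (\<phi> y))) (at (\<phi> y + 0 *\<^sub>R ?Z))"
    using smooth_on_has_derivative[OF W(5)] y by simp
  have d1: "((\<lambda>t. \<phi> y + t *\<^sub>R ?Z) has_vector_derivative ?Z) (at 0)"
    by (auto intro!: derivative_eq_intros)
  have "((?\<psi> \<circ> (\<lambda>t. \<phi> y + t *\<^sub>R ?Z)) has_vector_derivative frechet_derivative ?\<psi> (at (\<phi> y)) ?Z) (at 0)"
    using vector_derivative_diff_chain_within[of "\<lambda>t. \<phi> y + t *\<^sub>R ?Z" ?Z 0 UNIV ?\<psi>] d1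
      has_derivative_at_withinI[OF d2] by simp
  then have "(\<gamma> has_vector_derivative X) (at 0)"
    using diffeo_on_derivative_inverse(1)[OF assms(1) y, of X] unfolding \<gamma>_def comp_def by simp
  then have vd: "(\<gamma> has_vector_derivative X) (at 0)" .
  have *: "\<phi> y + t *\<^sub>R ?Z \<in> \<phi> ` W \<inter> ?\<psi> -` S" if "\<bar>t\<bar> < \<epsilon>" for t
    using inb[OF that] r(2) by blast
  show ?thesis
  proof (rule that[OF \<epsilon> _ _ _ vd])
    show "\<gamma> 0 = y" by (simp add: \<gamma>_def y W(3))
    fix t assume "\<bar>t\<bar> < \<epsilon>"
    note * = *[OF this]
    then show "\<gamma> t \<in> S" by (simp add: \<gamma>_def)
    show "\<phi> (\<gamma> t) = \<phi> y + t *\<^sub>R ?Z" unfolding \<gamma>_def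
      by (rule f_inv_into_f) (use * in blast)
  qed
qed

text \<open>The coordinate line in direction \<open>X\<close> stays in the level \<open>0\<close> of
  the coordinate \<open>None\<close>. Both \<open>X\<close> and \<open>- X\<close> qualify, so in a
  flat chart the velocities contain a full hyperplane.\<close>

lemma velocity_flat_chart:
  fixes \<phi> :: "'n::finite space \<Rightarrow> 'n space"
  assumes "diffeo_on W \<phi>" and S: "open S" "S \<subseteq> W" "y \<in> S" "y \<in> M"
    and M: "M \<inter> S = {x\<in>S. \<phi> x $ None = 0}"
    and X: "frechet_derivative \<phi> (at y) X $ None = 0"
  shows "velocity M y X"
proof -
  obtain \<gamma> \<epsilon> where \<gamma>: "0 < \<epsilon>" "\<gamma> (0::real) = y" "\<And>t. \<bar>t\<bar> < \<epsilon> \<Longrightarrow> \<gamma> t \<in> S"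
    "\<And>t. \<bar>t\<bar> < \<epsilon> \<Longrightarrow> \<phi> (\<gamma> t) = \<phi> y + t *\<^sub>R frechet_derivative \<phi> (at y) X"
    "(\<gamma> has_vector_derivative X) (at 0)"
    using diffeo_on_curve[OF assms(1) S(1-3)] by blast
  note Miff = Int_eq_Collect_iff[OF M]
  have "\<phi> y $ None = 0" using Miff[OF S(3)] S(4) by simp
  then have "\<gamma> t \<in> M" if "0 \<le> t" "t < \<epsilon>" for t
    using \<gamma>(3,4)[of t] Miff[of "\<gamma> t"] X that by simp
  from velocityI[OF \<gamma>(1,2) this \<gamma>(5)] show ?thesis .
qed

text \<open>
  At a point of the boundary hyperplane of a boundary chart some velocity has no opposite, whereas the
  velocities in a flat chart form a vector space.
\<close>

lemma flat_chart_not_boundary_chart: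
  fixes \<phi> :: "'n::finite space \<Rightarrow> 'n space"
  assumes "diffeo_on W \<phi>" and S: "open S" "S \<subseteq> W" "y \<in> S" "y \<in> M"
    and M: "M \<inter> S = {x\<in>S. \<phi> x $ None = 0}"
  shows "\<not> boundary_chart M y"
proof
  assume "boundary_chart M y"
  then obtain V and \<psi> :: "'n space \<Rightarrow> 'n space" and i where V: "diffeo_on V \<psi>" "y \<in> V" "\<psi> y $ Some i = 0"
    and MV: "M \<inter> V = {x\<in>V. \<psi> x $ None = 0 \<and> 0 \<le> \<psi> x $ Some i}"
    unfolding boundary_chart_def by blast
  have oV: "open V" using V(1) by (simp add: diffeo_on_def)
  \<comment> \<open>The inward coordinate vector of the boundary chart; moving along it keeps the
    boundary coordinate nonnegative.\<close>
  define X where "X = frechet_derivative (inv_into V \<psi>) (at (\<psi> y)) (axis (Some i) 1)"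
  have DX: "frechet_derivative \<psi> (at y) X = axis (Some i) 1"
    using diffeo_on_derivative_inverse(2)[OF V(1,2)] unfolding X_def by blast
  obtain \<gamma> \<epsilon> where \<gamma>: "0 < \<epsilon>" "\<gamma> (0::real) = y" "\<And>t. \<bar>t\<bar> < \<epsilon> \<Longrightarrow> \<gamma> t \<in> V"
    "\<And>t. \<bar>t\<bar> < \<epsilon> \<Longrightarrow> \<psi> (\<gamma> t) = \<psi> y + t *\<^sub>R frechet_derivative \<psi> (at y) X"
    "(\<gamma> has_vector_derivative X) (at 0)"
    using diffeo_on_curve[OF V(1) oV order_refl V(2)] by blast
  note MViff = Int_eq_Collect_iff[OF MV] and Miff = Int_eq_Collect_iff[OF M]
  have "\<psi> y $ None = 0" using MViff[OF V(2)] S(4) by simp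
  then have "\<gamma> t \<in> M" if "0 \<le> t" "t < \<epsilon>" for t
    using \<gamma>(3,4)[of t] MViff[of "\<gamma> t"] DX V(3) that by (simp add: axis_def)
  from velocityI[OF \<gamma>(1,2) this \<gamma>(5)] have v: "velocity M y X" .
  have yW: "y \<in> W" using S by auto
  have dW: "(\<phi> has_derivative frechet_derivative \<phi> (at y)) (at y)"
    using smooth_on_has_derivative assms(1) yW unfolding diffeo_on_def by blast
  then have "((\<lambda>x. \<phi> x $ None) has_derivative (\<lambda>h. frechet_derivative \<phi> (at y) h $ None)) (at y)"
    by (rule bounded_linear.has_derivative[OF bounded_linear_vec_nth])
  then have "frechet_derivative \<phi> (at y) X $ None = 0"
    by (rule velocity_annihilates[OF v S(1) S(3)]) (use Miff in blast)
  then have "frechet_derivative \<phi> (at y) (- X) $ None = 0"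
    using linear_neg[OF has_derivative_linear[OF dW]] by simp
  then have "velocity M y (- X)" using velocity_flat_chart[OF assms] by blast
  then obtain \<eta> \<delta> where \<eta>: "0 < \<delta>" "\<eta> 0 = y" "\<And>t. t \<in> {0..<\<delta>} \<Longrightarrow> \<eta> t \<in> M"
      "(\<eta> has_vector_derivative - X) (at 0 within {0..<\<delta>})"
    unfolding velocity_def by blast
  have dV: "(\<psi> has_derivative frechet_derivative \<psi> (at y)) (at (\<eta> 0))"
    using smooth_on_has_derivative V \<eta>(2) unfolding diffeo_on_def by blast
  then have "((\<lambda>x. \<psi> x $ Some i) has_derivative (\<lambda>h. frechet_derivative \<psi> (at y) h $ Some i)) (at (\<eta> 0))"
    by (rule bounded_linear.has_derivative[OF bounded_linear_vec_nth])
  from image_has_vector_derivative[OF \<eta>(4) this]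
  \<comment> \<open>The curve with velocity \<open>- X\<close> starts on the boundary and decreases
    the boundary coordinate at unit rate, although this coordinate is nonnegative on
    \<open>M\<close>.\<close>
  have "((\<lambda>t. \<psi> (\<eta> t) $ Some i) has_vector_derivative - 1) (at 0 within {0..<\<delta>})"
    using DX linear_neg[OF has_derivative_linear[OF dV]] by (simp add: axis_def)
  then have "((\<lambda>t. (\<psi> (\<eta> t) $ Some i - \<psi> (\<eta> 0) $ Some i) / (t - 0)) \<longlongrightarrow> - 1) (at 0 within {0..<\<delta>})"
    unfolding has_real_derivative_iff_has_vector_derivative[symmetric] has_field_derivative_iff .
  then have ev1: "\<forall>\<^sub>F t in at 0 within {0..<\<delta>}. (\<psi> (\<eta> t) $ Some i - \<psi> (\<eta> 0) $ Some i) / (t - 0) < 0"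
    by (rule order_tendstoD(2)) simp
  have ev2: "\<forall>\<^sub>F t in at 0 within {0..<\<delta>}. \<eta> t \<in> V \<and> t \<in> {0..<\<delta>} \<and> t \<noteq> 0"
    using has_vector_derivative_eventually[OF \<eta>(4) oV] \<eta>(2) V(2) by simp
  have "\<forall>\<^sub>F t in at 0 within {0..<\<delta>}. False"
    using ev1 ev2
  proof eventually_elim
    case (elim t)
    then have "\<psi> (\<eta> t) $ Some i < 0" using \<eta>(2) V(3) by (simp add: divide_less_0_iff)
    moreover have "0 \<le> \<psi> (\<eta> t) $ Some i" using elim \<eta>(3)[of t] MViff[of "\<eta> t"] by simp
    ultimately show ?case by simp
  qed
  then show False
    using at_0_within_half_open_nontrivial[OF \<eta>(1)] by simp
qed

text \<open>\<open>f\<close> is a local equation of \<open>M\<close> with gradient \<open>g\<close>, increasing in the direction of the normal \<open>\<nu>\<close>.\<close>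

definition side_chart :: "'n::finite space set \<Rightarrow> ('n space \<Rightarrow> 'n space) \<Rightarrow> 'n space set \<Rightarrow>
    ('n space \<Rightarrow> real) \<Rightarrow> ('n space \<Rightarrow> 'n space) \<Rightarrow> bool" where
  "side_chart M \<nu> W f g \<longleftrightarrow> open W \<and> (\<forall>x\<in>W. (f has_derivative (\<lambda>h. g x \<bullet> h)) (at x)) \<and>
     continuous_on W g \<and> M \<inter> W = {x\<in>W. f x = 0} \<and> (\<forall>y\<in>M \<inter> W. 0 < \<nu> y \<bullet> g y) \<and>
     W \<inter> mboundary M = {}"

lemma linear_functional_inner:
  fixes L :: "'a::euclidean_space \<Rightarrow> real"
  assumes "linear L"
  shows "L h = (\<Sum>b\<in>Basis. L b *\<^sub>R b) \<bullet> h"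
proof -
  have "L h = L (\<Sum>b\<in>Basis. (h \<bullet> b) *\<^sub>R b)" by (simp add: euclidean_representation)
  also have "\<dots> = (\<Sum>b\<in>Basis. (h \<bullet> b) * L b)"
    using assms by (simp add: linear_sum linear_scale)
  also have "\<dots> = (\<Sum>b\<in>Basis. L b *\<^sub>R b) \<bullet> h"
    by (simp add: inner_sum_left inner_commute[of h] mult.commute)
  finally show ?thesis .
qed

text \<open>The local equation is the coordinate \<open>None\<close> of a chart, up to sign. Its
  gradient is not orthogonal to \<open>\<nu>\<close> on \<open>M\<close>: otherwise
  \<open>\<nu>\<close> itself would be a velocity, hence tangent.\<close>

lemma side_chart_exists:
  fixes M :: "'n::finite space set"
  assumes M: "smooth_hypersurface M" and \<nu>: "unit_normal M \<nu>" and q: "q \<in> M - mboundary M"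
  obtains W f g where "side_chart M \<nu> W f g" "q \<in> W"
proof -
  have "interior_chart M q"
    using M q unfolding smooth_hypersurface_def mboundary_def by blast
  then obtain W0 and \<phi> :: "'n space \<Rightarrow> 'n space" where W0: "diffeo_on W0 \<phi>" "q \<in> W0"
    and MW0: "M \<inter> W0 = {x\<in>W0. \<phi> x $ None = 0}"
    unfolding interior_chart_def by blast
  have o0: "open W0" and sm: "smooth_on W0 \<phi>" using W0 by (auto simp: diffeo_on_def)
  note Miff = Int_eq_Collect_iff[OF MW0]
  define G where "G x = (\<Sum>b\<in>Basis. (frechet_derivative \<phi> (at x) b $ None) *\<^sub>R b)" for x
  have d\<phi>: "(\<phi> has_derivative frechet_derivative \<phi> (at x)) (at x)" if "x \<in> W0" for x
    using smooth_on_has_derivative[OF sm that] .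
  have G: "frechet_derivative \<phi> (at x) h $ None = G x \<bullet> h" if "x \<in> W0" for x h
  proof -
    have "((\<lambda>x. \<phi> x $ None) has_derivative (\<lambda>h. frechet_derivative \<phi> (at x) h $ None)) (at x)"
      using d\<phi>[OF that] by (rule bounded_linear.has_derivative[OF bounded_linear_vec_nth])
    from linear_functional_inner[OF has_derivative_linear[OF this]]
    show ?thesis unfolding G_def .
  qed
  have dF: "((\<lambda>x. \<phi> x $ None) has_derivative (\<lambda>h. G x \<bullet> h)) (at x)" if "x \<in> W0" for x
  proof -
    have "((\<lambda>x. \<phi> x $ None) has_derivative (\<lambda>h. frechet_derivative \<phi> (at x) h $ None)) (at x)"
      using d\<phi>[OF that] by (rule bounded_linear.has_derivative[OF bounded_linear_vec_nth])
    then show ?thesis unfolding G[OF that] .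
  qed
  have contG: "continuous_on W0 G"
    unfolding G_def by (intro continuous_intros continuous_on_component smooth_on_continuous_derivative[OF sm])
  have nz: "\<nu> y \<bullet> G y \<noteq> 0" if y: "y \<in> M" "y \<in> W0" for y
  proof
    assume "\<nu> y \<bullet> G y = 0"
    then have "frechet_derivative \<phi> (at y) (\<nu> y) $ None = 0" using G[OF y(2)] by (simp add: inner_commute)
    then have "velocity M y (\<nu> y)"
      using velocity_flat_chart[OF W0(1) o0 order_refl y(2,1) MW0] by blast
    then have "\<nu> y \<in> tangent_space M y" unfolding tangent_space_velocity by (simp add: span_base)
    then have "\<nu> y \<bullet> \<nu> y = 0" "norm (\<nu> y) = 1" using \<nu> y(1) unfolding unit_normal_def by auto
    then show False by simp
  qed
  have nb: "y \<notin> mboundary M" if y: "y \<in> W0" for y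
    using flat_chart_not_boundary_chart[OF W0(1) o0 order_refl y _ MW0]
    unfolding mboundary_def by blast
  have "smooth_along M \<nu>" using \<nu> by (simp add: unit_normal_def)
  then obtain W1 g1 where W1: "open W1" "q \<in> W1" "smooth_on W1 g1" "\<And>y. y \<in> M \<inter> W1 \<Longrightarrow> g1 y = \<nu> y"
    unfolding smooth_along_def using q by (meson DiffD1)
  define \<sigma> where "\<sigma> = sgn (\<nu> q \<bullet> G q)"
  have \<sigma>: "\<sigma> = 1 \<or> \<sigma> = -1" "\<sigma> * (\<nu> q \<bullet> G q) > 0"
    using nz[of q] q W0(2) by (auto simp: \<sigma>_def sgn_real_def)
  \<comment> \<open>\<open>\<nu>\<close> is only given along \<open>M\<close>; its local extension
    \<open>g1\<close> makes the sign condition an open one on the ambient space.\<close>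
  define W where "W = (W0 \<inter> W1) \<inter> (\<lambda>x. \<sigma> * (g1 x \<bullet> G x)) -` {0<..}"
  have "continuous_on (W0 \<inter> W1) (\<lambda>x. \<sigma> * (g1 x \<bullet> G x))"
    by (intro continuous_intros continuous_on_subset[OF contG] continuous_on_subset[OF smooth_on_continuous[OF W1(3)]]) auto
  then have oW: "open W" unfolding W_def
    using o0 W1(1) by (intro continuous_open_preimage) auto
  have qW: "q \<in> W" using W0(2) W1(2) W1(4)[of q] q \<sigma>(2) by (simp add: W_def)
  have "side_chart M \<nu> W (\<lambda>x. \<sigma> * \<phi> x $ None) (\<lambda>x. \<sigma> *\<^sub>R G x)"
    unfolding side_chart_def
  proof (intro conjI ballI)
    fix x assume "x \<in> W"
    then have "((\<lambda>x. \<phi> x $ None) has_derivative (\<lambda>h. G x \<bullet> h)) (at x)" using dF by (simp add: W_def)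
    then show "((\<lambda>x. \<sigma> * \<phi> x $ None) has_derivative (\<lambda>h. (\<sigma> *\<^sub>R G x) \<bullet> h)) (at x)"
      by (auto intro!: derivative_eq_intros)
  next
    show "continuous_on W (\<lambda>x. \<sigma> *\<^sub>R G x)"
      by (intro continuous_intros continuous_on_subset[OF contG]) (auto simp: W_def)
    have "\<sigma> \<noteq> 0" using \<sigma>(1) by auto
    then show "M \<inter> W = {x\<in>W. \<sigma> * \<phi> x $ None = 0}"
      by (auto simp: W_def Miff)
  next
    fix y assume "y \<in> M \<inter> W"
    then show "0 < \<nu> y \<bullet> \<sigma> *\<^sub>R G y" using W1(4)[of y] by (auto simp: W_def)
  next
    show "W \<inter> mboundary M = {}" using nb by (auto simp: W_def)
  qed (rule oW)
  then show ?thesis using that qW by blast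
qed

lemma side_chart_subset:
  assumes "side_chart M \<nu> W f g" "open S" "S \<subseteq> W"
  shows "side_chart M \<nu> S f g"
  using assms unfolding side_chart_def by (auto intro: continuous_on_subset)

lemma side_chart_continuous:
  assumes "side_chart M \<nu> W f g"
  shows "continuous_on W f"
  using assms unfolding side_chart_def
  by (metis continuous_at_imp_continuous_on has_derivative_continuous)

lemma side_chart_iff:
  assumes "side_chart M \<nu> W f g" "x \<in> W"
  shows "x \<in> M \<longleftrightarrow> f x = 0"
  using assms unfolding side_chart_def by blast

text \<open>If the gradient annihilated all directions of the hyperplane, it would be a multiple of
  \<open>n\<close>. All velocities, being annihilated by the gradient, would then be orthogonal to
  \<open>n\<close>, against transversality. The resulting \<open>e\<close> runs inside the
  hyperplane and crosses \<open>M\<close>.\<close>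

lemma side_chart_transversal:
  fixes M :: "'n::finite space set"
  assumes sc: "side_chart M \<nu> W f g" and y: "y \<in> M" "y \<in> W"
    and T: "\<not> tangent_space M y \<subseteq> perp n"
  obtains e where "norm e = 1" "n \<bullet> e = 0" "0 < g y \<bullet> e"
proof -
  have "\<exists>e. n \<bullet> e = 0 \<and> g y \<bullet> e \<noteq> 0"
  proof (rule ccontr)
    assume a: "\<not> ?thesis"
    have gv: "g y \<bullet> X = 0" if "velocity M y X" for X
      using velocity_annihilates[OF that, of W f "\<lambda>h. g y \<bullet> h"] sc y
      unfolding side_chart_def by blast
    have "\<nu> y \<bullet> g y \<noteq> 0" using sc y unfolding side_chart_def by fastforce
    then have g0: "g y \<noteq> 0" by auto
    have n0: "n \<noteq> 0" using T by (auto simp: perp_def)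
    define w where "w = g y - ((n \<bullet> g y) / (n \<bullet> n)) *\<^sub>R n"
    have nw: "n \<bullet> w = 0" using n0 by (simp add: w_def inner_diff_right)
    then have "g y \<bullet> w = 0" using a by blast
    then have "w \<bullet> w = 0" using nw by (simp add: w_def inner_diff_left)
    then have gy: "g y = ((n \<bullet> g y) / (n \<bullet> n)) *\<^sub>R n" by (simp add: w_def)
    then have c0: "(n \<bullet> g y) / (n \<bullet> n) \<noteq> 0" using g0 by (metis scaleR_zero_left)
    have "n \<bullet> X = 0" if "velocity M y X" for X
    proof -
      have "((n \<bullet> g y) / (n \<bullet> n)) * (n \<bullet> X) = 0"
        using gv[OF that] gy by (metis inner_scaleR_left)
      then show ?thesis using c0 by simp
    qed
    then have "{X. velocity M y X} \<subseteq> perp n" by (auto simp: perp_def)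
    moreover have "subspace (perp n)"
      by (auto simp: perp_def subspace_def inner_add_right)
    ultimately have "tangent_space M y \<subseteq> perp n"
      unfolding tangent_space_velocity by (rule span_minimal)
    then show False using T by blast
  qed
  then obtain e where e: "n \<bullet> e = 0" "g y \<bullet> e \<noteq> 0" by blast
  define s where "s = sgn (g y \<bullet> e) / norm e"
  have "e \<noteq> 0" using e by auto
  then show ?thesis
    using e by (intro that[of "s *\<^sub>R e"]) (auto simp: s_def sgn_real_def)
qed

section \<open>Cylinders in which both sides of the hypersurface are connected\<close>

text \<open>For a unit vector \<open>e\<close> this is the open cylinder about \<open>q\<close> with
  axis \<open>e\<close>, half-height \<open>a\<close> and radius \<open>b\<close>. Height and radius
  are separate parameters because the height is fixed before the radius is chosen.\<close>

definition box_nbhd :: "'a::real_inner \<Rightarrow> 'a \<Rightarrow> real \<Rightarrow> real \<Rightarrow> 'a set" where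
  "box_nbhd e q a b = {x. \<bar>e \<bullet> (x - q)\<bar> < a \<and> norm ((x - q) - (e \<bullet> (x - q)) *\<^sub>R e) < b}"

lemma box_nbhd_uminus: "box_nbhd (- e) q a b = box_nbhd e q a b"
  by (simp add: box_nbhd_def)

lemma open_box_nbhd: "open (box_nbhd e q a b)"
  unfolding box_nbhd_def
  by (intro open_Collect_conj open_Collect_less continuous_intros)

lemma convex_box_nbhd: "convex (box_nbhd e q a b)"
proof -
  have lin: "linear (\<lambda>x. e \<bullet> x)" "linear (\<lambda>x. x - (e \<bullet> x) *\<^sub>R e)"
    by (auto intro!: linearI simp: inner_add_right algebra_simps)
  have "box_nbhd e q a b = (\<lambda>x. q + x) ` ((\<lambda>x. e \<bullet> x) -` {-a<..<a} \<inter> (\<lambda>x. x - (e \<bullet> x) *\<^sub>R e) -` ball 0 b)"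
    (is "_ = _ ` ?S")
  proof -
    have "x \<in> (\<lambda>x. q + x) ` ?S \<longleftrightarrow> x - q \<in> ?S" for x
      by (metis (no_types, lifting) add.commute diff_add_cancel image_iff add_diff_cancel_left')
    then show ?thesis by (auto simp: box_nbhd_def)
  qed
  then show ?thesis
    using lin by (auto intro!: convex_translation convex_Int convex_linear_vimage)
qed

lemma box_nbhd_subset_ball:
  assumes "norm e = 1" "a + b \<le> r"
  shows "box_nbhd e q a b \<subseteq> ball q r"
proof
  fix x assume x: "x \<in> box_nbhd e q a b"
  have "norm (x - q) = norm ((e \<bullet> (x - q)) *\<^sub>R e + ((x - q) - (e \<bullet> (x - q)) *\<^sub>R e))" by simp
  also have "\<dots> \<le> norm ((e \<bullet> (x - q)) *\<^sub>R e) + norm ((x - q) - (e \<bullet> (x - q)) *\<^sub>R e)" by (rule norm_triangle_ineq)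
  also have "\<dots> < a + b" using x assms(1) by (simp add: box_nbhd_def)
  finally show "x \<in> ball q r" using assms(2) by (simp add: dist_norm norm_minus_commute)
qed

lemma directional_increase:
  fixes f :: "'a::euclidean_space \<Rightarrow> real"
  assumes d: "\<And>x. x \<in> W \<Longrightarrow> (f has_derivative (\<lambda>h. g x \<bullet> h)) (at x)"
    and pos: "\<And>x. x \<in> W \<Longrightarrow> 0 < g x \<bullet> e"
    and W: "convex W" "x \<in> W" "x + u *\<^sub>R e \<in> W" and u: "0 < u"
  shows "f x < f (x + u *\<^sub>R e)"
proof -
  have inW: "x + t *\<^sub>R e \<in> W" if "0 \<le> t" "t \<le> u" for t
  proof -
    have "x + t *\<^sub>R e = (1 - t/u) *\<^sub>R x + (t/u) *\<^sub>R (x + u *\<^sub>R e)"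
      using u by (simp add: algebra_simps)
    moreover have "(1 - t/u) *\<^sub>R x + (t/u) *\<^sub>R (x + u *\<^sub>R e) \<in> W"
      using that u by (intro convexD[OF W]) auto
    ultimately show ?thesis by simp
  qed
  have "\<exists>y. DERIV (\<lambda>t. f (x + t *\<^sub>R e)) t :> y \<and> 0 < y" if "0 \<le> t" "t \<le> u" for t
  proof (intro exI conjI)
    have "((\<lambda>t. x + t *\<^sub>R e) has_derivative (\<lambda>h. h *\<^sub>R e)) (at t)"
      by (auto intro!: derivative_eq_intros)
    then have "((\<lambda>t. f (x + t *\<^sub>R e)) has_derivative (\<lambda>h. g (x + t *\<^sub>R e) \<bullet> (h *\<^sub>R e))) (at t)"
      using d[OF inW[OF that]]
      by (rule has_derivative_compose[where g = f and f = "\<lambda>t. x + t *\<^sub>R e"])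
    then show "DERIV (\<lambda>t. f (x + t *\<^sub>R e)) t :> g (x + t *\<^sub>R e) \<bullet> e"
      unfolding has_field_derivative_def by (rule has_derivative_eq_rhs) (simp add: fun_eq_iff)
  qed (use pos inW that in auto)
  from DERIV_pos_imp_increasing[OF u, of "\<lambda>t. f (x + t *\<^sub>R e)", OF this]
  show ?thesis by simp
qed

lemma box_nbhd_shift:
  assumes "norm e = 1" "x \<in> box_nbhd e q a b" "\<bar>e \<bullet> (x - q) + s\<bar> < a"
  shows "x + s *\<^sub>R e \<in> box_nbhd e q a b"
proof -
  have "e \<bullet> e = 1" using assms(1) by (simp add: norm_eq_1)
  then have *: "e \<bullet> (x + s *\<^sub>R e - q) = e \<bullet> (x - q) + s" by (simp add: algebra_simps inner_add_right inner_diff_right)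
  have **: "x + s *\<^sub>R e - q - (e \<bullet> (x - q) + s) *\<^sub>R e = x - q - (e \<bullet> (x - q)) *\<^sub>R e"
    by (simp add: algebra_simps)
  show ?thesis using assms(2,3) unfolding box_nbhd_def mem_Collect_eq * ** by blast
qed

text \<open>\<open>f\<close> increases along \<open>e\<close>, so a point with \<open>f\<close>
  positive can be lifted along the axis to height \<open>a/2\<close> without losing positivity, and
  the part of the cylinder above that height is convex. The set \<open>S\<close> allows the same
  argument in the whole space and inside a hyperplane that contains the direction
  \<open>e\<close>.\<close>

lemma connected_positive_side_box:
  fixes f :: "'a::euclidean_space \<Rightarrow> real" and e q :: 'a and a b :: real
  defines "B \<equiv> box_nbhd e q a b"
  assumes d: "\<And>x. x \<in> B \<Longrightarrow> (f has_derivative (\<lambda>h. g x \<bullet> h)) (at x)"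
    and pos: "\<And>x. x \<in> B \<Longrightarrow> 0 < g x \<bullet> e" and e: "norm e = 1" and ab: "0 < a" "0 < b"
    and top: "\<And>x. x \<in> B \<Longrightarrow> e \<bullet> (x - q) = a/2 \<Longrightarrow> 0 < f x"
    and S: "convex S" "q \<in> S" "\<And>x t. x \<in> S \<Longrightarrow> x + t *\<^sub>R e \<in> S"
  shows "connected (S \<inter> B \<inter> {x. 0 < f x})"
proof -
  have ee: "e \<bullet> e = 1" using e by (simp add: norm_eq_1)
  have cB: "convex B" unfolding B_def by (rule convex_box_nbhd)
  have inc: "f x < f (x + u *\<^sub>R e)" if "x \<in> B" "x + u *\<^sub>R e \<in> B" "0 < u" for x u
    by (rule directional_increase[where W = B and g = g]) (use d pos cB that in auto)
  have shift: "x + s *\<^sub>R e \<in> B" if "x \<in> B" "\<bar>e \<bullet> (x - q) + s\<bar> < a" for x s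
    using box_nbhd_shift[OF e] that unfolding B_def by blast
  define T where "T = S \<inter> B \<inter> {x. a/2 \<le> e \<bullet> (x - q)}"
  have "{x. a/2 \<le> e \<bullet> (x - q)} = {x. e \<bullet> x \<ge> a/2 + e \<bullet> q}" by (auto simp: inner_diff_right)
  then have "convex T" unfolding T_def using S(1) cB convex_halfspace_ge by (metis convex_Int)
  then have cT: "connected T" by (rule convex_connected)
  have fT: "0 < f x" if "x \<in> T" for x
  proof (cases "e \<bullet> (x - q) = a/2")
    case True then show ?thesis using top that by (auto simp: T_def)
  next
    case False
    define s where "s = e \<bullet> (x - q) - a/2"
    have s: "0 < s" using that False by (auto simp: T_def s_def)
    have x: "x \<in> B" using that by (simp add: T_def)
    have m: "x + (- s) *\<^sub>R e \<in> B" by (rule shift) (use x ab in \<open>auto simp: s_def\<close>)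
    have "e \<bullet> (x + (- s) *\<^sub>R e - q) = a/2" using ee by (simp add: s_def inner_diff_right inner_add_right)
    then have "0 < f (x + (- s) *\<^sub>R e)" using top m by blast
    also have "\<dots> < f (x + (- s) *\<^sub>R e + s *\<^sub>R e)" by (rule inc) (use m x s in auto)
    finally show ?thesis by simp
  qed
  have qB: "q \<in> B" using ab by (simp add: B_def box_nbhd_def)
  have "q + (a/2) *\<^sub>R e \<in> B" by (rule shift) (use qB ab in auto)
  then have tT: "q + (a/2) *\<^sub>R e \<in> T" using S ee by (simp add: T_def)
  let ?X = "S \<inter> B \<inter> {x. 0 < f x}"
  \<comment> \<open>Points already above height \<open>a/2\<close> stay where they are.\<close>
  define up where "up x = x + max 0 (a/2 - e \<bullet> (x - q)) *\<^sub>R e" for x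
  have upT: "up x \<in> T" if "x \<in> ?X" for x
  proof -
    have "\<bar>e \<bullet> (x - q)\<bar> < a" using that by (simp add: B_def box_nbhd_def)
    then have "up x \<in> B" unfolding up_def using that ab by (intro shift) (auto simp: max_def)
    moreover have "a/2 \<le> e \<bullet> (up x - q)" using ee by (simp add: up_def inner_diff_right inner_add_right max_def)
    ultimately show ?thesis using S(3) that by (simp add: T_def up_def)
  qed
  have seg: "closed_segment x (up x) \<subseteq> ?X" if x: "x \<in> ?X" for x
  proof
    fix y assume y: "y \<in> closed_segment x (up x)"
    have "convex (S \<inter> B)" using S(1) cB by (simp add: convex_Int)
    then have yB: "y \<in> S \<inter> B" using y x upT[OF x] closed_segment_subset[of x "S \<inter> B" "up x"] by (auto simp: T_def)
    obtain t where t: "0 \<le> t" "t \<le> 1" "y = (1 - t) *\<^sub>R x + t *\<^sub>R up x"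
      using y by (auto simp: in_segment)
    define u where "u = t * max 0 (a/2 - e \<bullet> (x - q))"
    have y': "y = x + u *\<^sub>R e" using t(3) by (simp add: up_def u_def algebra_simps)
    have "0 \<le> u" using t by (simp add: u_def)
    then have "f x \<le> f y" using inc[of x u] x yB y' by (cases "u = 0") auto
    then show "y \<in> ?X" using yB x by auto
  qed
  have TX: "T \<subseteq> ?X" using fT by (auto simp: T_def)
  have "?X = (\<Union>x\<in>?X. closed_segment x (up x) \<union> T)"
  proof (intro subset_antisym subsetI)
    fix x assume "x \<in> ?X" then show "x \<in> (\<Union>x\<in>?X. closed_segment x (up x) \<union> T)"
      by (intro UN_I[of x]) auto
  next
    fix y assume "y \<in> (\<Union>x\<in>?X. closed_segment x (up x) \<union> T)"
    then obtain x where "x \<in> ?X" "y \<in> closed_segment x (up x) \<union> T" by (elim UN_E)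
    then show "y \<in> ?X" using seg[of x] TX by (meson UnE subsetD)
  qed
  moreover have "connected (\<Union>x\<in>?X. closed_segment x (up x) \<union> T)"
  proof (rule connected_Union)
    fix Y assume "Y \<in> (\<lambda>x. closed_segment x (up x) \<union> T) ` ?X"
    then obtain x where x: "x \<in> ?X" "Y = closed_segment x (up x) \<union> T" by blast
    have "closed_segment x (up x) \<inter> T \<noteq> {}" using upT[OF x(1)] by auto
    then show "connected Y" unfolding x(2)
      using connected_Un[OF connected_segment(1) cT] by blast
  next
    have "q + (a/2) *\<^sub>R e \<in> \<Inter> ((\<lambda>x. closed_segment x (up x) \<union> T) ` ?X)" using tT by blast
    then show "\<Inter> ((\<lambda>x. closed_segment x (up x) \<union> T) ` ?X) \<noteq> {}" by blast
  qed
  ultimately show ?thesis by simp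
qed

text \<open>First the height is fixed so that \<open>f\<close> is positive at one end of the axis
  and negative at the other; then the radius is taken so small that these signs persist on the discs
  at heights \<open>a/2\<close> and \<open>-a/2\<close>. The negative side is the positive side for
  \<open>- f\<close> and \<open>- e\<close>.\<close>

lemma box_nbhd_sides:
  fixes f :: "'a::euclidean_space \<Rightarrow> real"
  assumes W: "open W" "q \<in> W" and d: "\<And>x. x \<in> W \<Longrightarrow> (f has_derivative (\<lambda>h. g x \<bullet> h)) (at x)"
    and g: "continuous_on W g" and f0: "f q = 0" and e: "norm e = 1" and ge: "0 < g q \<bullet> e"
  obtains a b where "0 < a" "0 < b" "box_nbhd e q a b \<subseteq> W"
    "\<And>S. convex S \<Longrightarrow> q \<in> S \<Longrightarrow> (\<And>x t. x \<in> S \<Longrightarrow> x + t *\<^sub>R e \<in> S) \<Longrightarrow>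
       connected (S \<inter> box_nbhd e q a b \<inter> {x. 0 < f x}) \<and> connected (S \<inter> box_nbhd e q a b \<inter> {x. f x < 0})"
    "\<And>t. 0 < t \<Longrightarrow> t < a \<Longrightarrow> 0 < f (q + t *\<^sub>R e) \<and> f (q - t *\<^sub>R e) < 0"
    "\<And>t. \<bar>t\<bar> < a \<Longrightarrow> q + t *\<^sub>R e \<in> box_nbhd e q a b"
proof -
  have ee: "e \<bullet> e = 1" using e by (simp add: norm_eq_1)
  have "open (W \<inter> (\<lambda>x. g x \<bullet> e) -` {0<..})"
    by (intro continuous_open_preimage continuous_intros g W)
  moreover have "q \<in> W \<inter> (\<lambda>x. g x \<bullet> e) -` {0<..}" using W ge by simp
  ultimately obtain r where r: "0 < r" "ball q r \<subseteq> W \<inter> (\<lambda>x. g x \<bullet> e) -` {0<..}"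
    using openE by blast
  define a where "a = r/2"
  have a: "0 < a" using r by (simp add: a_def)
  have inb: "q + t *\<^sub>R e \<in> ball q r" if "\<bar>t\<bar> < r" for t using that e by (simp add: dist_norm)
  have fpos: "0 < f (q + t *\<^sub>R e)" if "0 < t" "t < r" for t
    using directional_increase[of "ball q r" f g e q t] d r inb[of t] that f0 by (force simp: subset_iff)
  have fneg: "f (q + (- t) *\<^sub>R e) < 0" if "0 < t" "t < r" for t
    using directional_increase[of "ball q r" f g e "q + (- t) *\<^sub>R e" t] d r inb[of "- t"] that f0
    by (force simp: subset_iff)
  have contf: "continuous_on (ball q r) f"
    using d r by (meson Int_iff continuous_at_imp_continuous_on has_derivative_continuous subset_iff)
  have "open (ball q r \<inter> f -` {0<..})" "open (ball q r \<inter> f -` {..<0})"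
    by (intro continuous_open_preimage contf; simp)+
  moreover have "q + (a/2) *\<^sub>R e \<in> ball q r \<inter> f -` {0<..}" "q + (- (a/2)) *\<^sub>R e \<in> ball q r \<inter> f -` {..<0}"
    using inb[of "a/2"] inb[of "-(a/2)"] fpos[of "a/2"] fneg[of "a/2"] a r by (auto simp: a_def)
  ultimately obtain \<delta>1 \<delta>2 where \<delta>: "0 < \<delta>1" "ball (q + (a/2) *\<^sub>R e) \<delta>1 \<subseteq> ball q r \<inter> f -` {0<..}"
     "0 < \<delta>2" "ball (q + (- (a/2)) *\<^sub>R e) \<delta>2 \<subseteq> ball q r \<inter> f -` {..<0}"
    by (meson openE)
  define b where "b = min (r/2) (min \<delta>1 \<delta>2)"
  have b: "0 < b" "b \<le> r/2" "b \<le> \<delta>1" "b \<le> \<delta>2" using r \<delta> by (auto simp: b_def)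
  let ?B = "box_nbhd e q a b"
  have Bb: "?B \<subseteq> ball q r" by (rule box_nbhd_subset_ball[OF e]) (use b in \<open>simp add: a_def\<close>)
  have level: "dist (q + c *\<^sub>R e) x < b" if "x \<in> ?B" "e \<bullet> (x - q) = c" for x c
    using that by (simp add: box_nbhd_def dist_norm norm_minus_commute algebra_simps)
  show ?thesis
  proof (rule that[OF a b(1)])
    show "?B \<subseteq> W" using Bb r by blast
  next
    fix S :: "'a set" assume S: "convex S" "q \<in> S" "\<And>x t. x \<in> S \<Longrightarrow> x + t *\<^sub>R e \<in> S"
    have 1: "connected (S \<inter> ?B \<inter> {x. 0 < f x})"
    proof (rule connected_positive_side_box[where g = g])
      fix x assume x: "x \<in> ?B"
      show "(f has_derivative (\<lambda>h. g x \<bullet> h)) (at x)" using d x Bb r by blast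
      show "0 < g x \<bullet> e" using x Bb r by auto
      assume "e \<bullet> (x - q) = a / 2"
      then have "x \<in> ball (q + (a/2) *\<^sub>R e) \<delta>1" using level[OF x] b by fastforce
      then show "0 < f x" using \<delta>(2) by auto
    qed (use e a b S in auto)
    have 2: "connected (S \<inter> box_nbhd (- e) q a b \<inter> {x. 0 < - f x})"
    proof (rule connected_positive_side_box[where g = "\<lambda>x. - g x"])
      fix x assume "x \<in> box_nbhd (- e) q a b"
      then have x: "x \<in> ?B" by (simp add: box_nbhd_uminus)
      show "((\<lambda>x. - f x) has_derivative (\<lambda>h. - g x \<bullet> h)) (at x)"
        using has_derivative_minus[OF d, of x] x Bb r by (auto simp: inner_minus_left)
      show "0 < - g x \<bullet> - e" using x Bb r by auto
      assume "- e \<bullet> (x - q) = a / 2"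
      then have "x \<in> ball (q + (- (a/2)) *\<^sub>R e) \<delta>2" using level[OF x, of "-(a/2)"] b by fastforce
      then show "0 < - f x" using \<delta>(4) by auto
    next
      fix x t assume "x \<in> S"
      then show "x + t *\<^sub>R - e \<in> S" using S(3)[of x "- t"] by simp
    qed (use e a b S in auto)
    show "connected (S \<inter> ?B \<inter> {x. 0 < f x}) \<and> connected (S \<inter> ?B \<inter> {x. f x < 0})"
      using 1 2 by (simp add: box_nbhd_uminus)
  next
    fix t assume "0 < t" "t < a"
    then show "0 < f (q + t *\<^sub>R e) \<and> f (q - t *\<^sub>R e) < 0" using fpos[of t] fneg[of t] r by (simp add: a_def)
  next
    fix t assume "\<bar>t\<bar> < a"
    then show "q + t *\<^sub>R e \<in> ?B" using b ee by (simp add: box_nbhd_def)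
  qed
qed

lemma connected_nonzero_positive:
  fixes f :: "'a::topological_space \<Rightarrow> real"
  assumes "connected C" "continuous_on C f" "\<And>x. x \<in> C \<Longrightarrow> f x \<noteq> 0" "c \<in> C" "0 < f c" "x \<in> C"
  shows "0 < f x"
proof (rule ccontr)
  assume "\<not> 0 < f x"
  then have "f x \<le> 0" by simp
  moreover have "connected (f ` C)" using assms(1,2) connected_continuous_image by blast
  ultimately have "0 \<in> f ` C"
    using connectedD_interval[of "f ` C" "f x" "f c" 0] assms by auto
  then show False using assms(3) by auto
qed

text \<open>Both functions increase along \<open>\<nu>\<close> at \<open>y\<close> and have the same
  zeros. In a cylinder with axis \<open>\<nu> y\<close> each side of \<open>f1\<close> is connected,
  so \<open>f2\<close> has constant sign there, and this sign can be read off at one point of the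
  axis.\<close>

lemma side_chart_sign_agree:
  fixes M :: "'n::finite space set"
  assumes sc1: "side_chart M \<nu> W1 f1 g1" and sc2: "side_chart M \<nu> W2 f2 g2"
    and y: "y \<in> M" "y \<in> W1" "y \<in> W2" and \<nu>: "norm (\<nu> y) = 1"
  shows "\<exists>B. open B \<and> y \<in> B \<and> B \<subseteq> W1 \<inter> W2 \<and> (\<forall>x\<in>B. sgn (f1 x) = sgn (f2 x))"
proof -
  let ?W = "W1 \<inter> W2" and ?e = "\<nu> y"
  have oW: "open ?W" and yW: "y \<in> ?W" using sc1 sc2 y by (auto simp: side_chart_def)
  have s1: "side_chart M \<nu> ?W f1 g1" and s2: "side_chart M \<nu> ?W f2 g2"
    using side_chart_subset[OF sc1 oW] side_chart_subset[OF sc2 oW] by auto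
  have f0: "f1 y = 0" "f2 y = 0" using side_chart_iff s1 s2 y yW by blast+
  have ge: "0 < g1 y \<bullet> ?e" "0 < g2 y \<bullet> ?e"
    using s1 s2 y yW unfolding side_chart_def by (metis IntI inner_commute)+
  obtain a b where ab: "0 < a" "0 < b" "box_nbhd ?e y a b \<subseteq> ?W"
    "\<And>S. convex S \<Longrightarrow> y \<in> S \<Longrightarrow> (\<And>x t. x \<in> S \<Longrightarrow> x + t *\<^sub>R ?e \<in> S) \<Longrightarrow>
       connected (S \<inter> box_nbhd ?e y a b \<inter> {x. 0 < f1 x}) \<and> connected (S \<inter> box_nbhd ?e y a b \<inter> {x. f1 x < 0})"
    "\<And>t. 0 < t \<Longrightarrow> t < a \<Longrightarrow> 0 < f1 (y + t *\<^sub>R ?e) \<and> f1 (y - t *\<^sub>R ?e) < 0"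
    "\<And>t. \<bar>t\<bar> < a \<Longrightarrow> y + t *\<^sub>R ?e \<in> box_nbhd ?e y a b"
    by (rule box_nbhd_sides[of ?W y f1 g1 ?e]) (use s1 oW yW f0 \<nu> ge in \<open>auto simp: side_chart_def\<close>)
  obtain a2 b2 where a2: "0 < a2"
    "\<And>t. 0 < t \<Longrightarrow> t < a2 \<Longrightarrow> 0 < f2 (y + t *\<^sub>R ?e) \<and> f2 (y - t *\<^sub>R ?e) < 0"
    by (rule box_nbhd_sides[of ?W y f2 g2 ?e]) (use s2 oW yW f0 \<nu> ge in \<open>auto simp: side_chart_def\<close>)
  let ?B = "box_nbhd ?e y a b"
  define t where "t = min a a2 / 2"
  have t: "0 < t" "t < a" "t < a2" using ab(1) a2(1) by (auto simp: t_def)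
  have con: "connected (?B \<inter> {x. 0 < f1 x})" "connected (?B \<inter> {x. f1 x < 0})"
    using ab(4)[of UNIV] by auto
  have cont: "continuous_on ?B f2"
    using side_chart_continuous[OF s2] ab(3) continuous_on_subset by blast
  have zero: "f1 x = 0 \<longleftrightarrow> f2 x = 0" if "x \<in> ?B" for x
    using side_chart_iff[OF s1, of x] side_chart_iff[OF s2, of x] that ab(3) by blast
  have tp: "y + t *\<^sub>R ?e \<in> ?B \<inter> {x. 0 < f1 x}" using ab(5)[of t] ab(6)[of t] t by auto
  have tn: "y - t *\<^sub>R ?e \<in> ?B \<inter> {x. f1 x < 0}" using ab(5)[of t] ab(6)[of "- t"] t by auto
  have nz: "f2 x \<noteq> 0" if "x \<in> ?B" "f1 x \<noteq> 0" for x using zero that by blast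
  have pos: "0 < f2 x" if "x \<in> ?B" "0 < f1 x" for x
    by (rule connected_nonzero_positive[OF con(1) _ _ tp])
      (use nz a2(2)[of t] t that in \<open>auto intro: continuous_on_subset[OF cont]\<close>)
  have neg: "0 < - f2 x" if "x \<in> ?B" "f1 x < 0" for x
    by (rule connected_nonzero_positive[OF con(2) _ _ tn])
      (use nz a2(2)[of t] t that in \<open>auto intro!: continuous_intros continuous_on_subset[OF cont]\<close>)
  show ?thesis
  proof (intro exI[of _ ?B] conjI ballI)
    fix x assume "x \<in> ?B"
    then show "sgn (f1 x) = sgn (f2 x)"
      using pos[of x] neg[of x] zero[of x] by (cases "f1 x" "0::real" rule: linorder_cases) auto
  qed (use ab(3) ab(6)[of 0] ab(1) open_box_nbhd in auto)
qed

text \<open>Signs of two charts are known to agree only near common points of \<open>M\<close>; on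
  an overlap away from \<open>M\<close> they could differ. The chart domains are therefore shrunk
  until each is covered by finitely many reference balls and agrees in sign with every reference
  chart it meets. Two charts are then compared through a reference chart.\<close>

lemma oriented_neighborhood:
  fixes M :: "'n::finite space set"
  assumes M: "smooth_hypersurface M" and \<nu>: "unit_normal M \<nu>"
    and \<Gamma>: "compact \<Gamma>" "\<Gamma> \<subseteq> M - mboundary M"
  obtains N P Q where "open N" "\<Gamma> \<subseteq> N" "open P" "open Q" "P \<inter> Q = {}" "N - M = P \<union> Q"
    "N \<inter> mboundary M = {}"
    "\<And>\<gamma>. \<gamma> \<in> \<Gamma> \<Longrightarrow> \<exists>W f g. side_chart M \<nu> W f g \<and> \<gamma> \<in> W \<and> W \<subseteq> N \<and>
       (\<forall>x\<in>W. (x \<in> P \<longleftrightarrow> 0 < f x) \<and> (x \<in> Q \<longleftrightarrow> f x < 0))"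
proof -
  have "\<forall>y\<in>\<Gamma>. \<exists>W f g r. side_chart M \<nu> W f g \<and> 0 < r \<and> cball y r \<subseteq> W"
  proof
    fix y assume "y \<in> \<Gamma>"
    then obtain W f g where "side_chart M \<nu> W f g" "y \<in> W"
      using side_chart_exists[OF M \<nu>, of y] \<Gamma>(2) by blast
    moreover have "open W" using \<open>side_chart M \<nu> W f g\<close> by (simp add: side_chart_def)
    then obtain r where "0 < r" "cball y r \<subseteq> W"
      using \<open>y \<in> W\<close> open_contains_cball by blast
    ultimately show "\<exists>W f g r. side_chart M \<nu> W f g \<and> 0 < r \<and> cball y r \<subseteq> W" by blast
  qed
  then obtain W f g r where ch: "\<And>y. y \<in> \<Gamma> \<Longrightarrow> side_chart M \<nu> (W y) (f y) (g y)"
    "\<And>y. y \<in> \<Gamma> \<Longrightarrow> 0 < r y" "\<And>y. y \<in> \<Gamma> \<Longrightarrow> cball y (r y) \<subseteq> W y"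
    by metis
  obtain F where F: "F \<subseteq> \<Gamma>" "finite F" "\<Gamma> \<subseteq> (\<Union>c\<in>F. ball c (r c))"
    by (rule compactE_image[OF \<Gamma>(1), of \<Gamma> "\<lambda>c. ball c (r c)"]) (use ch(2) in auto)
  define good where "good y B \<longleftrightarrow> open B \<and> y \<in> B \<and> B \<subseteq> W y \<and> B \<subseteq> (\<Union>c\<in>F. ball c (r c)) \<and>
      (\<forall>c\<in>F. \<forall>x\<in>B. x \<in> cball c (r c) \<longrightarrow> sgn (f c x) = sgn (f y x))" for y B
  have "\<exists>B. good y B" if y: "y \<in> \<Gamma>" for y
  proof -
    have yW: "y \<in> W y" using ch[OF y] by force
    have yM: "y \<in> M" using y \<Gamma> by blast
    then have ny: "norm (\<nu> y) = 1" using \<nu> by (simp add: unit_normal_def)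
    have "\<forall>c\<in>F. \<exists>B. open B \<and> y \<in> B \<and> (\<forall>x\<in>B. x \<in> cball c (r c) \<longrightarrow> sgn (f c x) = sgn (f y x))"
    proof
      fix c assume c: "c \<in> F"
      show "\<exists>B. open B \<and> y \<in> B \<and> (\<forall>x\<in>B. x \<in> cball c (r c) \<longrightarrow> sgn (f c x) = sgn (f y x))"
      proof (cases "y \<in> cball c (r c)")
        case True
        then have "y \<in> W c" using ch(3) F c by blast
        have c': "c \<in> \<Gamma>" using F(1) c by blast
        obtain B where "open B" "y \<in> B" "\<And>x. x \<in> B \<Longrightarrow> sgn (f c x) = sgn (f y x)"
          using side_chart_sign_agree[OF ch(1)[OF c'] ch(1)[OF y] yM \<open>y \<in> W c\<close> yW ny] by blast
        then show ?thesis by blast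
      next
        case False
        \<comment> \<open>Closed balls are used so that a centre whose ball misses \<open>y\<close>
          imposes no condition near \<open>y\<close>.\<close>
        then show ?thesis by (intro exI[of _ "- cball c (r c)"]) auto
      qed
    qed
    then obtain B where B: "\<And>c. c \<in> F \<Longrightarrow> open (B c) \<and> y \<in> B c \<and>
        (\<forall>x\<in>B c. x \<in> cball c (r c) \<longrightarrow> sgn (f c x) = sgn (f y x))" by metis
    show ?thesis unfolding good_def
    proof (intro exI[of _ "(\<Inter>c\<in>F. B c) \<inter> W y \<inter> (\<Union>c\<in>F. ball c (r c))"] conjI)
      show "open ((\<Inter>c\<in>F. B c) \<inter> W y \<inter> (\<Union>c\<in>F. ball c (r c)))"
        using B F(2) ch(1)[OF y] by (intro open_Int open_INT open_UN) (auto simp: side_chart_def)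
      show "y \<in> (\<Inter>c\<in>F. B c) \<inter> W y \<inter> (\<Union>c\<in>F. ball c (r c))"
        using B F(3) y yW by blast
    qed (use B in auto)
  qed
  then have "\<exists>B. \<forall>y\<in>\<Gamma>. good y (B y)" by (intro bchoice) blast
  then obtain B where B0: "\<And>y. y \<in> \<Gamma> \<Longrightarrow> good y (B y)" by blast
  have B: "\<And>y. y \<in> \<Gamma> \<Longrightarrow> open (B y)" "\<And>y. y \<in> \<Gamma> \<Longrightarrow> y \<in> B y" "\<And>y. y \<in> \<Gamma> \<Longrightarrow> B y \<subseteq> W y"
    "\<And>y. y \<in> \<Gamma> \<Longrightarrow> B y \<subseteq> (\<Union>c\<in>F. ball c (r c))"
    "\<And>y c x. y \<in> \<Gamma> \<Longrightarrow> c \<in> F \<Longrightarrow> x \<in> B y \<Longrightarrow> x \<in> cball c (r c) \<Longrightarrow> sgn (f c x) = sgn (f y x)"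
    using B0 unfolding good_def by blast+
  have agree: "sgn (f y x) = sgn (f z x)" if yz: "y \<in> \<Gamma>" "z \<in> \<Gamma>" "x \<in> B y" "x \<in> B z" for x y z
  proof -
    obtain c where "c \<in> F" "x \<in> ball c (r c)" using B(4)[OF yz(1)] yz(3) by blast
    then show ?thesis using B(5)[of y c x] B(5)[of z c x] yz by auto
  qed
  have sB: "side_chart M \<nu> (B y) (f y) (g y)" if "y \<in> \<Gamma>" for y
    using side_chart_subset[OF ch(1) B(1) B(3)] that by blast
  define N where "N = (\<Union>y\<in>\<Gamma>. B y)"
  define P where "P = (\<Union>y\<in>\<Gamma>. B y \<inter> f y -` {0<..})"
  define Q where "Q = (\<Union>y\<in>\<Gamma>. B y \<inter> f y -` {..<0})"
  have PQ: "x \<in> P \<longleftrightarrow> 0 < f y x" "x \<in> Q \<longleftrightarrow> f y x < 0" if "y \<in> \<Gamma>" "x \<in> B y" for x y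
  proof -
    show "x \<in> P \<longleftrightarrow> 0 < f y x"
    proof
      assume "x \<in> P"
      then obtain z where "z \<in> \<Gamma>" "x \<in> B z" "0 < f z x" by (auto simp: P_def)
      then show "0 < f y x" using agree[OF that(1) _ that(2), of z] by (metis sgn_greater)
    qed (use that P_def in auto)
    show "x \<in> Q \<longleftrightarrow> f y x < 0"
    proof
      assume "x \<in> Q"
      then obtain z where "z \<in> \<Gamma>" "x \<in> B z" "f z x < 0" by (auto simp: Q_def)
      then show "f y x < 0" using agree[OF that(1) _ that(2), of z] by (metis sgn_less)
    qed (use that Q_def in auto)
  qed
  show ?thesis
  proof (rule that[of N P Q])
    show "open N" unfolding N_def using B(1) by blast
    show "\<Gamma> \<subseteq> N" unfolding N_def using B(2) by blast
    show "open P" unfolding P_def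
      using B(1) side_chart_continuous[OF sB] by (intro open_UN ballI continuous_open_preimage) auto
    show "open Q" unfolding Q_def
      using B(1) side_chart_continuous[OF sB] by (intro open_UN ballI continuous_open_preimage) auto
    show "P \<inter> Q = {}"
    proof (rule equals0I)
      fix x assume x: "x \<in> P \<inter> Q"
      then obtain y where "y \<in> \<Gamma>" "x \<in> B y" by (auto simp: P_def)
      then show False using PQ[of y x] x by auto
    qed
    have "x \<notin> M \<longleftrightarrow> x \<in> P \<union> Q" if xN: "x \<in> N" for x
    proof -
      obtain y where "y \<in> \<Gamma>" "x \<in> B y" using xN by (auto simp: N_def)
      then show ?thesis using PQ[of y x] side_chart_iff[OF sB, of y x] by auto
    qed
    moreover have "P \<union> Q \<subseteq> N" by (auto simp: P_def Q_def N_def)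
    ultimately show "N - M = P \<union> Q" by blast
    show "N \<inter> mboundary M = {}" using sB unfolding N_def side_chart_def by blast
    fix \<gamma> assume \<gamma>: "\<gamma> \<in> \<Gamma>"
    show "\<exists>W f g. side_chart M \<nu> W f g \<and> \<gamma> \<in> W \<and> W \<subseteq> N \<and>
       (\<forall>x\<in>W. (x \<in> P \<longleftrightarrow> 0 < f x) \<and> (x \<in> Q \<longleftrightarrow> f x < 0))"
      using sB[OF \<gamma>] B(2)[OF \<gamma>] PQ[OF \<gamma>] \<gamma> N_def by blast
  qed
qed

section \<open>The index of a hyperplane section\<close>

lemma cis_eq_cis_2pi:
  assumes "cis (2 * pi * a) = cis (2 * pi * b)"
  shows "a - b \<in> \<int>"
proof -
  have "sin (2 * pi * a) = sin (2 * pi * b)" "cos (2 * pi * a) = cos (2 * pi * b)"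
    using assms by (metis cis.sel)+
  then obtain n :: int where "2 * pi * a = 2 * pi * b + 2 * pi * n"
    using sin_cos_eq_iff by blast
  then have "2 * pi * (a - b - of_int n) = 0" by (simp add: algebra_simps)
  then have "a - b = of_int n" by simp
  then show ?thesis by simp
qed

lemma compact_positive_lower_bound:
  fixes f :: "'a::topological_space \<Rightarrow> real"
  assumes "compact S" "continuous_on S f" "\<And>x. x \<in> S \<Longrightarrow> 0 < f x"
  obtains d where "0 < d" "\<And>x. x \<in> S \<Longrightarrow> d \<le> f x"
proof (cases "S = {}")
  case False
  then obtain x where "x \<in> S" "\<And>y. y \<in> S \<Longrightarrow> f x \<le> f y"
    using continuous_attains_inf assms by meson
  then show ?thesis using that assms by blast
qed (use that[of 1] in auto)

text \<open>
  In a tube around the slice let \<open>\<tau> \<in> [-1, 1]\<close> be a signed distance to \<open>M\<close>. The map equal to $e^{i\pi\tau}$ in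
  the tube and to $-1$ outside is continuous on a slab, and a logarithm $2\pi i u$ of it exists because the
  slab is convex. Thus \<open>u\<close> is an integer exactly on \<open>M\<close>, and its integer part jumps across \<open>M\<close>.
\<close>

lemma index_function:
  fixes M :: "'n::finite space set"
  assumes M: "smooth_hypersurface M" and \<nu>: "unit_normal M \<nu>"
    and \<Gamma>: "compact (slice M n p)" "slice M n p \<noteq> {}"
  obtains h K and u :: "'n space \<Rightarrow> real" where "0 < h" "compact K" "K \<subseteq> M - mboundary M" "hyperplane n p \<inter> K = slice M n p"
    "continuous_on {x. \<bar>n \<bullet> (x - p)\<bar> < h} u"
    "\<And>x. \<bar>n \<bullet> (x - p)\<bar> < h \<Longrightarrow> u x \<in> \<int> \<longleftrightarrow> x \<in> K"
    "\<And>\<gamma>. \<gamma> \<in> slice M n p \<Longrightarrow> \<exists>W f g. side_chart M \<nu> W f g \<and> \<gamma> \<in> W \<and> W \<subseteq> {x. \<bar>n \<bullet> (x - p)\<bar> < h} \<and>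
       (\<forall>x\<in>W. (0 < f x \<longrightarrow> u \<gamma> < u x \<and> u x < u \<gamma> + 1) \<and> (f x < 0 \<longrightarrow> u \<gamma> - 1 < u x \<and> u x < u \<gamma>) \<and>
          (f x = 0 \<longrightarrow> u x = u \<gamma>))"
proof -
  let ?\<Gamma> = "slice M n p"
  have \<Gamma>M: "?\<Gamma> \<subseteq> M - mboundary M" by (auto simp: slice_def)
  obtain N P Q where N: "open N" "?\<Gamma> \<subseteq> N" "open P" "open Q" "P \<inter> Q = {}" "N - M = P \<union> Q"
    "N \<inter> mboundary M = {}"
    and ch: "\<And>\<gamma>. \<gamma> \<in> ?\<Gamma> \<Longrightarrow> \<exists>W f g. side_chart M \<nu> W f g \<and> \<gamma> \<in> W \<and> W \<subseteq> N \<and>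
       (\<forall>x\<in>W. (x \<in> P \<longleftrightarrow> 0 < f x) \<and> (x \<in> Q \<longleftrightarrow> f x < 0))"
    using oriented_neighborhood[OF M \<nu> \<Gamma>(1) \<Gamma>M] by metis
  obtain r where r: "0 < r" "(\<Union>x\<in>?\<Gamma>. cball x r) \<subseteq> N"
    using compact_subset_open_imp_cball_epsilon_subset[OF \<Gamma>(1) N(1,2)] by blast
  define cN where "cN = {x. infdist x ?\<Gamma> \<le> r}"
  have ccN: "compact cN" unfolding cN_def using compact_infdist_le \<Gamma> r(1) by blast
  have cNN: "cN \<subseteq> N"
  proof
    fix x assume x: "x \<in> cN"
    obtain y where "y \<in> ?\<Gamma>" "infdist x ?\<Gamma> = dist x y"
      using infdist_attains_inf[OF compact_imp_closed[OF \<Gamma>(1)] \<Gamma>(2)] by blast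
    then have "x \<in> (\<Union>x\<in>?\<Gamma>. cball x r)" using x by (auto simp: cN_def dist_commute)
    then show "x \<in> N" using r(2) by blast
  qed
  have \<Gamma>cN: "?\<Gamma> \<subseteq> cN" using r by (auto simp: cN_def)
  \<comment> \<open>Within the tube \<open>cN\<close>, the distance to \<open>A1\<close> is positive
    exactly on the side \<open>P\<close> and the distance to \<open>A2\<close> exactly on the side
    \<open>Q\<close>; on \<open>K\<close> both vanish.\<close>
  define A1 where "A1 = cN - P"
  define A2 where "A2 = cN - Q"
  have A: "compact A1" "compact A2" using ccN N(3,4) by (auto simp: A1_def A2_def compact_diff)
  have PM: "P \<inter> M = {}" "Q \<inter> M = {}" using N(6) by blast+
  have A\<Gamma>: "?\<Gamma> \<subseteq> A1" "?\<Gamma> \<subseteq> A2" using \<Gamma>cN \<Gamma>M PM by (auto simp: A1_def A2_def)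
  then have Ane: "A1 \<noteq> {}" "A2 \<noteq> {}" using \<Gamma>(2) by auto
  define K where "K = cN - (P \<union> Q)"
  have KM: "K = M \<inter> cN" using N(6) cNN PM by (auto simp: K_def)
  have cK: "compact K" unfolding K_def by (intro compact_diff ccN open_Un N(3,4))
  have Kb: "K \<subseteq> M - mboundary M" using KM cNN N(7) by blast
  have HK: "hyperplane n p \<inter> K = ?\<Gamma>"
    using Kb \<Gamma>cN \<Gamma>M by (auto simp: slice_def KM)
  have inP: "0 < infdist x A1" "infdist x A2 = 0" if "x \<in> P" "x \<in> cN" for x
  proof -
    show "0 < infdist x A1" using infdist_pos_not_in_closed[OF compact_imp_closed[OF A(1)] Ane(1)] that
      by (simp add: A1_def)
    have "x \<in> A2" using that N(5) by (auto simp: A2_def)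
    then show "infdist x A2 = 0" by simp
  qed
  have inQ: "0 < infdist x A2" "infdist x A1 = 0" if "x \<in> Q" "x \<in> cN" for x
  proof -
    show "0 < infdist x A2" using infdist_pos_not_in_closed[OF compact_imp_closed[OF A(2)] Ane(2)] that
      by (simp add: A2_def)
    have "x \<in> A1" using that N(5) by (auto simp: A1_def)
    then show "infdist x A1 = 0" by simp
  qed
  have inK: "infdist x A1 = 0" "infdist x A2 = 0" if "x \<in> K" for x
    using that by (auto simp: K_def A1_def A2_def)
  \<comment> \<open>The outer shell of the tube. Points of \<open>K\<close> in the shell are off the
    hyperplane, so \<open>s\<close> is positive there. Inside a slab of half-height
    \<open>d/2\<close> the larger of the two distances then exceeds \<open>d/2\<close>, which
    saturates \<open>\<tau>\<close> at 1 or -1.\<close>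
  define Sh where "Sh = cN \<inter> {x. r/2 \<le> infdist x ?\<Gamma>}"
  define s where "s x = max (infdist x A1) (infdist x A2) + \<bar>n \<bullet> (x - p)\<bar>" for x
  have cSh: "compact Sh" unfolding Sh_def
    by (intro compact_Int_closed ccN closed_Collect_le continuous_intros)
  have conts: "continuous_on Sh s" unfolding s_def by (intro continuous_intros)
  have spos: "0 < s x" if x: "x \<in> Sh" for x
  proof -
    have xc: "x \<in> cN" using x by (simp add: Sh_def)
    then consider "x \<in> P" | "x \<in> Q" | "x \<in> K" by (auto simp: K_def)
    then show ?thesis
    proof cases
      case 1 show ?thesis using inP[OF 1 xc] by (auto simp: s_def)
    next
      case 2 show ?thesis using inQ[OF 2 xc] by (auto simp: s_def)
    next
      case 3
      have "n \<bullet> (x - p) \<noteq> 0"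
      proof
        assume "n \<bullet> (x - p) = 0"
        then have "x \<in> ?\<Gamma>" using HK 3 by (auto simp: hyperplane_def)
        then show False using x r(1) by (auto simp: Sh_def)
      qed
      then show ?thesis using inK[OF 3] by (simp add: s_def)
    qed
  qed
  obtain d where d: "0 < d" "\<And>x. x \<in> Sh \<Longrightarrow> d \<le> s x"
    using compact_positive_lower_bound[OF cSh conts spos] by blast
  define h where "h = d/2"
  have h: "0 < h" using d by (simp add: h_def)
  define \<tau> where "\<tau> x = min 1 (infdist x A1 / h) - min 1 (infdist x A2 / h)" for x
  let ?Z = "{x. \<bar>n \<bullet> (x - p)\<bar> < h}"
  have cont\<tau>: "continuous_on S \<tau>" for S unfolding \<tau>_def using h by (intro continuous_intros) auto
  have \<tau>P: "0 < \<tau> x" "\<tau> x \<le> 1" if "x \<in> P" "x \<in> cN" for x using inP[OF that] h by (auto simp: \<tau>_def)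
  have \<tau>Q: "\<tau> x < 0" "-1 \<le> \<tau> x" if "x \<in> Q" "x \<in> cN" for x using inQ[OF that] h by (auto simp: \<tau>_def)
  have \<tau>K: "\<tau> x = 0" if "x \<in> K" for x using inK[OF that] h by (auto simp: \<tau>_def)
  have shell: "(x \<in> P \<and> \<tau> x = 1) \<or> (x \<in> Q \<and> \<tau> x = -1)" if x: "x \<in> Sh" "x \<in> ?Z" for x
  proof -
    have xc: "x \<in> cN" using x by (simp add: Sh_def)
    have m: "h < max (infdist x A1) (infdist x A2)" using d(2)[OF x(1)] x(2) by (auto simp: s_def h_def)
    consider "x \<in> P" | "x \<in> Q" | "x \<in> K" using xc by (auto simp: K_def)
    then show ?thesis
    proof cases
      case 1 then show ?thesis using inP[OF 1 xc] m h by (auto simp: \<tau>_def)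
    next
      case 2 then show ?thesis using inQ[OF 2 xc] m h by (auto simp: \<tau>_def)
    next
      case 3 then show ?thesis using inK[OF 3] m h by auto
    qed
  qed
  \<comment> \<open>The two pieces fit together because on the shell \<open>\<tau>\<close> is 1 or
    -1, and both values are sent to -1.\<close>
  define G where "G x = (if infdist x ?\<Gamma> < r then cis (pi * \<tau> x) else - 1)" for x
  have G1: "G x = - 1" if "x \<in> ?Z" "r/2 < infdist x ?\<Gamma>" for x
  proof (cases "infdist x ?\<Gamma> < r")
    case True
    then have "x \<in> Sh" using that by (simp add: Sh_def cN_def)
    then have "\<tau> x = 1 \<or> \<tau> x = -1" using shell that by blast
    then show ?thesis using True by (auto simp: G_def complex_eq_iff)
  qed (simp add: G_def)
  have oZ: "open ?Z" by (intro open_Collect_less continuous_intros)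
  have cvZ: "convex ?Z"
  proof -
    have "?Z = {x. n \<bullet> x < h + n \<bullet> p} \<inter> {x. n \<bullet> x > n \<bullet> p - h}" by (auto simp: inner_diff_right)
    then show ?thesis by (simp add: convex_halfspace_lt convex_halfspace_gt convex_Int)
  qed
  let ?Z1 = "?Z \<inter> {x. infdist x ?\<Gamma> < r}" and ?Z2 = "?Z \<inter> {x. r/2 < infdist x ?\<Gamma>}"
  have o12: "open ?Z1" "open ?Z2" using oZ by (intro open_Int open_Collect_less continuous_intros; simp)+
  have "continuous_on ?Z1 (\<lambda>x. cis (pi * \<tau> x))" by (intro continuous_intros continuous_on_cis cont\<tau>)
  then have c1: "continuous_on ?Z1 G" by (rule continuous_on_eq) (simp add: G_def)
  have c2: "continuous_on ?Z2 G" by (rule continuous_on_eq[of _ "\<lambda>x. - 1"]) (use G1 in auto)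
  have "?Z = ?Z1 \<union> ?Z2" using r by auto
  then have contG: "continuous_on ?Z G" using continuous_on_open_Un[OF o12 c1 c2] by simp
  have nG: "norm (G x) = 1" for x by (simp add: G_def)
  obtain l where l: "continuous_on ?Z l" "\<And>x. x \<in> ?Z \<Longrightarrow> G x = exp (l x)"
    using continuous_logarithm_on_contractible[OF contG convex_imp_contractible[OF cvZ]] nG
    by (metis norm_zero zero_neq_one)
  define u where "u x = Im (l x) / (2 * pi)" for x
  have contu: "continuous_on ?Z u" unfolding u_def using l(1) by (intro continuous_intros) auto
  have Gu: "G x = cis (2 * pi * u x)" if "x \<in> ?Z" for x
  proof -
    have "exp (Re (l x)) = 1" using l(2)[OF that] nG[of x] by (metis norm_exp_eq_Re)
    then have "G x = cis (Im (l x))" using l(2)[OF that] by (simp add: exp_eq_polar)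
    then show ?thesis by (simp add: u_def)
  qed
  have uG: "u x \<in> \<int> \<longleftrightarrow> G x = 1" if "x \<in> ?Z" for x
  proof
    assume "G x = 1"
    then have "cis (2 * pi * u x) = cis (2 * pi * 0)" using Gu[OF that] by simp
    then show "u x \<in> \<int>" using cis_eq_cis_2pi by fastforce
  qed (simp add: Gu[OF that])
  have cis1: "cis (pi * t) \<noteq> 1" if t: "0 < t" "t \<le> 1" for t
  proof
    assume "cis (pi * t) = 1"
    then have "cis (2 * pi * (t/2)) = cis (2 * pi * 0)" by simp
    then have "t/2 \<in> \<int>" using cis_eq_cis_2pi by fastforce
    then show False using t by (auto elim!: Ints_cases)
  qed
  have cis2: "cis (pi * t) \<noteq> 1" if t: "t < 0" "- 1 \<le> t" for t
    using cis1[of "- t"] that by (metis cis_cnj complex_cnj_one mult_minus_right neg_0_less_iff_less neg_le_iff_le minus_minus)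
  have GK: "G x = 1 \<longleftrightarrow> x \<in> K" if x: "x \<in> ?Z" for x
  proof (cases "infdist x ?\<Gamma> < r")
    case True
    then have xc: "x \<in> cN" by (simp add: cN_def)
    then consider "x \<in> P" | "x \<in> Q" | "x \<in> K" by (auto simp: K_def)
    then show ?thesis
    proof cases
      case 1 then show ?thesis using \<tau>P[OF 1 xc] cis1 True by (auto simp: G_def K_def)
    next
      case 2 then show ?thesis using \<tau>Q[OF 2 xc] cis2 True by (auto simp: G_def K_def)
    next
      case 3 then show ?thesis using \<tau>K True by (simp add: G_def)
    qed
  next
    case False
    have "x \<notin> K"
    proof
      assume k: "x \<in> K"
      then have "x \<in> Sh" using False r by (auto simp: Sh_def K_def)
      then show False using shell[OF _ x] k by (auto simp: K_def)
    qed
    then show ?thesis using False by (simp add: G_def)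
  qed
  show ?thesis
  proof (rule that[OF h cK Kb HK contu])
    fix x assume "\<bar>n \<bullet> (x - p)\<bar> < h"
    then show "u x \<in> \<int> \<longleftrightarrow> x \<in> K" using uG GK by simp
  next
    fix \<gamma> assume \<gamma>: "\<gamma> \<in> ?\<Gamma>"
    then obtain W f g where W: "side_chart M \<nu> W f g" "\<gamma> \<in> W"
      "\<And>x. x \<in> W \<Longrightarrow> (x \<in> P \<longleftrightarrow> 0 < f x) \<and> (x \<in> Q \<longleftrightarrow> f x < 0)" using ch by meson
    have \<gamma>K: "\<gamma> \<in> K" using \<gamma> HK by blast
    have \<gamma>Z: "\<gamma> \<in> ?Z" using \<gamma> h by (simp add: slice_def hyperplane_def)
    have \<gamma>1: "\<gamma> \<in> ?Z1" using \<gamma>Z r \<gamma> by simp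
    have u\<gamma>: "u \<gamma> \<in> \<int>" using uG[OF \<gamma>Z] GK[OF \<gamma>Z] \<gamma>K by blast
    \<comment> \<open>The bound 1/2 makes the integer \<open>u x - \<tau> x / 2 - u \<gamma>\<close>
      smaller than 1 in absolute value, hence zero: near \<open>\<gamma>\<close> the index function
      is \<open>u \<gamma> + \<tau> / 2\<close>.\<close>
    define S where "S = W \<inter> (?Z1 \<inter> (\<lambda>x. \<bar>u x - u \<gamma>\<bar> + \<bar>\<tau> x\<bar>) -` {..<1/2})"
    have oS: "open S" unfolding S_def
    proof (rule open_Int)
      show "open W" using W by (simp add: side_chart_def)
      have "continuous_on ?Z1 (\<lambda>x. \<bar>u x - u \<gamma>\<bar> + \<bar>\<tau> x\<bar>)"
        by (intro continuous_intros continuous_on_subset[OF contu] cont\<tau>) auto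
      then show "open (?Z1 \<inter> (\<lambda>x. \<bar>u x - u \<gamma>\<bar> + \<bar>\<tau> x\<bar>) -` {..<1/2})"
        by (rule continuous_open_preimage[OF _ o12(1)]) simp
    qed
    have uS: "u x = u \<gamma> + \<tau> x / 2" if x: "x \<in> S" for x
    proof -
      have xZ: "x \<in> ?Z" "infdist x ?\<Gamma> < r" using x by (auto simp: S_def)
      then have "cis (2 * pi * u x) = cis (2 * pi * (\<tau> x / 2))" using Gu[of x] by (simp add: G_def)
      then have "u x - \<tau> x / 2 \<in> \<int>" by (rule cis_eq_cis_2pi)
      then have "u x - \<tau> x / 2 - u \<gamma> \<in> \<int>" using u\<gamma> by (rule Ints_diff)
      moreover have "\<bar>u x - u \<gamma>\<bar> + \<bar>\<tau> x\<bar> < 1/2" using x by (simp add: S_def)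
      then have "\<bar>u x - \<tau> x / 2 - u \<gamma>\<bar> < 1" by linarith
      ultimately have "u x - \<tau> x / 2 - u \<gamma> = 0" using Ints_nonzero_abs_less1 by blast
      then show ?thesis by simp
    qed
    have Sc: "x \<in> cN" if "x \<in> S" for x using that by (auto simp: S_def cN_def)
    show "\<exists>W f g. side_chart M \<nu> W f g \<and> \<gamma> \<in> W \<and> W \<subseteq> ?Z \<and>
       (\<forall>x\<in>W. (0 < f x \<longrightarrow> u \<gamma> < u x \<and> u x < u \<gamma> + 1) \<and> (f x < 0 \<longrightarrow> u \<gamma> - 1 < u x \<and> u x < u \<gamma>) \<and>
          (f x = 0 \<longrightarrow> u x = u \<gamma>))"
    proof (intro exI[of _ S] exI[of _ f] exI[of _ g] conjI ballI)
      show "side_chart M \<nu> S f g" by (rule side_chart_subset[OF W(1) oS]) (auto simp: S_def)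
      show "\<gamma> \<in> S" using W(2) \<gamma>1 \<tau>K[OF \<gamma>K] by (simp add: S_def)
      show "S \<subseteq> ?Z" by (auto simp: S_def)
      fix x assume x: "x \<in> S"
      have xW: "x \<in> W" using x by (simp add: S_def)
      show "0 < f x \<longrightarrow> u \<gamma> < u x \<and> u x < u \<gamma> + 1"
        using \<tau>P[of x] Sc[OF x] W(3)[OF xW] uS[OF x] by auto
      show "f x < 0 \<longrightarrow> u \<gamma> - 1 < u x \<and> u x < u \<gamma>"
        using \<tau>Q[of x] Sc[OF x] W(3)[OF xW] uS[OF x] by auto
      show "f x = 0 \<longrightarrow> u x = u \<gamma>"
        using \<tau>K[of x] Sc[OF x] W(3)[OF xW] uS[OF x] by (auto simp: K_def)
    qed
  qed
qed

section \<open>Stability of hyperplanes on compact sets, and the enclosed set\<close>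

text \<open>On the compact part of the ball outside \<open>G\<close> the distance to the plane is
  bounded below by some \<open>\<mu>\<close>. Tilting and shifting the plane by less than
  \<open>\<delta>\<close> changes the defining function on the ball by less than
  \<open>\<delta>\<close> times the sum in the denominator of \<open>\<delta>\<close>.\<close>

lemma hyperplanes_near_compact:
  fixes n p :: "'a::euclidean_space"
  assumes G: "open G" "hyperplane n p \<inter> cball p \<rho> \<subseteq> G"
  obtains \<delta> where "0 < \<delta>"
    "\<And>m q. norm (m - n) < \<delta> \<Longrightarrow> norm (q - p) < \<delta> \<Longrightarrow> hyperplane m q \<inter> cball p \<rho> \<subseteq> G"
proof -
  have c: "compact (cball p \<rho> - G)" by (intro compact_diff compact_cball G(1))
  have cont: "continuous_on (cball p \<rho> - G) (\<lambda>x. \<bar>n \<bullet> (x - p)\<bar>)" by (intro continuous_intros)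
  have "0 < \<bar>n \<bullet> (x - p)\<bar>" if "x \<in> cball p \<rho> - G" for x
    using G(2) that by (auto simp: hyperplane_def)
  then obtain \<mu> where \<mu>: "0 < \<mu>" "\<And>x. x \<in> cball p \<rho> - G \<Longrightarrow> \<mu> \<le> \<bar>n \<bullet> (x - p)\<bar>"
    using compact_positive_lower_bound[OF c cont] by blast
  define \<delta> where "\<delta> = min 1 (\<mu> / (\<bar>\<rho>\<bar> + norm n + 1))"
  have pos: "0 < \<bar>\<rho>\<bar> + norm n + 1" by (simp add: add_nonneg_pos)
  have \<delta>: "0 < \<delta>" "\<delta> \<le> 1" using \<mu>(1) pos by (auto simp: \<delta>_def)
  have "\<delta> * (\<bar>\<rho>\<bar> + norm n + 1) \<le> \<mu> / (\<bar>\<rho>\<bar> + norm n + 1) * (\<bar>\<rho>\<bar> + norm n + 1)"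
    using pos by (intro mult_right_mono) (auto simp: \<delta>_def)
  then have \<delta>\<mu>: "\<delta> * (\<bar>\<rho>\<bar> + norm n + 1) \<le> \<mu>" using pos by simp
  show ?thesis
  proof (rule that[OF \<delta>(1)], rule subsetI, rule ccontr)
    fix m q x assume m: "norm (m - n) < \<delta>" and q: "norm (q - p) < \<delta>"
      and x: "x \<in> hyperplane m q \<inter> cball p \<rho>" "x \<notin> G"
    have "n \<bullet> (x - p) = (n - m) \<bullet> (x - p) + m \<bullet> (q - p)"
      using x by (simp add: hyperplane_def inner_diff_left inner_diff_right)
    then have "\<bar>n \<bullet> (x - p)\<bar> \<le> \<bar>(n - m) \<bullet> (x - p)\<bar> + \<bar>m \<bullet> (q - p)\<bar>" by simp
    also have "\<dots> \<le> norm (n - m) * norm (x - p) + norm m * norm (q - p)"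
      by (intro add_mono Cauchy_Schwarz_ineq2)
    also have "\<dots> < \<delta> * (\<bar>\<rho>\<bar> + norm n + 1)"
    proof -
      have 1: "norm (n - m) * norm (x - p) \<le> \<delta> * \<bar>\<rho>\<bar>"
        using m x \<delta>(1) by (intro mult_mono) (auto simp: norm_minus_commute dist_norm)
      have "norm m \<le> norm (m - n) + norm n" by norm
      then have "norm m < norm n + 1" using m \<delta>(2) by linarith
      then have "norm m * norm (q - p) < (norm n + 1) * \<delta>"
        using q by (intro mult_strict_mono') auto
      then show ?thesis using 1 by (simp add: algebra_simps)
    qed
    finally have "\<bar>n \<bullet> (x - p)\<bar> < \<mu>" using \<delta>\<mu> by simp
    then show False using \<mu>(2)[of x] x by auto
  qed
qed

lemma convex_hyperplane_at: "convex (hyperplane n p)"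
proof -
  have "hyperplane n p = {x. n \<bullet> x = n \<bullet> p}" by (auto simp: hyperplane_def inner_diff_right)
  then show ?thesis by (simp only: convex_hyperplane)
qed

text \<open>The ambient dimension is at least two, so every such set contains a line.\<close>

lemma unbounded_hyperplane:
  fixes n p :: "'n::finite space"
  shows "\<not> bounded (hyperplane n p)"
proof
  assume "bounded (hyperplane n p)"
  then obtain B where B: "\<And>x. x \<in> hyperplane n p \<Longrightarrow> norm x \<le> B"
    using bounded_iff by blast
  have "2 \<le> DIM('n space)" by (simp add: card_UNIV_option finite_UNIV_card_ge_0 Suc_le_eq)
  then obtain e where e: "e \<noteq> 0" "n \<bullet> e = 0"
    using orthogonal_to_vector_exists[of n] by (auto simp: orthogonal_def)
  define t where "t = (B + norm p + 1) / norm e"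
  have te: "t * norm e = B + norm p + 1" using e by (simp add: t_def)
  have B0: "0 \<le> B" using B[of p] order_trans[OF norm_ge_zero[of p]] by (simp add: hyperplane_def)
  have t0: "0 \<le> t" using B0 e by (auto simp: t_def intro!: divide_nonneg_nonneg add_nonneg_nonneg)
  have "p + t *\<^sub>R e \<in> hyperplane n p" using e by (simp add: hyperplane_def)
  then have "norm (p + t *\<^sub>R e) \<le> B" by (rule B)
  moreover have "norm (t *\<^sub>R e) \<le> norm (p + t *\<^sub>R e) + norm p"
    by (metis add_diff_cancel_left' norm_triangle_ineq4)
  ultimately show False using te t0 by simp
qed

lemma enclosed_connected_subset:
  assumes "x \<in> enclosed M n p" "connected C" "C \<subseteq> hyperplane n p - slice M n p" "x \<in> C"
  shows "C \<subseteq> enclosed M n p"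
proof
  fix y assume y: "y \<in> C"
  have "C \<subseteq> connected_component_set (hyperplane n p - slice M n p) x"
    using assms(2-4) by (intro connected_component_maximal)
  then have "connected_component_set (hyperplane n p - slice M n p) x
      = connected_component_set (hyperplane n p - slice M n p) y"
    using y by (intro connected_component_eq[symmetric]) blast
  then show "y \<in> enclosed M n p" using assms(1,3) y by (auto simp: enclosed_def)
qed

text \<open>Without a slice the only component is the whole hyperplane, which is unbounded and so
  encloses nothing.\<close>

lemma slice_nonempty:
  fixes M :: "'n::finite space set"
  assumes "x \<in> enclosed M n p" shows "slice M n p \<noteq> {}"
proof
  assume "slice M n p = {}"
  then have "connected_component_set (hyperplane n p - slice M n p) x = hyperplane n p"
    using assms convex_connected[OF convex_hyperplane_at[of n p]] connected_component_eq_self[of "hyperplane n p" x]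
    by (simp add: enclosed_def)
  then show False using assms unbounded_hyperplane[of n p] by (simp add: enclosed_def)
qed

text \<open>By the intermediate value theorem a function avoiding the integers has constant integer
  part on a connected set.\<close>

lemma connected_unit_interval:
  fixes u :: "'a::topological_space \<Rightarrow> real" and k :: int
  assumes C: "connected C" "continuous_on C u" "\<And>x. x \<in> C \<Longrightarrow> u x \<notin> \<int>"
    and c: "c \<in> C" "k < u c" "u c < k + 1" and x: "x \<in> C"
  shows "k < u x" "u x < k + 1"
proof -
  have "0 < u x - k"
    by (rule connected_nonzero_positive[OF C(1) _ _ c(1) _ x])
      (use c C in \<open>auto intro!: continuous_intros dest!: C(3)\<close>)
  then show "k < u x" by simp
  have ne: "k + 1 - u y \<noteq> 0" if "y \<in> C" for y
  proof
    assume "k + 1 - u y = 0"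
    then have "u y = of_int (k + 1)" by simp
    then show False using C(3)[OF that] Ints_of_int by metis
  qed
  have "0 < k + 1 - u x"
    by (rule connected_nonzero_positive[OF C(1) _ ne c(1) _ x])
      (use c C in \<open>auto intro!: continuous_intros\<close>)
  then show "u x < k + 1" by simp
qed

lemma admissibleD:
  assumes "n \<in> admissible_directions M p"
  shows "norm n = 1" "\<And>q. q \<in> slice M n p \<Longrightarrow> \<not> tangent_space M q \<subseteq> perp n"
    "compact (slice M n p)" "connected (enclosed M n p)" "p \<in> enclosed M n p"
    "closure (enclosed M n p) - enclosed M n p = slice M n p"
    "\<exists>U. bounded_by M n p U \<and> emeasure lebesgue U < \<infinity>"
  using assms unfolding admissible_directions_def by blast+

text \<open>A union of bounded components need not be bounded; here connectedness puts everything
  into the component of \<open>p\<close>.\<close>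

lemma bounded_enclosed:
  assumes "n \<in> admissible_directions M p"
  shows "bounded (enclosed M n p)"
proof -
  note a = admissibleD[OF assms]
  have "enclosed M n p \<subseteq> connected_component_set (hyperplane n p - slice M n p) p"
    by (rule connected_component_maximal[OF a(5) a(4)]) (auto simp: enclosed_def)
  moreover have "bounded (connected_component_set (hyperplane n p - slice M n p) p)"
    using a(5) by (simp add: enclosed_def)
  ultimately show ?thesis using bounded_subset by blast
qed

text \<open>
  \<open>Inn\<close> and \<open>Out\<close> are the sets where the integer part of the index function is equal to, respectively
  different from, its value on the enclosed region.
\<close>

lemma enclosed_barrier:
  fixes M :: "'n::finite space set"
  assumes M: "smooth_hypersurface M" and \<nu>: "unit_normal M \<nu>" and n: "n \<in> admissible_directions M p"
  obtains Inn Out K \<rho> \<delta> where "open Inn" "open Out" "Inn \<inter> Out = {}" "Inn \<subseteq> ball p \<rho>" "- cball p \<rho> \<subseteq> Out"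
    "compact K" "K \<subseteq> M - mboundary M" "K \<inter> (Inn \<union> Out) = {}"
    "hyperplane n p \<inter> Inn = enclosed M n p" "hyperplane n p \<inter> K = slice M n p"
    "hyperplane n p \<subseteq> Inn \<union> Out \<union> K"
    "0 < \<delta>" "\<And>m q. norm (m - n) < \<delta> \<Longrightarrow> norm (q - p) < \<delta> \<Longrightarrow> hyperplane m q \<subseteq> Inn \<union> Out \<union> K"
    "\<And>\<gamma> U. \<gamma> \<in> slice M n p \<Longrightarrow> open U \<Longrightarrow> \<gamma> \<in> U \<Longrightarrow>
       \<exists>B. open B \<and> \<gamma> \<in> B \<and> B \<subseteq> U \<and> connected (B \<inter> Out) \<and> B \<inter> Out \<inter> hyperplane n p \<noteq> {}"
proof -
  note a = admissibleD[OF n]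
  let ?H = "hyperplane n p" and ?R = "enclosed M n p" and ?\<Gamma> = "slice M n p"
  have RH: "?R \<subseteq> ?H - ?\<Gamma>" by (auto simp: enclosed_def)
  obtain h K and u :: "'n space \<Rightarrow> real" where h: "0 < h" and K: "compact K" "K \<subseteq> M - mboundary M" "?H \<inter> K = ?\<Gamma>"
    and contu: "continuous_on {x. \<bar>n \<bullet> (x - p)\<bar> < h} u"
    and uK: "\<And>x. \<bar>n \<bullet> (x - p)\<bar> < h \<Longrightarrow> u x \<in> \<int> \<longleftrightarrow> x \<in> K"
    and uch: "\<And>\<gamma>. \<gamma> \<in> ?\<Gamma> \<Longrightarrow> \<exists>W f g. side_chart M \<nu> W f g \<and> \<gamma> \<in> W \<and> W \<subseteq> {x. \<bar>n \<bullet> (x - p)\<bar> < h} \<and>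
       (\<forall>x\<in>W. (0 < f x \<longrightarrow> u \<gamma> < u x \<and> u x < u \<gamma> + 1) \<and> (f x < 0 \<longrightarrow> u \<gamma> - 1 < u x \<and> u x < u \<gamma>) \<and>
          (f x = 0 \<longrightarrow> u x = u \<gamma>))"
    by (rule index_function[OF M \<nu> a(3) slice_nonempty[OF a(5)]]) (rule that; assumption)
  let ?Z = "{x. \<bar>n \<bullet> (x - p)\<bar> < h}"
  have oZ: "open ?Z" by (intro open_Collect_less continuous_intros)
  have HZ: "?H \<subseteq> ?Z" using h by (auto simp: hyperplane_def)
  have contH: "continuous_on C u" if "C \<subseteq> ?H" for C using contu HZ that continuous_on_subset by blast
  have uH: "u x \<notin> \<int>" if "x \<in> ?H - ?\<Gamma>" for x using uK[of x] K(3) HZ that by blast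
  define k where "k = \<lfloor>u p\<rfloor>"
  have up: "k < u p" "u p < k + 1"
  proof -
    have "u p \<notin> \<int>" using uH RH a(5) by blast
    then have "real_of_int k \<noteq> u p" by (metis Ints_of_int)
    moreover have "real_of_int k \<le> u p" "u p < real_of_int k + 1"
      using floor_correct[of "u p"] by (simp_all add: k_def)
    ultimately show "k < u p" "u p < k + 1" by linarith+
  qed
  have uR: "k < u x" "u x < k + 1" if "x \<in> ?R" for x
    using connected_unit_interval[OF a(4) contH _ a(5) up that] RH uH by blast+
  have "bounded (?R \<union> ?\<Gamma>)" using bounded_enclosed[OF n] compact_imp_bounded[OF a(3)] by simp
  moreover have "bounded K" using compact_imp_bounded[OF K(1)] .
  ultimately have "bounded (?R \<union> ?\<Gamma> \<union> K)" by simp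
  then obtain \<rho> where \<rho>: "?R \<union> ?\<Gamma> \<union> K \<subseteq> ball p \<rho>" using bounded_subset_ballD by blast
  \<comment> \<open>The index function lives on a slab that tilted planes leave far from
    \<open>p\<close>. Truncating \<open>Inn\<close> to a ball and adding the exterior of the ball to
    \<open>Out\<close> covers those parts. \<open>K\<close> is removed from \<open>Out\<close>
    because the index may be an integer other than \<open>k\<close> and \<open>k + 1\<close> on
    it.\<close>
  define Inn where "Inn = ball p \<rho> \<inter> (?Z \<inter> u -` {of_int k<..<of_int k + 1})"
  define Out where "Out = ((?Z \<inter> u -` ({..<of_int k} \<union> {of_int k + 1<..})) \<union> (- cball p \<rho>)) - K"
  have oI: "open Inn" unfolding Inn_def
    by (rule open_Int[OF open_ball continuous_open_preimage[OF contu oZ open_greaterThanLessThan]])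
  have oO: "open Out" unfolding Out_def
    by (intro open_Diff compact_imp_closed[OF K(1)] open_Un open_Compl closed_cball
        continuous_open_preimage[OF contu oZ] open_lessThan open_greaterThan)
  have IO: "Inn \<inter> Out = {}" by (auto simp: Inn_def Out_def)
  have no_int: "\<not> (k < y \<and> y < k + 1)" if y: "y \<in> \<int>" for y :: real
  proof -
    obtain j where "y = of_int j" using y by (auto elim: Ints_cases)
    then show ?thesis by (simp; linarith)
  qed
  have KIO: "K \<inter> (Inn \<union> Out) = {}"
    using uK no_int unfolding Inn_def Out_def by fastforce
  have far: "- cball p \<rho> \<subseteq> Out" using \<rho> by (auto simp: Out_def)
  have RI: "?R \<subseteq> Inn" using uR RH HZ \<rho> by (auto simp: Inn_def)
  have local: "\<exists>B. open B \<and> \<gamma> \<in> B \<and> B \<subseteq> U \<and> connected (B \<inter> Out) \<and> B \<inter> Out \<inter> ?H \<noteq> {} \<and>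
      B \<inter> ?H - ?\<Gamma> - ?R \<subseteq> Out" if \<gamma>: "\<gamma> \<in> ?\<Gamma>" and U: "open U" "\<gamma> \<in> U" for \<gamma> U
  proof -
    obtain W f g where W0: "side_chart M \<nu> W f g" "\<gamma> \<in> W" "W \<subseteq> ?Z"
      "\<forall>x\<in>W. (0 < f x \<longrightarrow> u \<gamma> < u x \<and> u x < u \<gamma> + 1) \<and> (f x < 0 \<longrightarrow> u \<gamma> - 1 < u x \<and> u x < u \<gamma>) \<and>
          (f x = 0 \<longrightarrow> u x = u \<gamma>)" using uch[OF \<gamma>] by blast
    have W: "side_chart M \<nu> W f g" "\<gamma> \<in> W" "W \<subseteq> ?Z"
      "\<And>x. x \<in> W \<Longrightarrow> 0 < f x \<Longrightarrow> u \<gamma> < u x \<and> u x < u \<gamma> + 1"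
      "\<And>x. x \<in> W \<Longrightarrow> f x < 0 \<Longrightarrow> u \<gamma> - 1 < u x \<and> u x < u \<gamma>"
      "\<And>x. x \<in> W \<Longrightarrow> f x = 0 \<Longrightarrow> u x = u \<gamma>" using W0 by blast+
    have \<gamma>M: "\<gamma> \<in> M" "\<gamma> \<in> ?H" using \<gamma> by (auto simp: slice_def)
    obtain e where e: "norm e = 1" "n \<bullet> e = 0" "0 < g \<gamma> \<bullet> e"
      using side_chart_transversal[OF W(1) \<gamma>M(1) W(2) a(2)[OF \<gamma>]] by blast
    let ?W = "W \<inter> U \<inter> ball p \<rho>"
    have sW: "side_chart M \<nu> ?W f g"
      by (rule side_chart_subset[OF W(1)]) (use W(1) U in \<open>auto simp: side_chart_def\<close>)
    have \<gamma>W: "\<gamma> \<in> ?W" using W(2) U \<gamma> \<rho> by blast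
    have f0: "f \<gamma> = 0" using side_chart_iff[OF W(1,2)] \<gamma>M by simp
    have oW: "open ?W" and dW: "\<And>x. x \<in> ?W \<Longrightarrow> (f has_derivative (\<lambda>h. g x \<bullet> h)) (at x)"
      and cg: "continuous_on ?W g" using sW unfolding side_chart_def by blast+
    obtain s b where sb: "0 < s" "0 < b" "box_nbhd e \<gamma> s b \<subseteq> ?W"
      and con: "\<And>S. convex S \<Longrightarrow> \<gamma> \<in> S \<Longrightarrow> (\<And>x t. x \<in> S \<Longrightarrow> x + t *\<^sub>R e \<in> S) \<Longrightarrow>
       connected (S \<inter> box_nbhd e \<gamma> s b \<inter> {x. 0 < f x}) \<and> connected (S \<inter> box_nbhd e \<gamma> s b \<inter> {x. f x < 0})"
      and sgn: "\<And>t. 0 < t \<Longrightarrow> t < s \<Longrightarrow> 0 < f (\<gamma> + t *\<^sub>R e) \<and> f (\<gamma> - t *\<^sub>R e) < 0"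
      and inB: "\<And>t. \<bar>t\<bar> < s \<Longrightarrow> \<gamma> + t *\<^sub>R e \<in> box_nbhd e \<gamma> s b"
      using box_nbhd_sides[OF oW \<gamma>W dW cg f0 e(1,3)] by metis
    define B where "B = box_nbhd e \<gamma> s b"
    have BW: "B \<subseteq> ?W" using sb(3) by (simp add: B_def)
    have oB: "open B" unfolding B_def by (rule open_box_nbhd)
    have \<gamma>B: "\<gamma> \<in> B" using inB[of 0] sb(1) by (simp add: B_def)
    have fz: "f x = 0 \<longleftrightarrow> x \<in> M" if "x \<in> B" for x using side_chart_iff[OF sW] BW that by blast
    have nM: "x \<notin> M" if "x \<in> B" "f x \<noteq> 0" for x using fz that by blast
    have f\<Gamma>: "x \<in> ?\<Gamma>" if "x \<in> B" "x \<in> ?H" "f x = 0" for x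
    proof -
      have "x \<notin> mboundary M" using sW BW that(1) unfolding side_chart_def by blast
      then show ?thesis using fz that by (simp add: slice_def)
    qed
    have conH: "connected (?H \<inter> B \<inter> {x. 0 < f x})" "connected (?H \<inter> B \<inter> {x. f x < 0})"
      using con[of ?H] \<gamma>M(2) e(2) convex_hyperplane_at[of n p]
      by (auto simp: B_def hyperplane_def inner_add_right inner_diff_right)
    have conB: "connected (B \<inter> {x. 0 < f x})" "connected (B \<inter> {x. f x < 0})"
      using con[of UNIV] by (auto simp: B_def)
    have sideH: "?H \<inter> B \<inter> {x. 0 < f x} \<subseteq> ?H - ?\<Gamma>" "?H \<inter> B \<inter> {x. f x < 0} \<subseteq> ?H - ?\<Gamma>"
      using nM by (fastforce simp: slice_def)+
    have notK: "x \<notin> K" if "x \<in> B" "f x \<noteq> 0" for x using fz[OF that(1)] that(2) K(2) by blast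
    \<comment> \<open>The region accumulates at \<open>\<gamma>\<close>, so it meets one of the two
      sides in the hyperplane; that side is connected and misses the slice, hence belongs to the
      region.\<close>
    have "\<gamma> \<in> closure ?R" using a(6) \<gamma> by blast
    then obtain y where y: "y \<in> ?R" "y \<in> B" using oB \<gamma>B by (meson IntE closure_iff_nhds_not_empty ex_in_conv order_refl)
    have yf: "f y \<noteq> 0" using f\<Gamma>[OF y(2)] y(1) RH by blast
    have pt: "\<gamma> + (s/2) *\<^sub>R e \<in> ?H \<inter> B \<inter> {x. 0 < f x}" "\<gamma> - (s/2) *\<^sub>R e \<in> ?H \<inter> B \<inter> {x. f x < 0}"
      using inB[of "s/2"] inB[of "-(s/2)"] sgn[of "s/2"] sb(1) e(2) \<gamma>M(2)
      by (auto simp: B_def hyperplane_def inner_add_right inner_diff_right)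
    have u\<gamma>: "u \<gamma> \<in> \<int>" using uK[of \<gamma>] K(3) \<gamma> HZ \<gamma>M(2) by blast
    then obtain j where j: "u \<gamma> = of_int j" by (auto elim: Ints_cases)
    have BZ: "x \<in> ?Z" "x \<in> W" "x \<in> ball p \<rho>" if "x \<in> B" for x using BW W(3) that by blast+
    have up': "u \<gamma> < u x \<and> u x < u \<gamma> + 1" if "x \<in> B" "0 < f x" for x using W(4) BZ that by blast
    have un': "u \<gamma> - 1 < u x \<and> u x < u \<gamma>" if "x \<in> B" "f x < 0" for x using W(5) BZ that by blast
    show ?thesis
    \<comment> \<open>The side meeting the region has index between \<open>k\<close> and
      \<open>k + 1\<close>. This forces \<open>u \<gamma>\<close> to be \<open>k\<close> if it is
      the positive side and \<open>k + 1\<close> if it is the negative one. Either way the opposite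
      side has index outside that interval, so it lies in \<open>Out\<close>.\<close>
    proof (cases "0 < f y")
      case True
      then have "?H \<inter> B \<inter> {x. 0 < f x} \<subseteq> ?R"
        using enclosed_connected_subset[OF y(1) conH(1) sideH(1)] y RH by blast
      have "j < k + 1" "k < j + 1" using up'[OF y(2) True] uR[OF y(1)] j by linarith+
      then have jk: "u \<gamma> = k" using j by simp
      have BO: "B \<inter> Out = B \<inter> {x. f x < 0}"
      proof (intro subset_antisym subsetI)
        fix x assume x: "x \<in> B \<inter> Out"
        then have "u x < k \<or> k + 1 < u x" "x \<notin> K" using BZ[of x] by (auto simp: Out_def)
        moreover have "f x \<noteq> 0" using calculation W(6)[of x] BZ[of x] x jk by auto
        ultimately show "x \<in> B \<inter> {x. f x < 0}" using up'[of x] x jk by force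
      next
        fix x assume x: "x \<in> B \<inter> {x. f x < 0}"
        then show "x \<in> B \<inter> Out" using un'[of x] jk BZ[of x] notK[of x] by (auto simp: Out_def)
      qed
      show ?thesis
      proof (intro exI[of _ B] conjI)
        show "B \<inter> ?H - ?\<Gamma> - ?R \<subseteq> Out"
        proof
          fix x assume x: "x \<in> B \<inter> ?H - ?\<Gamma> - ?R"
          then have "f x < 0" using f\<Gamma>[of x] \<open>?H \<inter> B \<inter> {x. 0 < f x} \<subseteq> ?R\<close>
            by (cases "f x" "0::real" rule: linorder_cases) auto
          then show "x \<in> Out" using BO x by blast
        qed
      qed (use oB \<gamma>B BW BO conB pt in auto)
    next
      case False
      then have fy: "f y < 0" using yf by simp
      then have sub: "?H \<inter> B \<inter> {x. f x < 0} \<subseteq> ?R"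
        using enclosed_connected_subset[OF y(1) conH(2) sideH(2)] y RH by blast
      have "j - 1 < k + 1" "k < j" using un'[OF y(2) fy] uR[OF y(1)] j by linarith+
      then have jk: "u \<gamma> = k + 1" using j by simp
      have BO: "B \<inter> Out = B \<inter> {x. 0 < f x}"
      proof (intro subset_antisym subsetI)
        fix x assume x: "x \<in> B \<inter> Out"
        then have "u x < k \<or> k + 1 < u x" "x \<notin> K" using BZ[of x] by (auto simp: Out_def)
        moreover have "f x \<noteq> 0" using calculation W(6)[of x] BZ[of x] x jk by auto
        ultimately show "x \<in> B \<inter> {x. 0 < f x}" using un'[of x] x jk by force
      next
        fix x assume x: "x \<in> B \<inter> {x. 0 < f x}"
        then show "x \<in> B \<inter> Out" using up'[of x] jk BZ[of x] notK[of x] by (auto simp: Out_def)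
      qed
      show ?thesis
      proof (intro exI[of _ B] conjI)
        show "B \<inter> ?H - ?\<Gamma> - ?R \<subseteq> Out"
        proof
          fix x assume x: "x \<in> B \<inter> ?H - ?\<Gamma> - ?R"
          then have "0 < f x" using f\<Gamma>[of x] sub
            by (cases "f x" "0::real" rule: linorder_cases) auto
          then show "x \<in> Out" using BO x by blast
        qed
      qed (use oB \<gamma>B BW BO conB pt in auto)
    qed
  qed
  \<comment> \<open>On the segment from \<open>x\<close> to \<open>p\<close> let
    \<open>\<gamma>\<close> be the first point of the slice. Just before \<open>\<gamma>\<close> the
    segment is outside the region, hence in \<open>Out\<close> by the local description, and the
    integer part of the index is constant from there back to \<open>x\<close>.\<close>
  have HO: "x \<in> Out" if x: "x \<in> ?H - ?R - ?\<Gamma>" for x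
  proof -
    have cvS: "closed_segment x p \<subseteq> ?H"
      using x convex_hyperplane_at[of n p] by (intro closed_segment_subset) (auto simp: hyperplane_def)
    let ?S = "closed_segment x p \<inter> ?\<Gamma>"
    have cS: "compact ?S" using a(3) by (intro compact_Int_closed compact_segment compact_imp_closed)
    have Sne: "?S \<noteq> {}"
    proof
      assume "?S = {}"
      then have "closed_segment x p \<subseteq> ?R"
        using cvS by (intro enclosed_connected_subset[OF a(5)]) auto
      then show False using x by auto
    qed
    have cd: "continuous_on ?S (dist x)" by (intro continuous_intros)
    obtain \<gamma> where \<gamma>: "\<gamma> \<in> ?S" "\<And>y. y \<in> ?S \<Longrightarrow> dist x \<gamma> \<le> dist x y"
      using continuous_attains_inf[OF cS Sne cd] by blast
    have xg: "x \<noteq> \<gamma>" using x \<gamma>(1) by blast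
    define C where "C = closed_segment x \<gamma> - {\<gamma>}"
    have osC: "open_segment x \<gamma> \<subseteq> C" by (auto simp: C_def open_segment_def)
    have "C \<subseteq> closure (open_segment x \<gamma>)" using xg by (auto simp: C_def closure_open_segment)
    then have cC: "connected C"
      using connected_intermediate_closure[OF convex_connected[OF convex_open_segment] osC] by blast
    have xC: "x \<in> C" using xg by (simp add: C_def)
    have "closed_segment x \<gamma> \<subseteq> closed_segment x p"
      using \<gamma>(1) by (auto simp: subset_closed_segment)
    then have CS: "C \<subseteq> closed_segment x p" by (auto simp: C_def)
    have "C \<inter> ?\<Gamma> = {}"
    proof (rule equals0I)
      fix y assume y: "y \<in> C \<inter> ?\<Gamma>"
      then have "dist x \<gamma> \<le> dist x y" using \<gamma>(2)[of y] CS by blast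
      moreover have "dist x y < dist x \<gamma>"
      proof -
        obtain t where t: "0 \<le> t" "t \<le> 1" "y = (1 - t) *\<^sub>R x + t *\<^sub>R \<gamma>" "y \<noteq> \<gamma>"
          using y by (auto simp: C_def in_segment)
        then have "t \<noteq> 1" by auto
        have "x - y = t *\<^sub>R (x - \<gamma>)" using t(3) by (simp add: algebra_simps)
        then have "dist x y = t * dist x \<gamma>" using t(1) by (simp add: dist_norm)
        moreover have "t * dist x \<gamma> < 1 * dist x \<gamma>"
          using xg t(2) \<open>t \<noteq> 1\<close> by (intro mult_strict_right_mono) auto
        ultimately show ?thesis by simp
      qed
      ultimately show False by simp
    qed
    then have CH: "C \<subseteq> ?H - ?\<Gamma>" using CS cvS by blast
    have CR: "C \<inter> ?R = {}"
    proof (rule equals0I)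
      fix y assume y: "y \<in> C \<inter> ?R"
      then have "C \<subseteq> ?R" using enclosed_connected_subset[of y M n p C] cC CH by blast
      then show False using x xC by blast
    qed
    have \<gamma>': "\<gamma> \<in> ?\<Gamma>" "\<gamma> \<in> ball p \<rho>" using \<gamma>(1) \<rho> by blast+
    obtain B where B: "open B" "\<gamma> \<in> B" "B \<inter> ?H - ?\<Gamma> - ?R \<subseteq> Out" "B \<subseteq> ball p \<rho>"
      using local[OF \<gamma>'(1) open_ball \<gamma>'(2)] by blast
    have "\<gamma> \<in> closure C"
    proof -
      have "\<gamma> \<in> closure (open_segment x \<gamma>)" using xg by (simp add: closure_open_segment)
      then show ?thesis using closure_mono[OF osC] by blast
    qed
    then obtain c where c: "c \<in> C" "c \<in> B"
      using B(1,2) by (meson IntE closure_iff_nhds_not_empty ex_in_conv order_refl)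
    have "c \<in> Out" using B(3) c CH CR by blast
    then have uc: "u c < k \<or> k + 1 < u c" using c B(4) by (auto simp: Out_def)
    define j where "j = \<lfloor>u c\<rfloor>"
    have "u c \<noteq> j" using uH CH c(1) by (metis Ints_of_int subsetD)
    moreover have "real_of_int j \<le> u c" "u c < real_of_int j + 1"
      using floor_correct[of "u c"] by (simp_all add: j_def)
    ultimately have j: "j < u c" "u c < j + 1" by linarith+
    then have jk: "j < k \<or> k < j" using uc by linarith
    have ux: "j < u x" "u x < j + 1"
      using connected_unit_interval[OF cC contH _ c(1) j xC] uH CH by blast+
    have "u x < k \<or> k + 1 < u x"
      using jk
    proof
      assume "j < k"
      then have "real_of_int j + 1 \<le> k" by linarith
      then show ?thesis using ux by linarith
    next
      assume "k < j"
      then have "real_of_int k + 1 \<le> j" by linarith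
      then show ?thesis using ux by linarith
    qed
    moreover have "x \<notin> K" using x K(3) by blast
    ultimately show "x \<in> Out" using x HZ by (auto simp: Out_def)
  qed
  have Hcov: "?H \<subseteq> Inn \<union> Out \<union> K" using RI HO K(3) by blast
  have HI: "?H \<inter> Inn = ?R"
  proof (intro subset_antisym subsetI)
    fix x assume x: "x \<in> ?H \<inter> Inn"
    show "x \<in> ?R"
    proof (rule ccontr)
      assume "x \<notin> ?R"
      moreover have "x \<notin> ?\<Gamma>" using x KIO K(3) by blast
      ultimately show False using HO[of x] x IO by blast
    qed
  qed (use RI RH in blast)
  \<comment> \<open>Near the hyperplane but inside the ball the index function is defined, so points
    there lie in \<open>Inn\<close>, \<open>Out\<close> or \<open>K\<close>; outside the closed ball
    everything is in \<open>Out\<close>.\<close>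
  define G where "G = Inn \<union> Out \<union> (?Z \<inter> ball p \<rho>)"
  have oG: "open G" unfolding G_def by (intro open_Un open_Int oI oO oZ open_ball)
  have HG: "?H \<inter> cball p \<rho> \<subseteq> G"
  proof
    fix x assume "x \<in> ?H \<inter> cball p \<rho>"
    then show "x \<in> G" using Hcov \<rho> HZ unfolding G_def by blast
  qed
  obtain \<delta> where \<delta>: "0 < \<delta>"
    "\<And>m q. norm (m - n) < \<delta> \<Longrightarrow> norm (q - p) < \<delta> \<Longrightarrow> hyperplane m q \<inter> cball p \<rho> \<subseteq> G"
    using hyperplanes_near_compact[OF oG HG] by metis
  have cov: "x \<in> Inn \<union> Out \<union> K" if x: "x \<in> ?Z \<inter> ball p \<rho>" for x
  proof (cases "u x \<in> \<int>")
    case True then show ?thesis using uK x by blast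
  next
    case False
    then have "u x \<noteq> k" "u x \<noteq> k + 1" using Ints_of_int[of k] Ints_of_int[of "k + 1"] by auto
    moreover have "x \<notin> K" using uK x False by blast
    ultimately show ?thesis using x by (auto simp: Inn_def Out_def)
  qed
  show ?thesis
  proof (rule that[OF oI oO IO _ far K(1,2) KIO HI K(3) Hcov \<delta>(1)])
    show "Inn \<subseteq> ball p \<rho>" by (auto simp: Inn_def)
  next
    fix m q assume "norm (m - n) < \<delta>" "norm (q - p) < \<delta>"
    then have *: "hyperplane m q \<inter> cball p \<rho> \<subseteq> G" by (rule \<delta>(2))
    show "hyperplane m q \<subseteq> Inn \<union> Out \<union> K"
    proof
      fix x assume "x \<in> hyperplane m q"
      then have "x \<in> G \<or> x \<in> - cball p \<rho>" using * by blast
      then show "x \<in> Inn \<union> Out \<union> K" using far cov[of x] by (auto simp: G_def)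
    qed
  next
    fix \<gamma> U assume "\<gamma> \<in> ?\<Gamma>" "open U" "\<gamma> \<in> U"
    from local[OF this] show "\<exists>B. open B \<and> \<gamma> \<in> B \<and> B \<subseteq> U \<and> connected (B \<inter> Out) \<and> B \<inter> Out \<inter> ?H \<noteq> {}"
      by blast
  qed
qed

section \<open>Hyperplanes close to an admissible one\<close>

lemma connected_subset_open_side:
  assumes "connected C" "open U" "open V" "U \<inter> V = {}" "C \<subseteq> U \<union> V" "c \<in> C" "c \<in> U"
  shows "C \<subseteq> U"
  using connectedD[OF assms(1-3)] assms(4-) by blast

text \<open>A coordinate line pointing inwards consists, after its start, of interior points. It
  serves to pass from facts about \<open>M - mboundary M\<close>, the only part a slice sees, to all
  of \<open>M\<close>.\<close>

lemma mboundary_subset_closure_interior: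
  fixes M :: "'n::finite space set"
  assumes y: "y \<in> mboundary M"
  shows "y \<in> closure (M - mboundary M)"
proof -
  obtain V and \<psi> :: "'n space \<Rightarrow> 'n space" and i where V: "diffeo_on V \<psi>" "y \<in> V" "\<psi> y $ Some i = 0"
    and MV: "M \<inter> V = {x\<in>V. \<psi> x $ None = 0 \<and> 0 \<le> \<psi> x $ Some i}"
    using y unfolding mboundary_def boundary_chart_def by blast
  have oV: "open V" and sm: "smooth_on V \<psi>" using V(1) by (simp_all add: diffeo_on_def)
  note MViff = Int_eq_Collect_iff[OF MV]
  have yM: "y \<in> M" using y by (simp add: mboundary_def)
  define X where "X = frechet_derivative (inv_into V \<psi>) (at (\<psi> y)) (axis (Some i) 1)"
  have DX: "frechet_derivative \<psi> (at y) X = axis (Some i) 1"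
    using diffeo_on_derivative_inverse(2)[OF V(1,2)] unfolding X_def by blast
  obtain \<gamma> \<epsilon> where \<gamma>: "0 < \<epsilon>" "\<gamma> (0::real) = y" "\<And>t. \<bar>t\<bar> < \<epsilon> \<Longrightarrow> \<gamma> t \<in> V"
    "\<And>t. \<bar>t\<bar> < \<epsilon> \<Longrightarrow> \<psi> (\<gamma> t) = \<psi> y + t *\<^sub>R frechet_derivative \<psi> (at y) X"
    "(\<gamma> has_vector_derivative X) (at 0)"
    using diffeo_on_curve[OF V(1) oV order_refl V(2)] by blast
  \<comment> \<open>Where the boundary coordinate is positive, the boundary chart is a flat
    chart.\<close>
  define S where "S = V \<inter> (\<lambda>x. \<psi> x $ Some i) -` {0<..}"
  have oS: "open S" unfolding S_def
    by (intro continuous_open_preimage continuous_on_component smooth_on_continuous[OF sm] oV open_greaterThan)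
  have MS: "M \<inter> S = {x\<in>S. \<psi> x $ None = 0}" using MViff by (auto simp: S_def)
  have y0: "\<psi> y $ None = 0" using MViff[OF V(2)] yM by simp
  have in_int: "\<gamma> t \<in> M - mboundary M" if t: "0 < t" "t < \<epsilon>" for t
  proof -
    have "\<psi> (\<gamma> t) $ Some i = t" "\<psi> (\<gamma> t) $ None = 0" "\<gamma> t \<in> V"
      using \<gamma>(3,4)[of t] t V(3) y0 DX by (auto simp: axis_def)
    then have *: "\<gamma> t \<in> S" "\<gamma> t \<in> M" using t MViff by (auto simp: S_def)
    then show ?thesis
      using flat_chart_not_boundary_chart[OF V(1) oS _ *(1,2) MS] by (auto simp: mboundary_def S_def)
  qed
  have "(\<gamma> \<longlongrightarrow> y) (at 0)"
    using has_vector_derivative_continuous[OF \<gamma>(5)] \<gamma>(2) by (simp add: continuous_at)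
  then have lim: "(\<gamma> \<longlongrightarrow> y) (at_right 0)" by (rule tendsto_within_subset) simp
  have "\<forall>\<^sub>F t in at_right 0. \<gamma> t \<in> M - mboundary M"
    using eventually_at_right_real[OF \<gamma>(1)] by (rule eventually_mono) (use in_int in auto)
  then have "\<forall>\<^sub>F t in at_right 0. \<gamma> t \<in> closure (M - mboundary M)"
    by (rule eventually_mono) (rule subsetD[OF closure_subset])
  then show ?thesis
    using Lim_in_closed_set[OF closed_closure _ _ lim] by simp
qed

text \<open>Removing from \<open>n\<close> its component along \<open>w\<close> moves it by less
  than \<open>\<epsilon>\<close>, and renormalizing costs at most as much again;
  \<open>\<epsilon> \<le> 1/2\<close> keeps the vector nonzero. Hence a point of a thin wedge about
  a hyperplane lies on a slightly tilted one.\<close>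

lemma perpendicular_unit_near:
  fixes n w :: "'a::real_inner"
  assumes n: "norm n = 1" and w: "\<bar>n \<bullet> w\<bar> < \<epsilon> * norm w" and \<epsilon>: "\<epsilon> \<le> 1/2"
  obtains m where "norm m = 1" "m \<bullet> w = 0" "norm (m - n) < 2 * \<epsilon>"
proof -
  have w0: "w \<noteq> 0" using w by auto
  define m' where "m' = n - ((n \<bullet> w) / (w \<bullet> w)) *\<^sub>R w"
  have m'w: "m' \<bullet> w = 0" using w0 by (simp add: m'_def inner_diff_left)
  have "norm (m' - n) = \<bar>n \<bullet> w\<bar> / (w \<bullet> w) * norm w" by (simp add: m'_def)
  also have "\<dots> = \<bar>n \<bullet> w\<bar> / norm w" using w0 by (simp add: dot_square_norm power2_eq_square)
  also have "\<dots> < \<epsilon>" using w w0 by (simp add: pos_divide_less_eq)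
  finally have d: "norm (m' - n) < \<epsilon>" .
  have "\<bar>norm m' - norm n\<bar> \<le> norm (m' - n)" by (rule norm_triangle_ineq3)
  then have d2: "\<bar>norm m' - 1\<bar> < \<epsilon>" using d n by simp
  then have m'0: "0 < norm m'" using \<epsilon> by linarith
  define m where "m = m' /\<^sub>R norm m'"
  have "m - m' = (1 / norm m' - 1) *\<^sub>R m'" by (simp add: m_def algebra_simps inverse_eq_divide)
  then have "norm (m - m') = \<bar>1 / norm m' - 1\<bar> * norm m'" by simp
  also have "\<dots> = \<bar>(1 / norm m' - 1) * norm m'\<bar>" by (simp add: abs_mult)
  also have "\<dots> = \<bar>1 - norm m'\<bar>" using m'0 by (simp add: algebra_simps)
  finally have "norm (m - m') < \<epsilon>" using d2 by linarith
  moreover have "norm (m - n) \<le> norm (m - m') + norm (m' - n)"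
    using norm_triangle_ineq[of "m - m'" "m' - n"] by simp
  ultimately have "norm (m - n) < 2 * \<epsilon>" using d by linarith
  moreover have "norm m = 1" using m'0 by (simp add: m_def)
  moreover have "m \<bullet> w = 0" using m'w by (simp add: m_def)
  ultimately show ?thesis using that by blast
qed

text \<open>
  A slice point in \<open>Inn\<close> would have points of the unenclosed part of the hyperplane next to it; their
  component is unbounded but cannot leave the bounded set \<open>Inn\<close>.
\<close>

lemma admissible_slice_in_barrier:
  fixes M :: "'n::finite space set"
  assumes M: "smooth_hypersurface M" and \<nu>: "unit_normal M \<nu>" and m: "m \<in> admissible_directions M p"
    and b: "open Inn" "open Out" "Inn \<inter> Out = {}" "bounded Inn" "p \<in> Inn" "K \<subseteq> M - mboundary M"
    and cov: "hyperplane m p \<subseteq> Inn \<union> Out \<union> K"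
  shows "slice M m p \<subseteq> K" "enclosed M m p \<subseteq> Inn"
proof -
  note a = admissibleD[OF m]
  have nK: "x \<notin> K" if "x \<in> hyperplane m p - slice M m p" for x using that b(6) by (auto simp: slice_def)
  have RH: "enclosed M m p \<subseteq> hyperplane m p - slice M m p" by (auto simp: enclosed_def)
  show RI: "enclosed M m p \<subseteq> Inn"
    by (rule connected_subset_open_side[OF a(4) b(1-3) _ a(5) b(5)]) (use RH nK cov in blast)
  have "enclosed M m p \<inter> Out = {}" using RI b(3) by blast
  then have clO: "closure (enclosed M m p) \<inter> Out = {}" using b(2) open_Int_closure_eq_empty by blast
  obtain Inn' Out' K' \<rho>' \<delta>' where b': "open Inn'" "open Out'" "Inn' \<inter> Out' = {}" "Inn' \<subseteq> ball p \<rho>'" "- cball p \<rho>' \<subseteq> Out'"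
    "compact K'" "K' \<subseteq> M - mboundary M" "K' \<inter> (Inn' \<union> Out') = {}"
    "hyperplane m p \<inter> Inn' = enclosed M m p" "hyperplane m p \<inter> K' = slice M m p"
    "hyperplane m p \<subseteq> Inn' \<union> Out' \<union> K'"
    "0 < \<delta>'" "\<And>m' q. norm (m' - m) < \<delta>' \<Longrightarrow> norm (q - p) < \<delta>' \<Longrightarrow> hyperplane m' q \<subseteq> Inn' \<union> Out' \<union> K'"
    "\<And>\<gamma> U. \<gamma> \<in> slice M m p \<Longrightarrow> open U \<Longrightarrow> \<gamma> \<in> U \<Longrightarrow>
       \<exists>B. open B \<and> \<gamma> \<in> B \<and> B \<subseteq> U \<and> connected (B \<inter> Out') \<and> B \<inter> Out' \<inter> hyperplane m p \<noteq> {}"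
    by (rule enclosed_barrier[OF M \<nu> m]) (rule that; assumption)
  show "slice M m p \<subseteq> K"
  proof
    fix \<gamma> assume \<gamma>: "\<gamma> \<in> slice M m p"
    show "\<gamma> \<in> K"
    proof (rule ccontr)
      assume "\<gamma> \<notin> K"
      moreover have "\<gamma> \<in> closure (enclosed M m p)" "\<gamma> \<in> hyperplane m p" using \<gamma> a(6) by (auto simp: slice_def)
      \<comment> \<open>The barrier belonging to \<open>m\<close> itself supplies points of the
        plane near \<open>\<gamma>\<close> that are not enclosed, and they still lie in the open set
        \<open>Inn\<close>.\<close>
      ultimately have "\<gamma> \<in> Inn" using cov clO by blast
      then obtain B where B: "B \<subseteq> Inn" "B \<inter> Out' \<inter> hyperplane m p \<noteq> {}"
        using b'(14)[OF \<gamma> b(1)] by blast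
      then obtain y where y: "y \<in> Inn" "y \<in> Out'" "y \<in> hyperplane m p" by blast
      have ynR: "y \<notin> enclosed M m p" using y b'(3,9) by blast
      have yn\<Gamma>: "y \<notin> slice M m p" using y b'(8,10) by blast
      let ?C = "connected_component_set (hyperplane m p - slice M m p) y"
      have sub: "?C \<subseteq> hyperplane m p - slice M m p" by (rule connected_component_subset)
      have yC: "y \<in> ?C" using y yn\<Gamma> by simp
      have "?C \<subseteq> Inn"
        by (rule connected_subset_open_side[OF connected_connected_component b(1-3) _ yC y(1)]) (use sub nK cov in blast)
      then have "bounded ?C" using b(4) bounded_subset by blast
      then show False using ynR yn\<Gamma> y by (simp add: enclosed_def)
    qed
  qed
qed

text \<open>The tilt contributes at most \<open>\<delta> * norm (x - p)\<close>. The shift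
  contributes less than \<open>\<delta>\<close>, which at distance at least \<open>r\<close> is at
  most \<open>\<delta> / r\<close> times the distance. Hence
  \<open>\<delta> * (1 + 1/r) = \<epsilon>\<close>.\<close>

lemma hyperplane_in_wedge:
  fixes n p :: "'a::real_inner"
  assumes "0 < \<epsilon>" "0 < r"
  obtains \<delta> where "0 < \<delta>" "\<And>m q x. norm m = 1 \<Longrightarrow> norm (m - n) < \<delta> \<Longrightarrow> norm (q - p) < \<delta> \<Longrightarrow> x \<in> hyperplane m q \<Longrightarrow>
     r \<le> norm (x - p) \<Longrightarrow> \<bar>n \<bullet> (x - p)\<bar> < \<epsilon> * norm (x - p)"
proof -
  define \<delta> where "\<delta> = \<epsilon> / (1 + 1 / r)"
  have pos: "0 < 1 + 1/r" using assms(2) by (simp add: add_pos_pos)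
  have \<delta>: "0 < \<delta>" using assms(1) pos by (simp add: \<delta>_def)
  have d\<epsilon>: "\<delta> * (1 + 1/r) = \<epsilon>" using pos by (simp add: \<delta>_def)
  show ?thesis
  proof (rule that[OF \<delta>])
    fix m q x assume m: "norm m = 1" "norm (m - n) < \<delta>" and q: "norm (q - p) < \<delta>"
      and x: "x \<in> hyperplane m q" "r \<le> norm (x - p)"
    have "n \<bullet> (x - p) = (n - m) \<bullet> (x - p) + m \<bullet> (q - p)"
      using x(1) by (simp add: hyperplane_def inner_diff_left inner_diff_right)
    then have "\<bar>n \<bullet> (x - p)\<bar> \<le> \<bar>(n - m) \<bullet> (x - p)\<bar> + \<bar>m \<bullet> (q - p)\<bar>" by simp
    also have "\<dots> \<le> norm (n - m) * norm (x - p) + norm m * norm (q - p)"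
      by (intro add_mono Cauchy_Schwarz_ineq2)
    also have "\<dots> < \<delta> * norm (x - p) + \<delta>"
      using m q x(2) assms(2) by (intro add_le_less_mono mult_right_mono) (auto simp: norm_minus_commute)
    also have "\<dots> \<le> \<delta> * norm (x - p) + \<delta> * (norm (x - p) / r)"
    proof -
      have "1 \<le> norm (x - p) / r" using x(2) assms(2) by simp
      from mult_left_mono[OF this, of \<delta>] show ?thesis using \<delta> by simp
    qed
    also have "\<dots> = \<epsilon> * norm (x - p)" using d\<epsilon> by (simp add: algebra_simps flip: d\<epsilon>)
    finally show "\<bar>n \<bullet> (x - p)\<bar> < \<epsilon> * norm (x - p)" .
  qed
qed

lemma emeasure_infinite_balls:
  fixes T :: "'a::euclidean_space set"
  assumes T: "open T" and \<kappa>: "0 < \<kappa>" and balls: "\<And>t. 1 \<le> t \<Longrightarrow> \<exists>c. ball c (t * \<kappa>) \<subseteq> T"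
  shows "emeasure lborel T = \<infinity>"
proof (rule ccontr)
  assume fin: "emeasure lborel T \<noteq> \<infinity>"
  define v where "v = unit_ball_vol (real DIM('a))"
  have v: "0 < v" by (simp add: v_def unit_ball_vol_pos)
  \<comment> \<open>\<open>1/\<kappa>\<close> makes the radius \<open>t * \<kappa>\<close> at least
    1, so that its power dominates the radius itself; the last term makes the resulting lower bound
    exceed the measure of \<open>T\<close>.\<close>
  define t where "t = max 1 (max (1/\<kappa>) ((measure lborel T + 1) / (v * \<kappa>)))"
  have t: "1 \<le> t" "1 / \<kappa> \<le> t" "(measure lborel T + 1) / (v * \<kappa>) \<le> t" by (auto simp: t_def)
  have t1: "1 \<le> t * \<kappa>" using t(2) \<kappa> by (simp add: pos_divide_le_eq)
  have t2: "measure lborel T + 1 \<le> v * (t * \<kappa>)" using t(3) \<kappa> v by (simp add: pos_divide_le_eq algebra_simps)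
  obtain c where c: "ball c (t * \<kappa>) \<subseteq> T" using balls[OF t(1)] by blast
  have "measure lborel (ball c (t * \<kappa>)) = v * (t * \<kappa>) ^ DIM('a)"
    using t1 by (simp add: content_ball v_def)
  moreover have "(t * \<kappa>) ^ 1 \<le> (t * \<kappa>) ^ DIM('a)" using t1 by (intro power_increasing) auto
  then have "v * (t * \<kappa>) \<le> v * (t * \<kappa>) ^ DIM('a)" using v by simp
  moreover have "measure lborel (ball c (t * \<kappa>)) \<le> measure lborel T"
    using c T fin by (intro measure_mono_fmeasurable) (auto simp: fmeasurable_def less_top)
  ultimately show False using t2 by linarith
qed

text \<open>The part of the cone beyond radius \<open>r\<close> is stable under dilations about
  \<open>p\<close> with factor at least 1. A small ball about \<open>x\<close> thus has arbitrarily
  large dilates in \<open>Y\<close>, each joined to \<open>x\<close> by a radial segment.\<close>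

lemma component_infinite_measure_in_cone:
  fixes Y :: "'a::euclidean_space set" and n p :: 'a
  assumes Y: "open Y" and cone: "\<And>y. r < norm (y - p) \<Longrightarrow> \<bar>n \<bullet> (y - p)\<bar> < \<epsilon> * norm (y - p) \<Longrightarrow> y \<in> Y"
    and x: "r < norm (x - p)" "\<bar>n \<bullet> (x - p)\<bar> < \<epsilon> * norm (x - p)" and r: "0 \<le> r"
  shows "emeasure lborel (connected_component_set Y x) = \<infinity>"
proof -
  define S where "S = {y. r < norm (y - p)} \<inter> {y. \<bar>n \<bullet> (y - p)\<bar> < \<epsilon> * norm (y - p)}"
  have oS: "open S" unfolding S_def by (intro open_Int open_Collect_less continuous_intros)
  have xS: "x \<in> S" using x by (simp add: S_def)
  have SY: "S \<subseteq> Y" using cone by (auto simp: S_def)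
  have dil: "p + t *\<^sub>R (y - p) \<in> S" if "y \<in> S" "1 \<le> t" for y t
  proof -
    have "norm (y - p) \<le> t * norm (y - p)" using that(2) by (simp add: mult_le_cancel_right1)
    moreover have "t * \<bar>n \<bullet> (y - p)\<bar> < t * (\<epsilon> * norm (y - p))"
      using that by (intro mult_strict_left_mono) (auto simp: S_def)
    moreover have "norm (p + t *\<^sub>R (y - p) - p) = t * norm (y - p)" "\<bar>n \<bullet> (p + t *\<^sub>R (y - p) - p)\<bar> = t * \<bar>n \<bullet> (y - p)\<bar>"
      using that(2) by (simp_all add: abs_mult)
    ultimately show ?thesis using that(1) unfolding S_def Int_iff mem_Collect_eq by (simp only:) (simp add: mult.left_commute)
  qed
  obtain \<kappa> where \<kappa>: "0 < \<kappa>" "ball x \<kappa> \<subseteq> S" using oS xS openE by blast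
  show ?thesis
  proof (rule emeasure_infinite_balls[OF open_connected_component[OF Y] \<kappa>(1)])
    fix t :: real assume t: "1 \<le> t"
    let ?c = "p + t *\<^sub>R (x - p)"
    have b: "ball ?c (t * \<kappa>) \<subseteq> S"
    proof
      fix z assume z: "z \<in> ball ?c (t * \<kappa>)"
      define y where "y = p + (1/t) *\<^sub>R (z - p)"
      have zy: "z = p + t *\<^sub>R (y - p)" using t by (simp add: y_def)
      have "norm (t *\<^sub>R (x - y)) < t * \<kappa>" using z unfolding zy by (simp add: dist_norm algebra_simps)
      then have "norm (x - y) < \<kappa>" using t by simp
      then have "y \<in> S" using \<kappa>(2) by (auto simp: dist_norm)
      then show "z \<in> S" using dil[OF _ t] zy by simp
    qed
    have seg: "closed_segment x ?c \<subseteq> S"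
    proof
      fix z assume "z \<in> closed_segment x ?c"
      then obtain s where s: "0 \<le> s" "s \<le> 1" "z = (1 - s) *\<^sub>R x + s *\<^sub>R ?c" by (auto simp: in_segment)
      have "z = p + (1 + s * (t - 1)) *\<^sub>R (x - p)" using s(3) by (simp add: algebra_simps)
      moreover have "0 \<le> s * (t - 1)" using s t by simp
      ultimately show "z \<in> S" using dil[OF xS, of "1 + s * (t - 1)"] by simp
    qed
    have "?c \<in> closed_segment x ?c \<inter> ball ?c (t * \<kappa>)" using t \<kappa>(1) by simp
    then have "connected (closed_segment x ?c \<union> ball ?c (t * \<kappa>))"
      by (intro connected_Un connected_segment connected_ball) blast
    then have "closed_segment x ?c \<union> ball ?c (t * \<kappa>) \<subseteq> connected_component_set Y x"
      using b seg SY by (intro connected_component_maximal) auto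
    then show "\<exists>c. ball c (t * \<kappa>) \<subseteq> connected_component_set Y x" by blast
  qed
qed

text \<open>
  \<open>A\<close> is the wedge swept out by the admissible hyperplanes through \<open>p\<close>, together with a ball around \<open>p\<close>.
  The components of \<open>Out \<inter> A\<close> contain cones, so a region of finite volume cannot contain them.
\<close>

lemma barrier_of_admissible_neighborhood:
  fixes M :: "'n::finite space set"
  assumes M: "smooth_hypersurface M" and \<nu>: "unit_normal M \<nu>" and n: "n \<in> admissible_directions M p"
    and W: "open W" "n \<in> W" "W \<inter> sphere 0 1 \<subseteq> admissible_directions M p"
    and r0: "0 < r0" "ball p r0 \<inter> M = {}"
  obtains Inn Out A \<delta> where "open Inn" "open Out" "Inn \<inter> Out = {}" "bounded Inn" "open A" "M \<inter> A \<inter> (Inn \<union> Out) = {}"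
    "hyperplane n p \<inter> Inn = enclosed M n p" "hyperplane n p \<subseteq> Inn \<union> Out \<union> slice M n p" "0 < \<delta>"
    "\<And>m q. norm m = 1 \<Longrightarrow> norm (m - n) < \<delta> \<Longrightarrow> norm (q - p) < \<delta> \<Longrightarrow>
       hyperplane m q \<subseteq> A \<and> hyperplane m q \<subseteq> Inn \<union> Out \<union> (M - mboundary M) \<and>
       (\<forall>x\<in>hyperplane m q \<inter> Out. emeasure lborel (connected_component_set (Out \<inter> A) x) = \<infinity>)"
proof -
  note a = admissibleD[OF n]
  let ?H = "hyperplane n p" and ?R = "enclosed M n p" and ?\<Gamma> = "slice M n p"
  obtain Inn Out K \<rho> \<delta>1 where b: "open Inn" "open Out" "Inn \<inter> Out = {}" "Inn \<subseteq> ball p \<rho>" "- cball p \<rho> \<subseteq> Out"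
    "compact K" "K \<subseteq> M - mboundary M" "K \<inter> (Inn \<union> Out) = {}"
    "?H \<inter> Inn = ?R" "?H \<inter> K = ?\<Gamma>" "?H \<subseteq> Inn \<union> Out \<union> K"
    "0 < \<delta>1" "\<And>m q. norm (m - n) < \<delta>1 \<Longrightarrow> norm (q - p) < \<delta>1 \<Longrightarrow> hyperplane m q \<subseteq> Inn \<union> Out \<union> K"
    "\<And>\<gamma> U. \<gamma> \<in> ?\<Gamma> \<Longrightarrow> open U \<Longrightarrow> \<gamma> \<in> U \<Longrightarrow>
       \<exists>B. open B \<and> \<gamma> \<in> B \<and> B \<subseteq> U \<and> connected (B \<inter> Out) \<and> B \<inter> Out \<inter> ?H \<noteq> {}"
    by (rule enclosed_barrier[OF M \<nu> n]) (rule that; assumption)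
  have bI: "bounded Inn" using b(4) bounded_ball bounded_subset by blast
  have pI: "p \<in> Inn" using b(9) a(5) by blast
  obtain r1 where r1: "0 < r1" "ball n r1 \<subseteq> W" using W openE by blast
  \<comment> \<open>The wedge is so thin that the direction through any of its points, at distance
    below \<open>2 * \<epsilon>\<close> from \<open>n\<close>, is admissible and has its plane
    covered by the barrier.\<close>
  define \<epsilon> where "\<epsilon> = min (1/2) (min (r1/2) (\<delta>1/2))"
  have \<epsilon>: "0 < \<epsilon>" "\<epsilon> \<le> 1/2" "2 * \<epsilon> \<le> r1" "2 * \<epsilon> \<le> \<delta>1" using r1 b(12) by (auto simp: \<epsilon>_def)
  define A where "A = {x. \<bar>n \<bullet> (x - p)\<bar> < \<epsilon> * norm (x - p)} \<union> ball p r0"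
  have oA: "open A" unfolding A_def by (intro open_Un open_ball open_Collect_less continuous_intros)
  have MK: "x \<in> K" if x: "x \<in> M - mboundary M" "x \<in> A" for x
  proof -
    have "\<bar>n \<bullet> (x - p)\<bar> < \<epsilon> * norm (x - p)" using x r0(2) by (auto simp: A_def)
    then obtain m where m: "norm m = 1" "m \<bullet> (x - p) = 0" "norm (m - n) < 2 * \<epsilon>"
      using perpendicular_unit_near[OF a(1) _ \<epsilon>(2)] by blast
    have "m \<in> ball n r1" using m(3) \<epsilon>(3) by (simp add: dist_norm norm_minus_commute)
    then have "m \<in> W \<inter> sphere 0 1" using r1(2) m(1) by auto
    then have mE: "m \<in> admissible_directions M p" using W(3) by blast
    have "hyperplane m p \<subseteq> Inn \<union> Out \<union> K" using b(13)[of m p] m(3) \<epsilon>(4) b(12) by simp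
    from admissible_slice_in_barrier(1)[OF M \<nu> mE b(1-3) bI pI b(7) this]
    show ?thesis using x m(2) by (auto simp: slice_def hyperplane_def)
  qed
  \<comment> \<open>A boundary point of \<open>M\<close> in the open set \<open>A\<close> would be a
    limit of interior points in \<open>A\<close>, hence of points of the compact set
    \<open>K\<close>, which contains no boundary points.\<close>
  have MAK: "M \<inter> A \<subseteq> K"
  proof
    fix x assume x: "x \<in> M \<inter> A"
    have "x \<notin> mboundary M"
    proof
      assume "x \<in> mboundary M"
      then have "x \<in> closure (M - mboundary M)" by (rule mboundary_subset_closure_interior)
      then have "x \<in> closure (A \<inter> (M - mboundary M))" using x oA open_Int_closure_subset by blast
      moreover have "closure (A \<inter> (M - mboundary M)) \<subseteq> K"
        using MK by (intro closure_minimal compact_imp_closed b(6)) blast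
      ultimately show False using b(7) \<open>x \<in> mboundary M\<close> by blast
    qed
    then show "x \<in> K" using MK x by blast
  qed
  obtain \<delta>2 where \<delta>2: "0 < \<delta>2" "\<And>m q x. norm m = 1 \<Longrightarrow> norm (m - n) < \<delta>2 \<Longrightarrow> norm (q - p) < \<delta>2 \<Longrightarrow> x \<in> hyperplane m q \<Longrightarrow>
     r0 \<le> norm (x - p) \<Longrightarrow> \<bar>n \<bullet> (x - p)\<bar> < \<epsilon> * norm (x - p)"
    by (rule hyperplane_in_wedge[OF \<epsilon>(1) r0(1)]) (rule that; assumption)
  have planeA: "hyperplane m q \<subseteq> A" if "norm m = 1" "norm (m - n) < \<delta>2" "norm (q - p) < \<delta>2" for m q
  proof
    fix x assume x: "x \<in> hyperplane m q"
    show "x \<in> A"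
    proof (cases "norm (x - p) < r0")
      case True then show ?thesis by (simp add: A_def dist_norm norm_minus_commute)
    next
      case False then show ?thesis using \<delta>2(2)[OF that x] by (simp add: A_def)
    qed
  qed
  define Y where "Y = Out \<inter> A"
  have oY: "open Y" using b(2) oA by (simp add: Y_def open_Int)
  define \<rho>' where "\<rho>' = max r0 \<rho>"
  have \<rho>': "0 \<le> \<rho>'" "r0 \<le> \<rho>'" "\<rho> \<le> \<rho>'" using r0 by (auto simp: \<rho>'_def)
  define Inf where "Inf x \<longleftrightarrow> emeasure lborel (connected_component_set Y x) = \<infinity>" for x
  have farInf: "Inf x" if x: "x \<in> A" "\<rho>' < norm (x - p)" for x
    unfolding Inf_def
  proof (rule component_infinite_measure_in_cone[OF oY _ x(2) _ \<rho>'(1)])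
    fix y assume y: "\<rho>' < norm (y - p)" "\<bar>n \<bullet> (y - p)\<bar> < \<epsilon> * norm (y - p)"
    then have "y \<in> - cball p \<rho>" using \<rho>' by (simp add: dist_norm norm_minus_commute)
    then show "y \<in> Y" using b(5) y(2) by (auto simp: Y_def A_def)
  next
    show "\<bar>n \<bullet> (x - p)\<bar> < \<epsilon> * norm (x - p)"
      using x \<rho>' by (auto simp: A_def dist_norm norm_minus_commute)
  qed
  have InfC: "Inf y" if "connected C" "C \<subseteq> Y" "x \<in> C" "y \<in> C" "Inf x" for C x y
  proof -
    have "y \<in> connected_component_set Y x"
      using connected_component_maximal[OF that(3,1,2)] that(4) by blast
    then show ?thesis using that(5) connected_component_eq unfolding Inf_def by metis
  qed
  have HA: "?H \<subseteq> A" using planeA[of n p] a(1) \<delta>2(1) by simp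
  \<comment> \<open>A point of the plane in \<open>Out\<close> is not enclosed, so its component in
    the plane is unbounded and reaches the zone where the cone argument applies.\<close>
  have HOInf: "Inf x" if x: "x \<in> ?H" "x \<in> Out" for x
  proof -
    let ?C = "connected_component_set (?H - ?\<Gamma>) x"
    have xn: "x \<notin> ?R" "x \<notin> ?\<Gamma>" using x b(3,8,9,10) by blast+
    then have unb: "\<not> bounded ?C" using x by (auto simp: enclosed_def)
    have xC: "x \<in> ?C" using x xn by simp
    have sub: "?C \<subseteq> ?H - ?\<Gamma>" by (rule connected_component_subset)
    have "?C \<inter> ?R = {}"
    proof (rule equals0I)
      fix y assume "y \<in> ?C \<inter> ?R"
      then have "?C \<subseteq> ?R" using enclosed_connected_subset[OF _ connected_connected_component sub] by blast
      then show False using xC xn(1) by blast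
    qed
    then have CY: "?C \<subseteq> Y" using sub b(9,10,11) HA unfolding Y_def by blast
    have "\<exists>y\<in>?C. \<rho>' < norm (y - p)"
    proof (rule ccontr)
      assume "\<not> ?thesis"
      then have "?C \<subseteq> cball p \<rho>'" by (force simp: dist_norm norm_minus_commute)
      then show False using unb bounded_cball bounded_subset by blast
    qed
    then obtain y where y: "y \<in> ?C" "\<rho>' < norm (y - p)" by blast
    have "Inf y" using farInf y CY by (auto simp: Y_def)
    then show ?thesis using InfC[OF connected_connected_component CY y(1) xC] by blast
  qed
  \<comment> \<open>Written as a union of open sets, so that the property on the original plane
    passes to nearby planes on compact sets. Near a slice point it spreads because the local part of
    \<open>Out\<close> is connected and meets the original plane.\<close>
  define G where "G = \<Union>{B. open B \<and> (\<forall>x\<in>B \<inter> Out. Inf x)}"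
  have oG: "open G" unfolding G_def by blast
  have HG: "?H \<inter> cball p \<rho>' \<subseteq> G"
  proof
    fix x assume "x \<in> ?H \<inter> cball p \<rho>'"
    then have xH: "x \<in> ?H" by simp
    then consider "x \<in> Inn" | "x \<in> Out" | "x \<in> ?\<Gamma>" using b(10,11) by blast
    then have "\<exists>B. open B \<and> x \<in> B \<and> (\<forall>y\<in>B \<inter> Out. Inf y)"
    proof cases
      case 1 then show ?thesis using b(1,3) by (intro exI[of _ Inn]) blast
    next
      case 2
      have xY: "x \<in> Y" using 2 HA xH by (auto simp: Y_def)
      have "Inf y" if "y \<in> connected_component_set Y x" for y
        by (rule InfC[OF connected_connected_component connected_component_subset _ that HOInf[OF xH 2]]) (use xY in simp)
      then show ?thesis using open_connected_component[OF oY, of x] xY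
        by (intro exI[of _ "connected_component_set Y x"]) simp
    next
      case 3
      obtain B where B: "open B" "x \<in> B" "B \<subseteq> A" "connected (B \<inter> Out)" "B \<inter> Out \<inter> ?H \<noteq> {}"
        using b(14)[OF 3 oA] HA xH by blast
      obtain z where z: "z \<in> B \<inter> Out" "z \<in> ?H" using B(5) by blast
      have BY: "B \<inter> Out \<subseteq> Y" using B(3) by (auto simp: Y_def)
      have "Inf z" using HOInf z by blast
      then have "\<forall>y\<in>B \<inter> Out. Inf y" using InfC[OF B(4) BY z(1)] by blast
      then show ?thesis using B(1,2) by blast
    qed
    then show "x \<in> G" unfolding G_def by blast
  qed
  obtain \<delta>3 where \<delta>3: "0 < \<delta>3"
    "\<And>m q. norm (m - n) < \<delta>3 \<Longrightarrow> norm (q - p) < \<delta>3 \<Longrightarrow> hyperplane m q \<inter> cball p \<rho>' \<subseteq> G"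
    by (rule hyperplanes_near_compact[OF oG HG]) (rule that; assumption)
  define \<delta> where "\<delta> = min \<delta>1 (min \<delta>2 \<delta>3)"
  have \<delta>: "0 < \<delta>" "\<delta> \<le> \<delta>1" "\<delta> \<le> \<delta>2" "\<delta> \<le> \<delta>3" using b(12) \<delta>2(1) \<delta>3(1) by (auto simp: \<delta>_def)
  show ?thesis
  proof (rule that[OF b(1-3) bI oA _ b(9) _ \<delta>(1)])
    show "M \<inter> A \<inter> (Inn \<union> Out) = {}" using MAK b(8) by blast
    show "?H \<subseteq> Inn \<union> Out \<union> ?\<Gamma>" using b(10,11) by blast
    fix m q assume m: "norm m = 1" and mq: "norm (m - n) < \<delta>" "norm (q - p) < \<delta>"
    have pA: "hyperplane m q \<subseteq> A" using planeA[OF m] mq \<delta> by simp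
    show "hyperplane m q \<subseteq> A \<and> hyperplane m q \<subseteq> Inn \<union> Out \<union> (M - mboundary M) \<and>
       (\<forall>x\<in>hyperplane m q \<inter> Out. emeasure lborel (connected_component_set (Out \<inter> A) x) = \<infinity>)"
    proof (intro conjI ballI)
      show "hyperplane m q \<subseteq> A" by (rule pA)
      show "hyperplane m q \<subseteq> Inn \<union> Out \<union> (M - mboundary M)" using b(13)[of m q] b(7) mq \<delta> by fastforce
      fix x assume x: "x \<in> hyperplane m q \<inter> Out"
      have "Inf x"
      proof (cases "\<rho>' < norm (x - p)")
        case True then show ?thesis using farInf pA x by blast
      next
        case False
        then have "x \<in> G" using \<delta>3(2)[of m q] mq \<delta> x by (auto simp: dist_norm norm_minus_commute)
        then show ?thesis using x unfolding G_def by blast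
      qed
      then show "emeasure lborel (connected_component_set (Out \<inter> A) x) = \<infinity>" by (simp add: Inf_def Y_def)
    qed
  qed
qed

section \<open>The region cut off by a hyperplane\<close>

text \<open>To leave \<open>U\<close> a connected set has to cross the frontier of \<open>U\<close>,
  which lies in the closed-off region and \<open>M\<close>. All later containments of cut-off
  regions come from this.\<close>

lemma bounded_by_connected_subset:
  assumes U: "bounded_by M n p U" and C: "connected C" "C \<inter> (closure (enclosed M n p) \<union> M) = {}"
    and x: "x \<in> C" "x \<in> U"
  shows "C \<subseteq> U"
proof (rule ccontr)
  assume "\<not> C \<subseteq> U"
  then have "C \<inter> frontier U \<noteq> {}" using connected_Int_frontier[OF C(1), of U] x by blast
  then show False using U C(2) unfolding bounded_by_def by blast
qed

lemma bounded_by_below: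
  assumes U: "bounded_by M n p U" and x: "x \<in> enclosed M n p" and s: "0 < s"
  obtains t where "0 < t" "t < s" "x - t *\<^sub>R n \<in> U"
proof -
  obtain \<epsilon> where "\<epsilon> > 0" "\<And>t. 0 < t \<Longrightarrow> t < \<epsilon> \<Longrightarrow> x - t *\<^sub>R n \<in> U"
    using U x unfolding bounded_by_def by meson
  then show ?thesis using that[of "min s \<epsilon> / 2"] s by auto
qed

text \<open>Both regions contain points just below \<open>p\<close>, and each is connected and
  avoids what bounds the other.\<close>

lemma bounded_by_unique:
  assumes U1: "bounded_by M n p U1" and U2: "bounded_by M n p U2" and p: "p \<in> enclosed M n p"
  shows "U1 = U2"
proof -
  obtain \<epsilon>1 \<epsilon>2 where "\<epsilon>1 > 0" "\<And>t. 0 < t \<Longrightarrow> t < \<epsilon>1 \<Longrightarrow> p - t *\<^sub>R n \<in> U1"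
    "\<epsilon>2 > 0" "\<And>t. 0 < t \<Longrightarrow> t < \<epsilon>2 \<Longrightarrow> p - t *\<^sub>R n \<in> U2"
    using U1 U2 p unfolding bounded_by_def by meson
  then have x: "p - (min \<epsilon>1 \<epsilon>2 / 2) *\<^sub>R n \<in> U1" "p - (min \<epsilon>1 \<epsilon>2 / 2) *\<^sub>R n \<in> U2" by auto
  have "U1 \<subseteq> U2"
    by (rule bounded_by_connected_subset[OF U2 _ _ x]) (use U1 in \<open>simp_all add: bounded_by_def\<close>)
  moreover have "U2 \<subseteq> U1"
    by (rule bounded_by_connected_subset[OF U1 _ _ x(2,1)]) (use U2 in \<open>simp_all add: bounded_by_def\<close>)
  ultimately show ?thesis by blast
qed

lemma cut_region_bounded_by:
  assumes "n \<in> admissible_directions M p"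
  shows "bounded_by M n p (cut_region M n p)" "emeasure lebesgue (cut_region M n p) < \<infinity>"
proof -
  note a = admissibleD[OF assms]
  obtain U where U: "bounded_by M n p U" "emeasure lebesgue U < \<infinity>" using a(7) by blast
  have "cut_region M n p = U"
    unfolding cut_region_def using U(1) bounded_by_unique[OF _ U(1) a(5)] by (rule the_equality)
  then show "bounded_by M n p (cut_region M n p)" "emeasure lebesgue (cut_region M n p) < \<infinity>"
    using U by auto
qed

text \<open>What the barrier provides for a single plane. Through the last clause, a region of
  finite volume that avoids \<open>M\<close> and the enclosed part cannot touch the plane in
  \<open>Out\<close>.\<close>

definition tame_plane :: "'n::finite space set \<Rightarrow> 'n space set \<Rightarrow> 'n space set \<Rightarrow> 'n space set \<Rightarrow>
    'n space \<Rightarrow> 'n space \<Rightarrow> bool" where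
  "tame_plane M Inn Out A m q \<longleftrightarrow> hyperplane m q \<subseteq> A \<and> hyperplane m q \<subseteq> Inn \<union> Out \<union> (M - mboundary M) \<and>
     (\<forall>x\<in>hyperplane m q \<inter> Out. emeasure lborel (connected_component_set (Out \<inter> A) x) = \<infinity>)"

text \<open>Off the slice the plane is covered by the disjoint open sets \<open>Inn\<close> and
  \<open>Out\<close>, so a component starting in the bounded set \<open>Inn\<close> stays there.
  Admissibility of \<open>m\<close> is not assumed, only tameness.\<close>

lemma Inn_subset_enclosed:
  assumes b: "open Inn" "open Out" "Inn \<inter> Out = {}" "bounded Inn" "M \<inter> A \<inter> (Inn \<union> Out) = {}"
    and t: "tame_plane M Inn Out A m q"
  shows "hyperplane m q \<inter> Inn \<subseteq> enclosed M m q"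
proof
  fix x assume x: "x \<in> hyperplane m q \<inter> Inn"
  let ?C = "connected_component_set (hyperplane m q - slice M m q) x"
  have HA: "hyperplane m q \<subseteq> A" "hyperplane m q \<subseteq> Inn \<union> Out \<union> (M - mboundary M)"
    using t by (auto simp: tame_plane_def)
  have xs: "x \<in> hyperplane m q - slice M m q" using x HA(1) b(5) by (auto simp: slice_def)
  then have xC: "x \<in> ?C" by simp
  have sub: "?C \<subseteq> hyperplane m q - slice M m q" by (rule connected_component_subset)
  then have "?C \<subseteq> Inn \<union> Out" using HA(2) by (auto simp: slice_def)
  then have "?C \<subseteq> Inn"
    using connected_subset_open_side[OF connected_connected_component b(1-3) _ xC] x by blast
  then show "x \<in> enclosed M m q" using xs b(4) bounded_subset by (auto simp: enclosed_def)
qed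

lemma enclosed_subset_Inn:
  assumes b: "open Inn" "open Out" "Inn \<inter> Out = {}" "M \<inter> A \<inter> (Inn \<union> Out) = {}"
    and t: "tame_plane M Inn Out A m q" and m: "m \<in> admissible_directions M q" and q: "q \<in> Inn"
  shows "enclosed M m q \<subseteq> Inn" "closure (enclosed M m q) \<inter> Out = {}"
proof -
  note a = admissibleD[OF m]
  have "enclosed M m q \<subseteq> Inn \<union> Out"
    using t by (auto simp: tame_plane_def enclosed_def slice_def)
  then show "enclosed M m q \<subseteq> Inn"
    using connected_subset_open_side[OF a(4) b(1-3) _ a(5) q] by blast
  then have "enclosed M m q \<inter> Out = {}" using b(3) by blast
  then show "closure (enclosed M m q) \<inter> Out = {}" using b(2) open_Int_closure_eq_empty by blast
qed

lemma closure_enclosed_subset_hyperplane: "closure (enclosed M m q) \<subseteq> hyperplane m q"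
proof (rule closure_minimal)
  have "hyperplane m q = {x. m \<bullet> x = m \<bullet> q}" by (auto simp: hyperplane_def inner_diff_right)
  then show "closed (hyperplane m q)" by (simp add: closed_hyperplane)
qed (auto simp: enclosed_def)

text \<open>A point in \<open>Out\<close> would drag its whole component of
  \<open>Out \<inter> A\<close> into the region, since that component avoids \<open>M\<close> and
  the closure of the enclosed set, and this component has infinite volume. The second plane may
  differ from the cutting one, as is needed for all parallels sweeping a slab.\<close>

lemma cut_region_avoids_Out:
  fixes M :: "'n::finite space set"
  assumes b: "open Inn" "open Out" "Inn \<inter> Out = {}" "open A" "M \<inter> A \<inter> (Inn \<union> Out) = {}"
    and t: "tame_plane M Inn Out A m q" and m: "m \<in> admissible_directions M q" and q: "q \<in> Inn"
    and t': "tame_plane M Inn Out A m' q'"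
  shows "cut_region M m q \<inter> hyperplane m' q' \<inter> Out = {}"
proof (rule equals0I)
  note U = cut_region_bounded_by[OF m]
  fix x assume x: "x \<in> cut_region M m q \<inter> hyperplane m' q' \<inter> Out"
  let ?T = "connected_component_set (Out \<inter> A) x"
  have xT: "x \<in> ?T" using x t' by (auto simp: tame_plane_def)
  have sub: "?T \<subseteq> Out \<inter> A" by (rule connected_component_subset)
  have "?T \<inter> (closure (enclosed M m q) \<union> M) = {}"
    using sub enclosed_subset_Inn(2)[OF b(1-3,5) t m q] b(5) by blast
  then have "?T \<subseteq> cut_region M m q"
    using bounded_by_connected_subset[OF U(1) connected_connected_component _ xT] x by blast
  moreover have oU: "open (cut_region M m q)" using U(1) by (simp add: bounded_by_def)
  ultimately have "emeasure lborel ?T \<le> emeasure lborel (cut_region M m q)"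
    by (intro emeasure_mono) auto
  also have "\<dots> = emeasure lebesgue (cut_region M m q)" using oU by simp
  finally show False using U(2) x t' by (auto simp: tame_plane_def)
qed

text \<open>The region misses its plane: in \<open>Inn\<close> the plane is enclosed, in
  \<open>Out\<close> the volume would be infinite, and the rest is on \<open>M\<close>. Being
  connected and containing points just below \<open>q\<close>, it lies below.\<close>

lemma cut_region_below:
  fixes M :: "'n::finite space set"
  assumes b: "open Inn" "open Out" "Inn \<inter> Out = {}" "bounded Inn" "open A" "M \<inter> A \<inter> (Inn \<union> Out) = {}"
    and t: "tame_plane M Inn Out A m q" and m: "m \<in> admissible_directions M q" and q: "q \<in> Inn"
  shows "cut_region M m q \<subseteq> {x. m \<bullet> (x - q) < 0}"
proof
  note a = admissibleD[OF m] and U = cut_region_bounded_by(1)[OF m]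
  have UF: "cut_region M m q \<inter> (closure (enclosed M m q) \<union> M) = {}" using U by (simp add: bounded_by_def)
  have UH: "cut_region M m q \<inter> hyperplane m q = {}"
  proof (rule equals0I)
    fix x assume x: "x \<in> cut_region M m q \<inter> hyperplane m q"
    then have "x \<in> Inn" using UF t cut_region_avoids_Out[OF b(1-3,5,6) t m q t] by (auto simp: tame_plane_def)
    then have "x \<in> enclosed M m q" using Inn_subset_enclosed[OF b(1-4,6) t] x by blast
    then show False using UF x closure_subset[of "enclosed M m q"] by blast
  qed
  obtain s where s: "0 < s" "s < 1" "q - s *\<^sub>R m \<in> cut_region M m q"
    using bounded_by_below[OF U a(5), of 1] by auto
  fix x assume x: "x \<in> cut_region M m q"
  have "0 < - (m \<bullet> (x - q))"
  proof (rule connected_nonzero_positive[OF _ _ _ s(3) _ x, where f = "\<lambda>x. - (m \<bullet> (x - q))"])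
    show "connected (cut_region M m q)" using U by (simp add: bounded_by_def)
    show "- (m \<bullet> (y - q)) \<noteq> 0" if "y \<in> cut_region M m q" for y using UH that by (auto simp: hyperplane_def)
    show "0 < - (m \<bullet> (q - s *\<^sub>R m - q))" using s(1) a(1) by (simp add: dot_square_norm)
  qed (intro continuous_intros)
  then show "x \<in> {x. m \<bullet> (x - q) < 0}" by simp
qed

text \<open>The region of the upper plane is that of the lower plane plus a piece \<open>T\<close>
  of the slab. \<open>T\<close> is not determined exactly but only squeezed: near its lateral
  boundary \<open>M\<close> may cut off columns, so only points with room \<open>w\<close> inside
  \<open>Inn\<close> are claimed to belong to it.\<close>

lemma cut_region_slab:
  fixes M :: "'n::finite space set"
  assumes b: "open Inn" "open Out" "Inn \<inter> Out = {}" "bounded Inn" "open A" "M \<inter> A \<inter> (Inn \<union> Out) = {}"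
    and planes: "\<forall>s. \<bar>s\<bar> < r \<longrightarrow> tame_plane M Inn Out A m (q + s *\<^sub>R m) \<and> q + s *\<^sub>R m \<in> Inn"
    and m: "m \<in> admissible_directions M q" "m \<in> admissible_directions M q'"
    and q': "q' \<in> Inn" and w: "w = m \<bullet> (q' - q)" "0 < w" "w < r"
  obtains T where "T \<in> sets borel" "T \<subseteq> Inn \<inter> {x. 0 \<le> m \<bullet> (x - q) \<and> m \<bullet> (x - q) < w}"
    "\<And>x. 0 \<le> m \<bullet> (x - q) \<Longrightarrow> m \<bullet> (x - q) < w \<Longrightarrow> cball x w \<subseteq> Inn \<Longrightarrow> x \<in> T"
    "cut_volume M m q' - cut_volume M m q = measure lebesgue T"
proof -
  have tame: "tame_plane M Inn Out A m (q + s *\<^sub>R m)" and col: "q + s *\<^sub>R m \<in> Inn" if "\<bar>s\<bar> < r" for s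
    using planes that by blast+
  note a1 = admissibleD[OF m(1)] and a2 = admissibleD[OF m(2)]
  note U1 = cut_region_bounded_by[OF m(1)] and U2 = cut_region_bounded_by[OF m(2)]
  have mm: "m \<bullet> m = 1" using a1(1) by (simp add: norm_eq_1)
  have hyp: "hyperplane m (q + s *\<^sub>R m) = {x. m \<bullet> (x - q) = s}" for s
    using mm by (auto simp: hyperplane_def inner_diff_right inner_add_right)
  have H1: "hyperplane m q = {x. m \<bullet> (x - q) = 0}" by (simp add: hyperplane_def)
  have H2: "hyperplane m q' = {x. m \<bullet> (x - q) = w}" using w(1) by (auto simp: hyperplane_def inner_diff_right)
  have t1: "tame_plane M Inn Out A m q" using tame[of 0] w by simp
  have eqH: "hyperplane m q' = hyperplane m (q + w *\<^sub>R m)" using H2 hyp[of w] by simp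
  have t2: "tame_plane M Inn Out A m q'"
    using tame[of w] w unfolding tame_plane_def eqH by simp
  have q: "q \<in> Inn" using col[of 0] w by simp
  let ?U1 = "cut_region M m q" and ?U2 = "cut_region M m q'"
  let ?F1 = "closure (enclosed M m q) \<union> M" and ?F2 = "closure (enclosed M m q') \<union> M"
  have below1: "m \<bullet> (x - q) < 0" if "x \<in> ?U1" for x
    using cut_region_below[OF b t1 m(1) q] that by blast
  have below2: "m \<bullet> (x - q) < w" if "x \<in> ?U2" for x
    using cut_region_below[OF b t2 m(2) q'] that w(1) by (auto simp: inner_diff_right)
  have o: "open ?U1" "open ?U2" "connected ?U1" "connected ?U2" "?U1 \<inter> ?F1 = {}" "?U2 \<inter> ?F2 = {}"
     "frontier ?U1 \<subseteq> ?F1" using U1(1) U2(1) unfolding bounded_by_def by auto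
  have inA: "x \<in> A" if "\<bar>m \<bullet> (x - q)\<bar> < r" for x
    using tame[OF that] hyp[of "m \<bullet> (x - q)"] by (auto simp: tame_plane_def)
  have noM: "x \<notin> M" if "\<bar>m \<bullet> (x - q)\<bar> < r" "x \<in> Inn" for x using inA[OF that(1)] that(2) b(6) by blast
  have cl1: "m \<bullet> (x - q) = 0" if "x \<in> closure (enclosed M m q)" for x
    using closure_enclosed_subset_hyperplane[of M m q] that H1 by blast
  have cl2: "m \<bullet> (x - q) = w" if "x \<in> closure (enclosed M m q')" for x
    using closure_enclosed_subset_hyperplane[of M m q'] that H2 by blast
  \<comment> \<open>The vertical column above \<open>x\<close> stays in \<open>Inn\<close>, hence
    off \<open>M\<close>, until it reaches the enclosed part of the upper plane; just below that it
    is in \<open>?U2\<close>, and the column connects back to \<open>x\<close>.\<close>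
  have ascend: "x \<in> ?U2" if x: "- r < m \<bullet> (x - q)" "m \<bullet> (x - q) < w"
    and colx: "\<And>s. 0 \<le> s \<Longrightarrow> s \<le> w - m \<bullet> (x - q) \<Longrightarrow> x + s *\<^sub>R m \<in> Inn" for x
  proof -
    define c where "c = w - m \<bullet> (x - q)"
    have c: "0 < c" using x(2) by (simp add: c_def)
    have mx: "m \<bullet> (x + s *\<^sub>R m - q) = m \<bullet> (x - q) + s" for s
      using mm by (simp add: inner_diff_right inner_add_right)
    have "x + c *\<^sub>R m \<in> hyperplane m q' \<inter> Inn" using colx[of c] c mx[of c] by (simp add: H2 c_def)
    then have "x + c *\<^sub>R m \<in> enclosed M m q'" using Inn_subset_enclosed[OF b(1-4,6) t2] by blast
    then obtain t where t: "0 < t" "t < c" "x + c *\<^sub>R m - t *\<^sub>R m \<in> ?U2"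
      using bounded_by_below[OF U2(1) _ c] by metis
    let ?C = "(\<lambda>s. x + s *\<^sub>R m) ` {0..c - t}"
    have "?C \<subseteq> ?U2"
    proof (rule bounded_by_connected_subset[OF U2(1)])
      show "connected ?C" by (intro connected_continuous_image continuous_intros) simp
      show "?C \<inter> ?F2 = {}"
      proof (rule equals0I)
        fix y assume y: "y \<in> ?C \<inter> ?F2"
        then have "\<exists>s\<in>{0..c - t}. y = x + s *\<^sub>R m" by blast
        then obtain s where s: "y = x + s *\<^sub>R m" "0 \<le> s" "s \<le> c - t" using atLeastAtMost_iff by blast
        have my: "m \<bullet> (y - q) = m \<bullet> (x - q) + s" using mx s(1) by simp
        then have lt: "m \<bullet> (y - q) < w" "- r < m \<bullet> (y - q)" using s t x by (auto simp: c_def)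
        moreover have "y \<in> Inn" unfolding s(1) by (rule colx) (use s t in \<open>auto simp: c_def\<close>)
        ultimately have "y \<notin> M" using noM[of y] w(3) by auto
        then show False using y cl2[of y] lt by auto
      qed
      show "x + (c - t) *\<^sub>R m \<in> ?C" using t by (intro imageI) auto
      show "x + (c - t) *\<^sub>R m \<in> ?U2" using t(3) by (simp add: algebra_simps)
    qed
    moreover have "x + 0 *\<^sub>R m \<in> ?C" using t by (intro imageI) auto
    ultimately show "x \<in> ?U2" by auto
  qed
  \<comment> \<open>A common point of the two regions, on the normal line through
    \<open>q\<close>.\<close>
  obtain s0 where s0: "0 < s0" "s0 < r - w" "q - s0 *\<^sub>R m \<in> ?U1"
    using bounded_by_below[OF U1(1) a1(5), of "r - w"] w(3) by auto
  have s0U2: "q - s0 *\<^sub>R m \<in> ?U2"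
  proof (rule ascend)
    have *: "m \<bullet> (q - s0 *\<^sub>R m - q) = - s0" using mm by simp
    show "- r < m \<bullet> (q - s0 *\<^sub>R m - q)" "m \<bullet> (q - s0 *\<^sub>R m - q) < w" using * s0 w by auto
    fix s assume "0 \<le> s" "s \<le> w - m \<bullet> (q - s0 *\<^sub>R m - q)"
    then have "q + (s - s0) *\<^sub>R m \<in> Inn" using * s0 w by (intro col) auto
    then show "q - s0 *\<^sub>R m + s *\<^sub>R m \<in> Inn" by (simp add: algebra_simps)
  qed
  have sub12: "?U1 \<subseteq> ?U2"
  proof (rule bounded_by_connected_subset[OF U2(1) o(3) _ s0(3) s0U2])
    show "?U1 \<inter> ?F2 = {}" using o(5) cl2 below1 w(2) by fastforce
  qed
  \<comment> \<open>A disconnection of \<open>?U2\<close> unless \<open>X\<close> is empty: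
    \<open>Y\<close> is \<open>?U1\<close> with everything on or above the lower plane,
    \<open>X\<close> is whatever else lies below it. A point of \<open>?U2\<close> below that plane
    and outside \<open>?U1\<close> is even outside the closure of \<open>?U1\<close>, because it
    avoids all that bounds \<open>?U1\<close>.\<close>
  define X where "X = (?U2 \<inter> {x. m \<bullet> (x - q) < 0}) - closure ?U1"
  define Y where "Y = ?U1 \<union> (?U2 \<inter> {x. 0 \<le> m \<bullet> (x - q)})"
  have oX: "open X" unfolding X_def
    by (intro open_Diff open_Int o closed_closure open_Collect_less continuous_intros)
  have X': "x \<in> X" if "x \<in> ?U2" "m \<bullet> (x - q) < 0" "x \<notin> ?U1" for x
  proof -
    have "x \<notin> ?F1" using that o(6) cl1[of x] by auto
    then have "x \<notin> frontier ?U1" using o(7) by blast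
    then have "x \<notin> closure ?U1" using that(3) interior_open[OF o(1)] by (simp add: frontier_def)
    then show ?thesis using that by (simp add: X_def)
  qed
  have oY: "open Y"
  proof (rule openI)
    fix y assume y: "y \<in> Y"
    show "\<exists>e>0. ball y e \<subseteq> Y"
    proof (cases "y \<in> ?U1")
      case True
      obtain e where "0 < e" "ball y e \<subseteq> ?U1" using openE[OF o(1) True] by blast
      then show ?thesis unfolding Y_def by blast
    next
      case False
      then have y2: "y \<in> ?U2" "0 \<le> m \<bullet> (y - q)" using y by (auto simp: Y_def)
      obtain e where e: "0 < e" "ball y e \<subseteq> ?U2" using o(2) y2(1) openE by blast
      show ?thesis
      proof (cases "m \<bullet> (y - q) = 0")
        case False
        let ?V = "?U2 \<inter> {x. 0 < m \<bullet> (x - q)}"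
        have "open ?V" by (intro open_Int o open_Collect_less continuous_intros)
        then obtain e where "0 < e" "ball y e \<subseteq> ?V" using y2 False openE[of ?V y] by auto
        then show ?thesis unfolding Y_def by fastforce
      next
        case True
        \<comment> \<open>Only here can the openness of \<open>Y\<close> fail. The point must lie in
          \<open>Inn\<close>, so it is enclosed; then the lower half of a small ball avoids all
          barriers and contains points of \<open>?U1\<close>, hence lies in
          \<open>?U1\<close>.\<close>
        have yH: "y \<in> hyperplane m q" using True by (simp add: H1)
        have "y \<in> Inn"
          using yH y2(1) t1 o(6) cut_region_avoids_Out[OF b(1-3,5,6) t2 m(2) q' t1] by (auto simp: tame_plane_def)
        then have yR: "y \<in> enclosed M m q" using Inn_subset_enclosed[OF b(1-4,6) t1] yH by blast
        obtain t where t: "0 < t" "t < e" "y - t *\<^sub>R m \<in> ?U1" using bounded_by_below[OF U1(1) yR e(1)] by blast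
        let ?L = "ball y e \<inter> {x. m \<bullet> x < m \<bullet> q}"
        have "?L \<subseteq> ?U1"
        proof (rule bounded_by_connected_subset[OF U1(1) _ _ _ t(3)])
          show "connected ?L" by (intro convex_connected convex_Int convex_ball convex_halfspace_lt)
          show "?L \<inter> ?F1 = {}" using e(2) o(6) cl1 by (fastforce simp: inner_diff_right)
          show "y - t *\<^sub>R m \<in> ?L" using t a1(1) mm True by (simp add: dist_norm inner_diff_right)
        qed
        then have "ball y e \<subseteq> Y" using e(2) by (force simp: Y_def inner_diff_right)
        then show ?thesis using e(1) by blast
      qed
    qed
  qed
  have "X \<inter> Y = {}" unfolding X_def Y_def using closure_subset by fastforce
  moreover have U2XY: "?U2 \<subseteq> Y \<union> X" using X' by (fastforce simp: Y_def)
  ultimately have "?U2 \<subseteq> Y"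
    using connected_subset_open_side[OF o(4) oY oX _ U2XY s0U2] s0(3) by (auto simp: Y_def)
  then have U1eq: "?U1 = ?U2 \<inter> {x. m \<bullet> (x - q) < 0}" using sub12 below1 by (fastforce simp: Y_def)
  define T where "T = ?U2 \<inter> {x. 0 \<le> m \<bullet> (x - q)}"
  have Tm: "T \<in> sets borel"
    unfolding T_def by (intro sets.Int borel_open[OF o(2)] borel_closed closed_Collect_le continuous_intros)
  have U2eq: "?U2 = ?U1 \<union> T" "?U1 \<inter> T = {}" unfolding U1eq T_def by auto
  show ?thesis
  proof (rule that[OF Tm])
    show "T \<subseteq> Inn \<inter> {x. 0 \<le> m \<bullet> (x - q) \<and> m \<bullet> (x - q) < w}"
    proof
      fix x assume x: "x \<in> T"
      then have x2: "x \<in> ?U2" "0 \<le> m \<bullet> (x - q)" "m \<bullet> (x - q) < w" using below2 by (auto simp: T_def)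
      let ?q = "q + (m \<bullet> (x - q)) *\<^sub>R m"
      have tq: "tame_plane M Inn Out A m ?q" using x2 w by (intro tame) auto
      have xq: "x \<in> hyperplane m ?q" by (simp add: hyp)
      have "x \<in> Inn"
        using xq x2(1) tq o(6) cut_region_avoids_Out[OF b(1-3,5,6) t2 m(2) q' tq] by (auto simp: tame_plane_def)
      then show "x \<in> Inn \<inter> {x. 0 \<le> m \<bullet> (x - q) \<and> m \<bullet> (x - q) < w}" using x2 by simp
    qed
    fix x assume x: "0 \<le> m \<bullet> (x - q)" "m \<bullet> (x - q) < w" "cball x w \<subseteq> Inn"
    have "x \<in> ?U2"
    proof (rule ascend)
      fix s assume "0 \<le> s" "s \<le> w - m \<bullet> (x - q)"
      then have "x + s *\<^sub>R m \<in> cball x w" using x(1) a1(1) by (simp add: dist_norm)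
      then show "x + s *\<^sub>R m \<in> Inn" using x(3) by blast
    qed (use x w in auto)
    then show "x \<in> T" using x by (simp add: T_def)
  next
    have fin: "?U1 \<in> lmeasurable" "?U2 \<in> lmeasurable"
      using o(1,2) U1(2) U2(2) by (auto simp: fmeasurable_def)
    have "T \<in> lmeasurable"
      using fin(2) Tm by (intro fmeasurableI2[OF fin(2)]) (auto simp: T_def)
    then have "measure lebesgue (?U1 \<union> T) = measure lebesgue ?U1 + measure lebesgue T"
      using measure_Un3[OF fin(1), of T] U2eq(2) by simp
    then have "measure lebesgue ?U2 = measure lebesgue ?U1 + measure lebesgue T" by (simp only: flip: U2eq(1))
    then show "cut_volume M m q' - cut_volume M m q = measure lebesgue T" by (simp add: cut_volume_def)
  qed
qed

section \<open>The volume of a thin slab\<close>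

lemma isometry_vimage_ball:
  fixes f :: "'a::metric_space \<Rightarrow> 'b::metric_space"
  assumes "\<And>x y. dist (f x) (f y) = dist x y"
  shows "f -` ball (f x) r = ball x r"
  by (auto simp: assms)

text \<open>By Vitali's theorem an open set is, up to a null set, a disjoint union of balls, whose volumes are preserved.\<close>

lemma isometry_emeasure_open_le:
  fixes f :: "'a::euclidean_space \<Rightarrow> 'b::euclidean_space"
  assumes iso: "\<And>x y. dist (f x) (f y) = dist x y" and surj: "surj f" and dim: "DIM('a) = DIM('b)"
    and U: "open U"
  shows "emeasure lborel U \<le> emeasure lborel (f -` U)"
proof -
  have contf: "continuous_on UNIV f"
    unfolding continuous_on_iff by (metis iso)
  define K where "K = {(c, r). 0 < r \<and> ball c r \<subseteq> U}"
  obtain C where C: "countable C" "C \<subseteq> K"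
     "pairwise (\<lambda>i j. disjnt (ball (fst i) (snd i)) (ball (fst j) (snd j))) C"
     "negligible (U - (\<Union>i \<in> C. ball (fst i) (snd i)))"
  proof (rule Vitali_covering_theorem_balls[of U K fst snd])
    fix x :: 'b and d :: real assume x: "x \<in> U" "0 < d"
    obtain e where e: "0 < e" "ball x e \<subseteq> U" using U x(1) openE by blast
    have "(x, min e d / 2) \<in> K" using e x(2) by (auto simp: K_def)
    then show "\<exists>i. i \<in> K \<and> x \<in> ball (fst i) (snd i) \<and> snd i < d"
      using e x(2) by (intro exI[of _ "(x, min e d / 2)"]) auto
  qed (rule that; assumption)
  let ?B = "\<lambda>i::'b \<times> real. ball (fst i) (snd i)"
  have oB: "open (\<Union>i\<in>C. ?B i)" by blast
  have disj: "disjoint_family_on ?B C"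
    using C(3) by (auto simp: disjoint_family_on_def pairwise_def disjnt_def)
  have BU: "(\<Union>i\<in>C. ?B i) \<subseteq> U" using C(2) by (force simp: K_def)
  have same: "emeasure lborel (f -` ?B i) = emeasure lborel (?B i)" if "i \<in> C" for i
  proof -
    obtain z where z: "f z = fst i" using surj by (metis surjD)
    have r: "0 \<le> snd i" using that C(2) by (auto simp: K_def)
    have "f -` ?B i = ball z (snd i)" using isometry_vimage_ball[OF iso, of z "snd i"] z by simp
    then show ?thesis using r dim by (simp add: emeasure_ball)
  qed
  have "emeasure lborel U \<le> emeasure lborel (\<Union>i\<in>C. ?B i)"
  proof -
    have nb: "U - (\<Union>i\<in>C. ?B i) \<in> sets lborel" using U oB by auto
    have "U - (\<Union>i\<in>C. ?B i) \<in> null_sets lborel"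
      using C(4) nb by (simp add: negligible_iff_null_sets null_sets_completion_iff)
    then have "emeasure lborel (U - (\<Union>i\<in>C. ?B i)) = 0" by auto
    moreover have "emeasure lborel U \<le> emeasure lborel ((\<Union>i\<in>C. ?B i) \<union> (U - (\<Union>i\<in>C. ?B i)))"
      using U oB by (intro emeasure_mono) auto
    moreover have "\<dots> \<le> emeasure lborel (\<Union>i\<in>C. ?B i) + emeasure lborel (U - (\<Union>i\<in>C. ?B i))"
      using U oB by (intro emeasure_subadditive) auto
    ultimately show ?thesis by simp
  qed
  also have "\<dots> = (\<integral>\<^sup>+i. emeasure lborel (?B i) \<partial>count_space C)"
    by (rule emeasure_UN_countable) (use C(1) disj in auto)
  also have "\<dots> = (\<integral>\<^sup>+i. emeasure lborel (f -` ?B i) \<partial>count_space C)"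
    by (rule nn_integral_cong) (simp add: same)
  also have "\<dots> = emeasure lborel (\<Union>i\<in>C. f -` ?B i)"
  proof (rule emeasure_UN_countable[symmetric])
    show "f -` ?B i \<in> sets lborel" if "i \<in> C" for i
      using open_vimage[OF open_ball contf] by simp
    show "disjoint_family_on (\<lambda>i. f -` ?B i) C"
      unfolding disjoint_family_on_def
    proof (intro ballI impI)
      fix i j assume "i \<in> C" "j \<in> C" "i \<noteq> j"
      then have "?B i \<inter> ?B j = {}" using disj unfolding disjoint_family_on_def by blast
      then show "f -` ?B i \<inter> f -` ?B j = {}" by blast
    qed
  qed (rule C(1))
  also have "\<dots> \<le> emeasure lborel (f -` U)"
    using BU open_vimage[OF U contf] by (intro emeasure_mono) auto
  finally show ?thesis .
qed

text \<open>The inequality for open sets is applied to \<open>f\<close> and to its inverse; equality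
  on boxes then characterizes Lebesgue measure. Source and target are different types, here the
  product of a hyperplane model with the line, and the ambient space.\<close>

lemma lborel_distr_isometry:
  fixes f :: "'a::euclidean_space \<Rightarrow> 'b::euclidean_space"
  assumes iso: "\<And>x y. dist (f x) (f y) = dist x y" and surj: "surj f" and dim: "DIM('a) = DIM('b)"
  shows "distr lborel borel f = lborel" and "f \<in> borel_measurable borel"
proof -
  have contf: "continuous_on UNIV f"
    unfolding continuous_on_iff by (metis iso)
  show meas: "f \<in> borel_measurable borel" using contf by (rule borel_measurable_continuous_onI)
  have "inj f" by (rule injI) (metis iso dist_eq_0_iff)
  then have bij: "bij f" using surj by (simp add: bij_def)
  have gf: "inv f (f x) = x" "f (inv f y) = y" for x y using bij by (simp_all add: bij_is_inj surj_f_inv_f surj)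
  have iso': "dist (inv f x) (inv f y) = dist x y" for x y using iso gf(2) by metis
  have surj': "surj (inv f)" using gf(1) by (metis surjI)
  have eq: "emeasure lborel (f -` U) = emeasure lborel U" if U: "open U" for U
  proof (rule antisym)
    have "emeasure lborel (f -` U) \<le> emeasure lborel (inv f -` (f -` U))"
      by (rule isometry_emeasure_open_le[OF iso' surj' dim[symmetric] open_vimage[OF U contf]])
    also have "inv f -` (f -` U) = U" using gf by auto
    finally show "emeasure lborel (f -` U) \<le> emeasure lborel U" .
    show "emeasure lborel U \<le> emeasure lborel (f -` U)" by (rule isometry_emeasure_open_le[OF iso surj dim U])
  qed
  have "lborel = distr lborel borel f"
  proof (rule lborel_eqI)
    fix l u :: 'b assume le: "\<And>b. b \<in> Basis \<Longrightarrow> l \<bullet> b \<le> u \<bullet> b"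
    have "emeasure (distr lborel borel f) (box l u) = emeasure lborel (f -` box l u)"
      using meas by (subst emeasure_distr) auto
    also have "\<dots> = emeasure lborel (box l u)" by (rule eq[OF open_box])
    finally show "emeasure (distr lborel borel f) (box l u) = (\<Prod>b\<in>Basis. (u - l) \<bullet> b)"
      using le by (simp add: emeasure_lborel_box)
  qed simp
  then show "distr lborel borel f = lborel" by simp
qed

text \<open>Makes the choice operator in \<open>hyperplane_measure\<close> meaningful.\<close>

lemma hyperplane_isometry_exists:
  fixes n :: "'n::finite space"
  assumes "norm n = 1"
  shows "\<exists>L :: real ^ 'n \<Rightarrow> 'n space. linear L \<and> (\<forall>y. norm (L y) = norm y) \<and> range L = perp n"
proof -
  have sub: "subspace (perp n)" by (auto simp: perp_def subspace_def inner_add_right)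
  have "dim (perp n) = DIM('n space) - 1"
    using dim_hyperplane[of n] assms unfolding perp_def by (metis norm_zero zero_neq_one)
  then have d: "dim (UNIV :: (real ^ 'n) set) = dim (perp n)" by (simp add: card_UNIV_option)
  obtain L :: "real ^ 'n \<Rightarrow> 'n space" where "linear L" "L ` UNIV = perp n" "\<And>x. x \<in> UNIV \<Longrightarrow> norm (L x) = norm x"
    using isometry_subspaces[OF subspace_UNIV sub d] by blast
  then show ?thesis by auto
qed

lemma hyperplane_coordinates_isometry:
  fixes n p :: "'n::finite space" and L :: "real ^ 'n \<Rightarrow> 'n space"
  assumes n: "norm n = 1" and L: "linear L" "\<And>y. norm (L y) = norm y" "range L = perp n"
  defines "f \<equiv> \<lambda>z. p + L (fst z) + snd z *\<^sub>R n"
  shows "\<And>x y. dist (f x) (f y) = dist x y" "surj f" "distr lborel borel f = lborel" "f \<in> borel_measurable borel"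
proof -
  have nn: "n \<bullet> n = 1" using n by (simp add: norm_eq_1)
  have nL: "n \<bullet> L y = 0" for y using L(3) by (auto simp: perp_def)
  show iso: "dist (f x) (f y) = dist x y" for x y
  proof -
    define d s where "d = fst x - fst y" and "s = snd x - snd y"
    have *: "f x - f y = L d + s *\<^sub>R n"
      using L(1) by (simp add: f_def d_def s_def linear_diff algebra_simps)
    have "(norm (L d + s *\<^sub>R n))\<^sup>2 = L d \<bullet> L d + s * s"
      using nn nL[of d] by (simp add: power2_norm_eq_inner inner_add_left inner_add_right inner_commute[of "L d" n])
    also have "\<dots> = (norm d)\<^sup>2 + s\<^sup>2"
      using L(2)[of d] by (simp add: power2_norm_eq_inner[symmetric] power2_eq_square[symmetric])
    finally have "norm (f x - f y) = sqrt ((norm d)\<^sup>2 + s\<^sup>2)" unfolding * by (metis norm_ge_zero real_sqrt_unique)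
    moreover have "dist x y = sqrt ((norm d)\<^sup>2 + s\<^sup>2)"
      by (simp add: d_def s_def dist_prod_def dist_norm)
    ultimately show ?thesis by (simp add: dist_norm)
  qed
  show surj: "surj f"
  proof (rule surjI)
    fix x
    define s where "s = n \<bullet> (x - p)"
    have "x - p - s *\<^sub>R n \<in> range L" using nn by (simp add: L(3) perp_def s_def inner_diff_right)
    then have "\<exists>y. L y = x - p - s *\<^sub>R n" by (metis image_iff)
    then have "L (SOME y. L y = x - p - s *\<^sub>R n) = x - p - s *\<^sub>R n" by (rule someI_ex)
    then show "f (SOME y. L y = x - p - (n \<bullet> (x - p)) *\<^sub>R n, n \<bullet> (x - p)) = x" by (simp add: f_def s_def)
  qed
  have "DIM((real ^ 'n) \<times> real) = DIM('n space)" by (simp add: card_UNIV_option)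
  then show "distr lborel borel f = lborel" "f \<in> borel_measurable borel"
    using lborel_distr_isometry[OF iso surj] by auto
qed

section \<open>Slabs over a base, null slices and approximation of the base\<close>

text \<open>By Fubini: over each base point the fibre is a half-open interval of length
  \<open>w / \<mu>\<close>. The function \<open>l\<close>, which carries the tilt, merely shifts the
  fibre.\<close>

lemma emeasure_oblique_slab:
  fixes S :: "'a::euclidean_space set" and l :: "'a \<Rightarrow> real"
  assumes S: "S \<in> sets borel" and l: "continuous_on UNIV l" and \<mu>: "0 < \<mu>" "0 \<le> w"
  shows "{z. fst z \<in> S \<and> 0 \<le> l (fst z) + snd z * \<mu> \<and> l (fst z) + snd z * \<mu> < w} \<in> sets borel"
    and "emeasure lborel {z. fst z \<in> S \<and> 0 \<le> l (fst z) + snd z * \<mu> \<and> l (fst z) + snd z * \<mu> < w}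
       = emeasure lborel S * ennreal (w / \<mu>)"
proof -
  let ?E = "{z. fst z \<in> S \<and> 0 \<le> l (fst z) + snd z * \<mu> \<and> l (fst z) + snd z * \<mu> < w}"
  have c: "continuous_on UNIV (\<lambda>z::'a \<times> real. l (fst z) + snd z * \<mu>)"
    using continuous_on_compose2[OF l continuous_on_fst[OF continuous_on_id]] by (intro continuous_intros) auto
  have "?E = (fst -` S) \<inter> {z. 0 \<le> l (fst z) + snd z * \<mu>} \<inter> {z. l (fst z) + snd z * \<mu> < w}" by auto
  moreover have "fst -` S \<in> sets (borel :: ('a \<times> real) measure)"
    using measurable_sets[OF borel_measurable_continuous_onI[OF continuous_on_fst[OF continuous_on_id]] S] by simp
  moreover have "closed {z::'a \<times> real. 0 \<le> l (fst z) + snd z * \<mu>}" "open {z::'a \<times> real. l (fst z) + snd z * \<mu> < w}"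
    using c by (auto intro: closed_Collect_le open_Collect_less continuous_on_const)
  ultimately show E: "?E \<in> sets borel" by auto
  then have "?E \<in> sets (lborel \<Otimes>\<^sub>M lborel)" unfolding lborel_prod by simp
  then have "emeasure (lborel \<Otimes>\<^sub>M lborel) ?E = (\<integral>\<^sup>+y. emeasure lborel (Pair y -` ?E) \<partial>lborel)"
    by (rule lborel.emeasure_pair_measure_alt)
  also have "\<dots> = (\<integral>\<^sup>+y. ennreal (w / \<mu>) * indicator S y \<partial>lborel)"
  proof (rule nn_integral_cong)
    fix y :: 'a
    show "emeasure lborel (Pair y -` ?E) = ennreal (w / \<mu>) * indicator S y"
    proof (cases "y \<in> S")
      case True
      have "Pair y -` ?E = {- l y / \<mu> ..< (w - l y) / \<mu>}"
        using True \<mu>(1) by (auto simp: field_simps)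
      moreover have "- l y / \<mu> \<le> (w - l y) / \<mu>" using \<mu> by (intro divide_right_mono) auto
      moreover have "(w - l y) / \<mu> - - l y / \<mu> = w / \<mu>" by (simp add: diff_divide_distrib)
      ultimately show ?thesis using True by simp
    qed simp
  qed
  also have "\<dots> = emeasure lborel S * ennreal (w / \<mu>)"
    using nn_integral_cmult_indicator[of S lborel "ennreal (w / \<mu>)"] S by (simp add: mult.commute)
  finally show "emeasure lborel ?E = emeasure lborel S * ennreal (w / \<mu>)" by (simp add: lborel_prod)
qed

text \<open>The translates by \<open>v / (k + 1)\<close> are pairwise disjoint, have equal measure
  and stay in one ball; were the measure positive, they would overfill it.\<close>

lemma negligible_disjoint_translates:
  fixes C :: "'a::euclidean_space set"
  assumes C: "compact C" and disj: "\<And>x t. x \<in> C \<Longrightarrow> 0 < t \<Longrightarrow> x + t *\<^sub>R v \<notin> C"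
  shows "negligible C"
proof -
  obtain r where r: "C \<subseteq> ball 0 r" using compact_imp_bounded[OF C] bounded_subset_ballD by blast
  define B where "B = cball (0::'a) (r + norm v)"
  define f where "f k = (+) ((1 / real (Suc k)) *\<^sub>R v) ` C" for k
  have meas: "f k \<in> lmeasurable" for k
    unfolding f_def using compact_translation[OF C] by (simp add: lmeasurable_compact)
  have mf: "measure lebesgue (f k) = measure lebesgue C" for k
    unfolding f_def by (rule measure_translation)
  have fB: "f k \<subseteq> B" for k
  proof
    fix x assume "x \<in> f k"
    then obtain c where c: "c \<in> C" "x = (1 / real (Suc k)) *\<^sub>R v + c" by (auto simp: f_def)
    have "norm x \<le> norm ((1 / real (Suc k)) *\<^sub>R v) + norm c" unfolding c(2) by (rule norm_triangle_ineq)
    moreover have "norm ((1 / real (Suc k)) *\<^sub>R v) \<le> 1 * norm v"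
      unfolding norm_scaleR by (intro mult_right_mono) auto
    moreover have "norm c < r" using c(1) r by auto
    ultimately show "x \<in> B" by (simp add: B_def)
  qed
  have key: "f i \<inter> f j = {}" if "i < j" for i j
  proof (rule equals0I)
    fix x assume "x \<in> f i \<inter> f j"
    then obtain c d where c: "c \<in> C" "x = (1 / real (Suc i)) *\<^sub>R v + c" and d: "d \<in> C" "x = (1 / real (Suc j)) *\<^sub>R v + d"
      by (auto simp: f_def)
    have "d = c + (1 / real (Suc i) - 1 / real (Suc j)) *\<^sub>R v" using c(2) d(2) by (simp add: algebra_simps)
    moreover have "0 < 1 / real (Suc i) - 1 / real (Suc j)" using that by (simp add: frac_less2)
    ultimately show False using disj[OF c(1)] d(1) by blast
  qed
  have "pairwise (\<lambda>i j. negligible (f i \<inter> f j)) {..<N}" for N :: nat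
    unfolding pairwise_def
  proof (intro ballI impI)
    fix i j :: nat assume "i \<noteq> j"
    then show "negligible (f i \<inter> f j)" using key[of i j] key[of j i] by (cases "i < j") (auto simp: Int_commute)
  qed
  then have sum: "measure lebesgue (\<Union>(f ` {..<N})) = (\<Sum>k<N. measure lebesgue (f k))" for N :: nat
    using meas by (intro measure_negligible_finite_Union_image) auto
  have bound: "real N * measure lebesgue C \<le> measure lebesgue B" for N :: nat
  proof -
    have "measure lebesgue (\<Union>(f ` {..<N})) \<le> measure lebesgue B"
      using meas fB by (intro measure_mono_fmeasurable) (auto simp: B_def intro!: fmeasurable.finite_UN)
    then show ?thesis using sum[of N] mf by simp
  qed
  have "measure lebesgue C \<le> 0"
  proof (rule ccontr)
    assume "\<not> ?thesis"
    then have "0 < measure lebesgue C" by simp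
    then obtain N :: nat where "measure lebesgue B < real N * measure lebesgue C" using reals_Archimedean3 by blast
    then show False using bound[of N] by simp
  qed
  then have "measure lebesgue C = 0" using measure_nonneg[of lebesgue C] by linarith
  then show ?thesis using lmeasurable_compact[OF C] negligible_iff_measure by blast
qed

text \<open>Near each of its points the slice is a level set of a function strictly increasing along
  a direction of the hyperplane, so it is disjoint from its positive translates. Compactness reduces
  to finitely many such pieces.\<close>

lemma negligible_slice:
  fixes M :: "'n::finite space set" and L :: "real ^ 'n \<Rightarrow> 'n space"
  assumes M: "smooth_hypersurface M" and \<nu>: "unit_normal M \<nu>" and n: "n \<in> admissible_directions M p"
    and L: "linear L" "\<And>y. norm (L y) = norm y" "range L = perp n"
  shows "negligible {y. p + L y \<in> slice M n p}"
proof -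
  note a = admissibleD[OF n]
  let ?f = "\<lambda>y. p + L y"
  let ?G = "{y. ?f y \<in> slice M n p}"
  have contL: "continuous_on UNIV ?f"
    using L(1) by (intro continuous_intros linear_continuous_on) (simp add: linear_conv_bounded_linear)
  have dLL: "dist (?f x) (?f y) = dist x y" for x y
    using L(2)[of "x - y"] L(1) by (simp add: dist_norm linear_diff)
  have clG: "closed (?f -` slice M n p)"
    by (rule closed_vimage[OF compact_imp_closed[OF a(3)] contL])
  obtain r where r: "slice M n p \<subseteq> ball p r" using compact_imp_bounded[OF a(3)] bounded_subset_ballD by blast
  have "?G \<subseteq> cball 0 r"
  proof
    fix y assume "y \<in> ?G"
    then have "?f y \<in> ball p r" using r by blast
    then show "y \<in> cball 0 r" using L(2)[of y] by (simp add: dist_norm)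
  qed
  then have "bounded ?G" using bounded_cball bounded_subset by blast
  then have cG: "compact ?G" using clG by (simp add: compact_eq_bounded_closed vimage_def)
  have "\<exists>e>0. negligible (?G \<inter> cball y e)" if y: "y \<in> ?G" for y
  proof -
    have yM: "?f y \<in> M - mboundary M" using y by (simp add: slice_def)
    obtain W f g where W: "side_chart M \<nu> W f g" "?f y \<in> W" using side_chart_exists[OF M \<nu> yM] by blast
    obtain e where e: "norm e = 1" "n \<bullet> e = 0" "0 < g (?f y) \<bullet> e"
      using side_chart_transversal[OF W(1) _ W(2) a(2)[of "?f y"]] yM y by blast
    have "e \<in> range L" using e(2) L(3) by (simp add: perp_def)
    then obtain v where v: "L v = e" by blast
    have gW: "continuous_on W g" "open W" and dW: "\<And>x. x \<in> W \<Longrightarrow> (f has_derivative (\<lambda>h. g x \<bullet> h)) (at x)"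
      using W(1) unfolding side_chart_def by blast+
    have "open (W \<inter> (\<lambda>x. g x \<bullet> e) -` {0<..})"
      by (intro continuous_open_preimage continuous_intros gW open_greaterThan)
    moreover have mem: "?f y \<in> W \<inter> (\<lambda>x. g x \<bullet> e) -` {0<..}" using W(2) e(3) by simp
    ultimately obtain s where s: "0 < s" "cball (?f y) s \<subseteq> W \<inter> (\<lambda>x. g x \<bullet> e) -` {0<..}"
      using mem open_contains_cball by blast
    have inb: "?f x \<in> cball (?f y) s \<longleftrightarrow> x \<in> cball y s" for x using dLL[of y x] by simp
    have fz: "f (?f x) = 0" if "x \<in> ?G \<inter> cball y s" for x
    proof -
      have "?f x \<in> W" using that inb[of x] s(2) by blast
      then show ?thesis using side_chart_iff[OF W(1)] that by (auto simp: slice_def)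
    qed
    have "negligible (?G \<inter> cball y s)"
    proof (rule negligible_disjoint_translates[where v = v])
      show "compact (?G \<inter> cball y s)" using cG by (intro compact_Int) auto
      fix x t assume x: "x \<in> ?G \<inter> cball y s" and t: "0 < (t::real)"
      show "x + t *\<^sub>R v \<notin> ?G \<inter> cball y s"
      proof
        assume xt: "x + t *\<^sub>R v \<in> ?G \<inter> cball y s"
        have eq: "?f (x + t *\<^sub>R v) = ?f x + t *\<^sub>R e" using L(1) v by (simp add: linear_add linear_scale)
        have "f (?f x) < f (?f x + t *\<^sub>R e)"
        proof (rule directional_increase[where W = "cball (?f y) s" and g = g])
          show "?f x \<in> cball (?f y) s" using x inb by blast
          show "?f x + t *\<^sub>R e \<in> cball (?f y) s" using xt inb[of "x + t *\<^sub>R v"] eq by simp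
        qed (use s(2) dW t in auto)
        then show False using fz[OF x] fz[OF xt] eq by simp
      qed
    qed
    then show ?thesis using s(1) by blast
  qed
  then have "\<exists>e. \<forall>y\<in>?G. 0 < e y \<and> negligible (?G \<inter> cball y (e y))" by (intro bchoice) blast
  then obtain e where e: "\<And>y. y \<in> ?G \<Longrightarrow> 0 < e y" "\<And>y. y \<in> ?G \<Longrightarrow> negligible (?G \<inter> cball y (e y))" by blast
  obtain F where F: "F \<subseteq> ?G" "finite F" "?G \<subseteq> (\<Union>c\<in>F. ball c (e c))"
    by (rule compactE_image[OF cG, of ?G "\<lambda>c. ball c (e c)"]) (use e(1) in auto)
  have "negligible (\<Union>c\<in>F. ?G \<inter> cball c (e c))" using F(1,2) e(2) by (intro negligible_Union) auto
  moreover have "?G \<subseteq> (\<Union>c\<in>F. ?G \<inter> cball c (e c))"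
  proof
    fix y assume y: "y \<in> ?G"
    then obtain c where "c \<in> F" "y \<in> ball c (e c)" using F(3) by blast
    then show "y \<in> (\<Union>c\<in>F. ?G \<inter> cball c (e c))" using y ball_subset_cball by blast
  qed
  ultimately show ?thesis by (rule negligible_subset)
qed

lemma cut_volume_cong:
  assumes "m \<bullet> q = m \<bullet> q'"
  shows "cut_volume M m q = cut_volume M m q'"
proof -
  have "hyperplane m q = hyperplane m q'" using assms by (auto simp: hyperplane_def inner_diff_right)
  then have "slice M m q = slice M m q'" "enclosed M m q = enclosed M m q'"
    by (simp_all add: slice_def enclosed_def)
  then show ?thesis by (simp add: cut_volume_def cut_region_def bounded_by_def)
qed

lemma outer_approximation_compact:
  fixes K :: "'a::euclidean_space set"
  assumes K: "compact K" "K \<noteq> {}" and \<epsilon>: "0 < \<epsilon>"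
  obtains \<eta> where "0 < \<eta>" "compact {y. infdist y K \<le> \<eta>}" "measure lborel {y. infdist y K \<le> \<eta>} < measure lborel K + \<epsilon>"
proof -
  define A where "A j = {y. infdist y K \<le> 1 / real (Suc j)}" for j
  have cA: "compact (A j)" for j unfolding A_def by (rule compact_infdist_le[OF K(2,1)]) simp
  have int: "(\<Inter>j. A j) = K"
  proof (intro subset_antisym subsetI)
    fix y assume y: "y \<in> (\<Inter>j. A j)"
    have "infdist y K \<le> 0"
    proof (rule ccontr)
      assume "\<not> ?thesis"
      then have "0 < infdist y K" by simp
      then obtain j where "1 / real (Suc j) < infdist y K" using nat_approx_posE by blast
      moreover have "y \<in> A j" using y by blast
      ultimately show False by (simp add: A_def)
    qed
    then have "infdist y K = 0" using infdist_nonneg[of y K] by linarith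
    then show "y \<in> K" using in_closed_iff_infdist_zero[OF compact_imp_closed[OF K(1)] K(2), of y] by blast
  qed (auto simp: A_def)
  have "(\<lambda>j. measure lborel (A j)) \<longlonglongrightarrow> measure lborel (\<Inter>j. A j)"
  proof (rule Lim_measure_decseq)
    show "range A \<subseteq> sets lborel" using cA by (auto simp: borel_compact)
    show "decseq A" unfolding A_def decseq_def
    proof (intro allI impI subsetI)
      fix i j :: nat and y assume "i \<le> j" and y: "y \<in> {y. infdist y K \<le> 1 / real (Suc j)}"
      then have "1 / real (Suc j) \<le> 1 / real (Suc i)" by (intro divide_left_mono) auto
      then show "y \<in> {y. infdist y K \<le> 1 / real (Suc i)}" using y by simp
    qed
    show "emeasure lborel (A j) \<noteq> \<infinity>" for j using emeasure_compact_finite[OF cA] by (simp add: less_top)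
  qed
  then have "\<forall>\<^sub>F j in sequentially. measure lborel (A j) < measure lborel K + \<epsilon>"
    unfolding int by (rule order_tendstoD) (use \<epsilon> in simp)
  then obtain j where "measure lborel (A j) < measure lborel K + \<epsilon>" using eventually_happens by force
  then show ?thesis using that[of "1 / real (Suc j)"] cA[of j] by (simp add: A_def)
qed

lemma inner_approximation_open:
  fixes S :: "'a::euclidean_space set"
  assumes S: "open S" "bounded S" and \<epsilon>: "0 < \<epsilon>"
  obtains \<eta> where "0 < \<eta>" "measure lborel S - \<epsilon> < measure lborel {y. \<eta> < infdist y (- S)}"
proof -
  define B where "B j = {y. 1 / real (Suc j) < infdist y (- S)}" for j
  \<comment> \<open>Excludes the convention that \<open>infdist\<close> to the empty set is
    0.\<close>
  have ne: "- S \<noteq> {}" using S(2) by (metis Compl_empty_eq double_compl not_bounded_UNIV)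
  have un: "(\<Union>j. B j) = S"
  proof (intro subset_antisym subsetI)
    fix y assume "y \<in> (\<Union>j. B j)"
    then obtain j where "1 / real (Suc j) < infdist y (- S)" by (auto simp: B_def)
    then have "0 < infdist y (- S)" by (rule le_less_trans[rotated]) simp
    then show "y \<in> S" by (metis ComplI infdist_zero less_irrefl)
  next
    fix y assume "y \<in> S"
    then have "0 < infdist y (- S)" using infdist_pos_not_in_closed[OF closed_Compl[OF S(1)] ne] by simp
    then obtain j where "1 / real (Suc j) < infdist y (- S)" using nat_approx_posE by blast
    then show "y \<in> (\<Union>j. B j)" by (auto simp: B_def)
  qed
  have oB: "open (B j)" for j unfolding B_def by (intro open_Collect_less continuous_intros)
  have "(\<lambda>j. measure lborel (B j)) \<longlonglongrightarrow> measure lborel (\<Union>j. B j)"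
  proof (rule Lim_measure_incseq)
    show "range B \<subseteq> sets lborel" using oB by auto
    show "incseq B" unfolding B_def incseq_def
    proof (intro allI impI subsetI)
      fix i j :: nat and y assume "i \<le> j" and y: "y \<in> {y. 1 / real (Suc i) < infdist y (- S)}"
      then have "1 / real (Suc j) \<le> 1 / real (Suc i)" by (intro divide_left_mono) auto
      then show "y \<in> {y. 1 / real (Suc j) < infdist y (- S)}" using y by simp
    qed
    show "emeasure lborel (\<Union>j. B j) \<noteq> \<infinity>" unfolding un using emeasure_bounded_finite[OF S(2)] by simp
  qed
  then have "\<forall>\<^sub>F j in sequentially. measure lborel S - \<epsilon> < measure lborel (B j)"
    unfolding un by (rule order_tendstoD) (use \<epsilon> in simp)
  then obtain j where "measure lborel S - \<epsilon> < measure lborel (B j)" using eventually_happens by force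
  then show ?thesis using that[of "1 / real (Suc j)"] by (simp add: B_def)
qed

text \<open>The compact set has the same area as the open region because the slice is null. It is
  needed since an area can be approximated from outside by neighborhoods of a compact set, from
  inside by shrinking an open one.\<close>

lemma enclosed_area:
  fixes M :: "'n::finite space set" and L :: "real ^ 'n \<Rightarrow> 'n space"
  assumes M: "smooth_hypersurface M" and \<nu>: "unit_normal M \<nu>" and n: "n \<in> admissible_directions M p"
    and L: "linear L" "\<And>y. norm (L y) = norm y" "range L = perp n"
    and oR: "open {y. p + L y \<in> enclosed M n p}"
  shows "compact {y. p + L y \<in> enclosed M n p \<union> slice M n p}"
    and "measure lborel {y. p + L y \<in> enclosed M n p \<union> slice M n p} = measure lborel {y. p + L y \<in> enclosed M n p}"
proof -
  note a = admissibleD[OF n]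
  let ?f = "\<lambda>y. p + L y"
  let ?R = "{y. ?f y \<in> enclosed M n p}" and ?G = "{y. ?f y \<in> slice M n p}"
  have RG: "{y. ?f y \<in> enclosed M n p \<union> slice M n p} = ?R \<union> ?G" by auto
  have contL: "continuous_on UNIV ?f"
    using L(1) by (intro continuous_intros linear_continuous_on) (simp add: linear_conv_bounded_linear)
  have cl: "closure (enclosed M n p) = enclosed M n p \<union> slice M n p" using a(6) closure_subset by blast
  have "closed (?f -` closure (enclosed M n p))"
    by (rule closed_vimage[OF closed_closure contL])
  moreover have "bounded (?f -` closure (enclosed M n p))"
  proof -
    obtain r where r: "closure (enclosed M n p) \<subseteq> ball p r"
      using bounded_closure[OF bounded_enclosed[OF n]] bounded_subset_ballD by blast
    have "?f -` closure (enclosed M n p) \<subseteq> cball 0 r"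
    proof
      fix y assume "y \<in> ?f -` closure (enclosed M n p)"
      then have "?f y \<in> ball p r" using r by blast
      then show "y \<in> cball 0 r" using L(2)[of y] by (simp add: dist_norm)
    qed
    then show ?thesis using bounded_cball bounded_subset by blast
  qed
  ultimately show c: "compact {y. ?f y \<in> enclosed M n p \<union> slice M n p}"
    unfolding cl vimage_def by (simp add: compact_eq_bounded_closed)
  have neg: "negligible ?G" by (rule negligible_slice[OF M \<nu> n L])
  have "closed ?G" using closed_vimage[OF compact_imp_closed[OF a(3)] contL] unfolding vimage_def .
  then have Gb: "?G \<in> sets borel" by simp
  have "?G \<in> null_sets lborel"
    using neg Gb by (simp add: negligible_iff_null_sets null_sets_completion_iff)
  then show "measure lborel {y. ?f y \<in> enclosed M n p \<union> slice M n p} = measure lborel ?R"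
    unfolding RG using oR by (intro measure_Un_null_set) auto
qed

section \<open>The uniform rate of change under parallel displacement\<close>

text \<open>In coordinates adapted to \<open>n\<close>, the piece \<open>T\<close> of the slab is
  squeezed between two oblique slabs, over a shrunken and over an enlarged base. Each has volume
  base area times \<open>w / \<mu>\<close> with \<open>\<mu> = m \<bullet> n\<close> close to 1, so
  the error is proportional to the width \<open>w\<close>.\<close>

lemma cut_volume_increment_pos:
  fixes M :: "'n::finite space set"
  assumes M: "smooth_hypersurface M" and \<nu>: "unit_normal M \<nu>" and n: "n \<in> admissible_directions M p"
    and W: "open W" "n \<in> W" "W \<inter> sphere 0 1 \<subseteq> admissible_directions M p"
    and r0: "0 < r0" "ball p r0 \<inter> M = {}" and \<epsilon>: "0 < \<epsilon>"
  obtains \<delta> where "0 < \<delta>" "\<And>m q q'. norm (m - n) < \<delta> \<Longrightarrow> norm (q - p) < \<delta> \<Longrightarrow> norm (q' - p) < \<delta> \<Longrightarrow>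
     m \<in> admissible_directions M q \<Longrightarrow> m \<in> admissible_directions M q' \<Longrightarrow> 0 < m \<bullet> (q' - q) \<Longrightarrow>
     \<bar>cut_volume M m q' - cut_volume M m q - hyperplane_measure n p (enclosed M n p) * (m \<bullet> (q' - q))\<bar>
       \<le> \<epsilon> * (m \<bullet> (q' - q))"
proof -
  note a = admissibleD[OF n]
  have nn: "n \<bullet> n = 1" using a(1) by (simp add: norm_eq_1)
  obtain Inn Out A \<delta>0 where b: "open Inn" "open Out" "Inn \<inter> Out = {}" "bounded Inn" "open A" "M \<inter> A \<inter> (Inn \<union> Out) = {}"
    and HI: "hyperplane n p \<inter> Inn = enclosed M n p" and Hcov: "hyperplane n p \<subseteq> Inn \<union> Out \<union> slice M n p"
    and \<delta>0: "0 < \<delta>0" "\<And>m q. norm m = 1 \<Longrightarrow> norm (m - n) < \<delta>0 \<Longrightarrow> norm (q - p) < \<delta>0 \<Longrightarrow> tame_plane M Inn Out A m q"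
    by (rule barrier_of_admissible_neighborhood[folded tame_plane_def, OF M \<nu> n W r0]) (rule that; assumption)
  define L where "L = (SOME L :: real ^ 'n \<Rightarrow> 'n space. linear L \<and> (\<forall>y. norm (L y) = norm y) \<and> range L = perp n)"
  have L: "linear L" "\<And>y. norm (L y) = norm y" "range L = perp n"
    using someI_ex[OF hyperplane_isometry_exists[OF a(1)]] unfolding L_def by blast+
  have nL: "n \<bullet> L y = 0" for y using L(3) by (auto simp: perp_def)
  define R where "R = {y. p + L y \<in> enclosed M n p}"
  define K where "K = {y. p + L y \<in> enclosed M n p \<union> slice M n p}"
  have contL: "continuous_on UNIV (\<lambda>y. p + L y)"
    using L(1) by (intro continuous_intros linear_continuous_on) (simp add: linear_conv_bounded_linear)
  have inH: "p + L y \<in> hyperplane n p" for y using nL by (simp add: hyperplane_def)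
  have RI: "y \<in> R \<longleftrightarrow> p + L y \<in> Inn" for y using inH HI by (auto simp: R_def)
  have "R = (\<lambda>y. p + L y) -` Inn" using RI by auto
  then have oR: "open R" using open_vimage[OF b(1) contL] by simp
  have cK: "compact K" and mK: "measure lborel K = measure lborel R"
    using enclosed_area[OF M \<nu> n L] oR by (simp_all add: R_def K_def)
  have RK: "R \<subseteq> K" by (auto simp: R_def K_def)
  have bR: "bounded R" using bounded_subset[OF compact_imp_bounded[OF cK] RK] .
  have "0 \<in> R" using a(5) linear_0[OF L(1)] by (simp add: R_def)
  then have Kne: "K \<noteq> {}" using RK by blast
  define \<beta> where "\<beta> = hyperplane_measure n p (enclosed M n p)"
  have \<beta>R: "\<beta> = measure lborel R"
    using oR by (simp add: \<beta>_def hyperplane_measure_def Let_def L_def[symmetric] R_def)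
  have \<beta>0: "0 \<le> \<beta>" by (simp add: \<beta>R)
  obtain \<eta>1 where \<eta>1: "0 < \<eta>1" "compact {y. infdist y K \<le> \<eta>1}" "measure lborel {y. infdist y K \<le> \<eta>1} < \<beta> + \<epsilon>/2"
    using outer_approximation_compact[OF cK Kne, of "\<epsilon>/2"] \<epsilon> by (auto simp: mK \<beta>R)
  obtain \<eta>2 where \<eta>2: "0 < \<eta>2" "\<beta> - \<epsilon> < measure lborel {y. \<eta>2 < infdist y (- R)}"
    using inner_approximation_open[OF oR bR \<epsilon>] by (auto simp: \<beta>R)
  define f where "f z = p + L (fst z) + snd z *\<^sub>R n" for z :: "(real ^ 'n) \<times> real"
  have f: "\<And>x y. dist (f x) (f y) = dist x y" "surj f" "distr lborel borel f = lborel" "f \<in> borel_measurable borel"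
    using hyperplane_coordinates_isometry[OF a(1) L, of p] unfolding f_def by blast+
  have "inj f" by (rule injI) (metis f(1) dist_eq_0_iff)
  then have bij: "bij f" using f(2) by (simp add: bij_def)
  have ff: "f (inv f x) = x" for x using f(2) by (simp add: surj_f_inv_f)
  have contg: "continuous_on UNIV (inv f)"
    unfolding continuous_on_iff by (metis f(1) ff)
  obtain \<rho> where \<rho>: "Inn \<subseteq> ball p \<rho>" using b(4) bounded_subset_ballD by blast
  have pI: "p \<in> Inn" using HI a(5) by blast
  have \<rho>0: "0 < \<rho>" using pI \<rho> by auto
  obtain rI where rI: "0 < rI" "ball p rI \<subseteq> Inn" using b(1) pI openE by blast
  define S2 where "S2 = {y. \<eta>2 < infdist y (- R)}"
  have oS2: "open S2" unfolding S2_def by (intro open_Collect_less continuous_intros)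
  define C where "C = {y. \<eta>2 \<le> infdist y (- R)}"
  have CR: "C \<subseteq> R"
  proof
    fix y assume "y \<in> C"
    then have "0 < infdist y (- R)" using \<eta>2(1) by (simp add: C_def)
    then show "y \<in> R" by (metis ComplI infdist_zero less_irrefl)
  qed
  have "closed C" unfolding C_def by (intro closed_Collect_le continuous_intros)
  then have "compact C" using bounded_subset[OF bR CR] by (simp add: compact_eq_bounded_closed)
  then have cLC: "compact ((\<lambda>y. p + L y) ` C)"
    using contL continuous_on_subset by (intro compact_continuous_image) blast
  have LCI: "(\<lambda>y. p + L y) ` C \<subseteq> Inn" using CR RI by blast
  \<comment> \<open>Room in \<open>Inn\<close> around the shrunken base, so that whole columns over
    it fit into \<open>Inn\<close>.\<close>
  obtain \<eta>3 where \<eta>3: "0 < \<eta>3" "(\<Union>x\<in>(\<lambda>y. p + L y) ` C. cball x \<eta>3) \<subseteq> Inn"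
    using compact_subset_open_imp_cball_epsilon_subset[OF cLC b(1) LCI] by blast
  have S2C: "S2 \<subseteq> C" by (auto simp: S2_def C_def)
  \<comment> \<open>For planes near the original one, this open set says that their part in
    \<open>Inn\<close> lies over the enlarged base.\<close>
  define G where "G = Out \<union> inv f -` {z. infdist (fst z) K < \<eta>1}"
  have "open {z :: (real ^ 'n) \<times> real. infdist (fst z) K < \<eta>1}"
    by (intro open_Collect_less continuous_intros)
  then have oG: "open G" unfolding G_def by (intro open_Un b(2) open_vimage contg)
  have HG: "hyperplane n p \<inter> cball p \<rho> \<subseteq> G"
  proof
    fix x assume x: "x \<in> hyperplane n p \<inter> cball p \<rho>"
    show "x \<in> G"
    proof (cases "x \<in> Out")
      case False
      define z where "z = inv f x"
      have fz: "x = p + L (fst z) + snd z *\<^sub>R n" using ff[of x] by (simp add: z_def f_def)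
      have "n \<bullet> (x - p) = snd z" unfolding fz using nn nL by (simp add: inner_add_right)
      then have "snd z = 0" using x by (simp add: hyperplane_def)
      then have "x = p + L (fst z)" using fz by simp
      moreover have "x \<in> enclosed M n p \<union> slice M n p" using False x Hcov HI by blast
      ultimately have "fst z \<in> K" by (simp add: K_def)
      then show ?thesis using \<eta>1(1) by (simp add: G_def z_def[symmetric])
    qed (simp add: G_def)
  qed
  obtain \<delta>G where \<delta>G: "0 < \<delta>G"
    "\<And>m q. norm (m - n) < \<delta>G \<Longrightarrow> norm (q - p) < \<delta>G \<Longrightarrow> hyperplane m q \<inter> cball p \<rho> \<subseteq> G"
    by (rule hyperplanes_near_compact[OF oG HG]) (rule that; assumption)
  \<comment> \<open>The points \<open>q + s *\<^sub>R m\<close> with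
    \<open>\<bar>s\<bar> < 3 * \<delta>\<close> are within \<open>4 * \<delta>\<close> of
    \<open>p\<close>. The bound 1/2 gives \<open>\<mu> \<ge> 1/2\<close>, the one with
    \<open>\<beta> + \<epsilon>\<close> absorbs the factor \<open>1 / \<mu>\<close>, and
    \<open>8 + 2 * \<rho>\<close> collects the height of the slab over the base and its
    width.\<close>
  define \<delta> where "\<delta> = min (min (\<delta>0/4) (rI/4)) (min (min (1/2) (\<delta>G/4)) (min (\<epsilon> / (2 * (\<beta> + \<epsilon>))) (\<eta>3 / (8 + 2 * \<rho>))))"
  have d: "0 < \<delta>" "4 * \<delta> \<le> \<delta>0" "4 * \<delta> \<le> rI" "4 * \<delta> \<le> \<delta>G" "\<delta> \<le> \<epsilon> / (2 * (\<beta> + \<epsilon>))" "\<delta> \<le> \<eta>3 / (8 + 2 * \<rho>)"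
    using \<delta>0(1) rI(1) \<delta>G(1) \<epsilon> \<beta>0 \<eta>3(1) \<rho>0 unfolding \<delta>_def by (auto simp: min_less_iff_conj)
  have d4: "\<delta> \<le> 1/2" unfolding \<delta>_def
    by (rule min.coboundedI2, rule min.coboundedI1, rule min.coboundedI1, rule order_refl)
  have d6: "\<delta> * (\<beta> + \<epsilon>) \<le> \<epsilon> / 2" using d(5) \<epsilon> \<beta>0 by (simp add: field_simps)
  have d7: "\<delta> * (8 + 2 * \<rho>) \<le> \<eta>3" using d(6) \<rho>0 by (simp add: field_simps)
  show ?thesis
  proof (rule that[OF d(1)])
    fix m q q' assume near: "norm (m - n) < \<delta>" "norm (q - p) < \<delta>" "norm (q' - p) < \<delta>"
      and mE: "m \<in> admissible_directions M q" "m \<in> admissible_directions M q'" and w0: "0 < m \<bullet> (q' - q)"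
    define w where "w = m \<bullet> (q' - q)"
    have w: "0 < w" using w0 by (simp add: w_def)
    have m1: "norm m = 1" using admissibleD(1)[OF mE(1)] .
    have "w \<le> norm m * norm (q' - q)" unfolding w_def by (rule norm_cauchy_schwarz)
    moreover have "norm (q' - q) \<le> norm (q' - p) + norm (q - p)" by (metis norm_triangle_sub norm_minus_commute norm_triangle_ineq4 diff_diff_eq2 diff_add_cancel add_diff_cancel_right')
    ultimately have w2: "w < 2 * \<delta>" using near m1 by simp
    then have w3: "w < 3 * \<delta>" using d(1) by simp
    have shift: "norm (q + s *\<^sub>R m - p) < 4 * \<delta>" if "\<bar>s\<bar> < 3 * \<delta>" for s
    proof -
      have "norm (q + s *\<^sub>R m - p) \<le> norm (q - p) + norm (s *\<^sub>R m)"
        using norm_triangle_ineq[of "q - p" "s *\<^sub>R m"] by (simp add: algebra_simps)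
      then show ?thesis using near(2) that m1 by simp
    qed
    have tame: "tame_plane M Inn Out A m (q + s *\<^sub>R m)" if "\<bar>s\<bar> < 3 * \<delta>" for s
      using \<delta>0(2)[OF m1] shift[OF that] near(1) d(1,2) by simp
    have col: "q + s *\<^sub>R m \<in> Inn" if "\<bar>s\<bar> < 3 * \<delta>" for s
    proof -
      have "q + s *\<^sub>R m \<in> ball p rI" using shift[OF that] d(3) by (simp add: dist_norm norm_minus_commute)
      then show ?thesis using rI(2) by blast
    qed
    have planes: "\<forall>s. \<bar>s\<bar> < 3 * \<delta> \<longrightarrow> tame_plane M Inn Out A m (q + s *\<^sub>R m) \<and> q + s *\<^sub>R m \<in> Inn"
      using tame col by blast
    have q'I: "q' \<in> Inn"
    proof -
      have "q' \<in> ball p rI" using near(3) d(1,3) by (simp add: dist_norm norm_minus_commute)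
      then show ?thesis using rI(2) by blast
    qed
    obtain T where T: "T \<in> sets borel" "T \<subseteq> Inn \<inter> {x. 0 \<le> m \<bullet> (x - q) \<and> m \<bullet> (x - q) < w}"
      "\<And>x. 0 \<le> m \<bullet> (x - q) \<Longrightarrow> m \<bullet> (x - q) < w \<Longrightarrow> cball x w \<subseteq> Inn \<Longrightarrow> x \<in> T"
      "cut_volume M m q' - cut_volume M m q = measure lebesgue T"
      by (rule cut_region_slab[OF b planes mE q'I w_def w w3]) (rule that; assumption)
    define \<mu> where "\<mu> = m \<bullet> n"
    have "\<bar>(m - n) \<bullet> n\<bar> \<le> norm (m - n) * norm n" by (rule Cauchy_Schwarz_ineq2)
    then have \<mu>1: "1 - \<delta> \<le> \<mu>" using near(1) a(1) nn by (simp add: \<mu>_def inner_diff_left)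
    have \<mu>2: "\<mu> \<le> 1" using norm_cauchy_schwarz[of m n] m1 a(1) by (simp add: \<mu>_def)
    have \<mu>0: "1/2 \<le> \<mu>" "0 < \<mu>" using \<mu>1 d4 by linarith+
    define l where "l y = m \<bullet> (p + L y - q)" for y
    have contl: "continuous_on UNIV l" unfolding l_def
      by (intro continuous_on_inner continuous_on_const continuous_on_diff contL)
    have mf: "m \<bullet> (f z - q) = l (fst z) + snd z * \<mu>" for z
      by (simp add: f_def l_def \<mu>_def inner_add_right inner_diff_right)
    define E where "E S = {z. fst z \<in> S \<and> 0 \<le> l (fst z) + snd z * \<mu> \<and> l (fst z) + snd z * \<mu> < w}" for S
    have E: "E S \<in> sets borel" "measure lborel (E S) = measure lborel S * (w / \<mu>)"
      "emeasure lborel S < \<infinity> \<Longrightarrow> emeasure lborel (E S) < \<infinity>" if "S \<in> sets borel" for S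
    proof -
      note e = emeasure_oblique_slab[OF that contl \<mu>0(2) less_imp_le[OF w]]
      show "E S \<in> sets borel" using e(1) by (simp add: E_def)
      have e2: "emeasure lborel (E S) = emeasure lborel S * ennreal (w / \<mu>)" using e(2) by (simp add: E_def)
      show "measure lborel (E S) = measure lborel S * (w / \<mu>)"
        unfolding measure_def e2 using w \<mu>0(2) by (simp add: enn2real_mult)
      show "emeasure lborel S < \<infinity> \<Longrightarrow> emeasure lborel (E S) < \<infinity>" unfolding e2 by (simp add: ennreal_mult_less_top)
    qed
    have fT: "f -` T \<in> sets borel" using measurable_sets[OF f(4) T(1)] by simp
    have "measure lborel T = measure (distr lborel borel f) T" using f(3) by simp
    also have "\<dots> = measure lborel (f -` T)" using f(4) T(1) by (subst measure_distr) auto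
    finally have mT: "measure lebesgue T = measure lborel (f -` T)" using T(1) by simp
    let ?A = "{y. infdist y K \<le> \<eta>1}"
    have Ab: "?A \<in> sets borel" using borel_compact[OF \<eta>1(2)] .
    have upper: "f -` T \<subseteq> E ?A"
    proof
      fix z assume "z \<in> f -` T"
      then have z: "f z \<in> Inn" "0 \<le> m \<bullet> (f z - q)" "m \<bullet> (f z - q) < w" using T(2) by auto
      let ?q = "q + (m \<bullet> (f z - q)) *\<^sub>R m"
      have mm: "m \<bullet> m = 1" using m1 by (simp add: norm_eq_1)
      have "f z \<in> hyperplane m ?q" using mm by (simp add: hyperplane_def inner_diff_right inner_add_right)
      moreover have "f z \<in> cball p \<rho>" using z(1) \<rho> by auto
      moreover have "norm (?q - p) < \<delta>G" using shift[of "m \<bullet> (f z - q)"] z w2 d(1,4) by simp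
      ultimately have "f z \<in> G" using \<delta>G(2)[of m ?q] near(1) d(1,4) by auto
      then have "infdist (fst z) K < \<eta>1" using z(1) b(3) inv_f_f[OF \<open>inj f\<close>] by (auto simp: G_def)
      then show "z \<in> E ?A" using z mf by (simp add: E_def)
    qed
    have lower: "E S2 \<subseteq> f -` T"
    proof
      fix z assume "z \<in> E S2"
      then have z: "fst z \<in> S2" "0 \<le> m \<bullet> (f z - q)" "m \<bullet> (f z - q) < w" by (auto simp: E_def mf)
      let ?y = "p + L (fst z)"
      have yC: "?y \<in> (\<lambda>y. p + L y) ` C" using z(1) S2C by blast
      then have "?y \<in> ball p \<rho>" using LCI \<rho> by blast
      then have nLz: "norm (L (fst z)) < \<rho>" by (simp add: dist_norm)
      \<comment> \<open>Splits the height of the tilted plane over the base into the shift of the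
        base point and the tilt, each of order \<open>\<delta>\<close>.\<close>
      have "l (fst z) = m \<bullet> (p - q) + (m - n) \<bullet> L (fst z)"
        using nL by (simp add: l_def inner_diff_left inner_diff_right inner_add_right)
      moreover have "\<bar>m \<bullet> (p - q)\<bar> \<le> norm m * norm (p - q)" "\<bar>(m - n) \<bullet> L (fst z)\<bar> \<le> norm (m - n) * norm (L (fst z))"
        by (rule Cauchy_Schwarz_ineq2)+
      moreover have "norm m * norm (p - q) \<le> \<delta>" using m1 near(2) by (simp add: norm_minus_commute)
      moreover have "norm (m - n) * norm (L (fst z)) \<le> \<delta> * \<rho>" using near(1) nLz \<rho>0 d(1) by (intro mult_mono) auto
      ultimately have lb: "\<bar>l (fst z)\<bar> \<le> \<delta> + \<delta> * \<rho>" by linarith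
      have "\<bar>snd z * \<mu>\<bar> \<le> 2 * \<delta> + \<delta> + \<delta> * \<rho>" using z(2,3) w2 lb unfolding mf by linarith
      then have "\<bar>snd z\<bar> * \<mu> \<le> 2 * \<delta> + \<delta> + \<delta> * \<rho>" using \<mu>0(2) by (simp add: abs_mult)
      from order_trans[OF mult_left_mono[OF \<mu>0(1) abs_ge_zero] this]
      have sz: "\<bar>snd z\<bar> \<le> 2 * (3 * \<delta> + \<delta> * \<rho>)" by (simp add: algebra_simps)
      have "cball (f z) w \<subseteq> cball ?y \<eta>3"
      proof
        fix x assume "x \<in> cball (f z) w"
        then have "dist ?y x \<le> dist ?y (f z) + w" using dist_triangle[of ?y x "f z"] by simp
        also have "dist ?y (f z) = \<bar>snd z\<bar>" using a(1) by (simp add: f_def dist_norm)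
        finally have "dist ?y x \<le> \<delta> * (8 + 2 * \<rho>)" using sz w2 by (simp add: algebra_simps)
        then show "x \<in> cball ?y \<eta>3" using d7 by simp
      qed
      then have "cball (f z) w \<subseteq> Inn" using \<eta>3(2) yC by blast
      then show "z \<in> f -` T" using T(3)[of "f z"] z(2,3) by simp
    qed
    have finA: "emeasure lborel (E ?A) < \<infinity>" using E(3)[OF Ab] emeasure_compact_finite[OF \<eta>1(2)] by simp
    have Efm: "E ?A \<in> fmeasurable lborel" using finA E(1)[OF Ab] by (simp add: fmeasurable_def)
    have Tfm: "f -` T \<in> fmeasurable lborel" using fmeasurableI2[OF Efm upper] fT by simp
    have "measure lborel (f -` T) \<le> measure lborel (E ?A)"
      using upper fT Efm by (intro measure_mono_fmeasurable) auto
    also have "\<dots> = measure lborel ?A * (w / \<mu>)" by (rule E(2)[OF Ab])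
    also have "\<dots> \<le> (\<beta> + \<epsilon>/2) * (w / \<mu>)" using \<eta>1(3) w \<mu>0(2) by (intro mult_right_mono) auto
    also have "\<dots> \<le> (\<beta> + \<epsilon>) * w"
    proof -
      have "\<beta> + \<epsilon>/2 \<le> (\<beta> + \<epsilon>) * (1 - \<delta>)" using d6 by (simp add: algebra_simps)
      also have "\<dots> \<le> (\<beta> + \<epsilon>) * \<mu>" using \<mu>1 \<beta>0 \<epsilon> by (intro mult_left_mono) auto
      finally have "(\<beta> + \<epsilon>/2) * w \<le> (\<beta> + \<epsilon>) * \<mu> * w" using w by (intro mult_right_mono) auto
      then show ?thesis using \<mu>0(2) by (simp add: pos_divide_le_eq mult_ac)
    qed
    finally have up: "measure lborel (f -` T) \<le> (\<beta> + \<epsilon>) * w" .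
    have S2b: "S2 \<in> sets borel" using oS2 by simp
    have "(\<beta> - \<epsilon>) * w \<le> measure lborel S2 * w" using \<eta>2(2) w by (intro mult_right_mono) (auto simp: S2_def)
    also have "\<dots> \<le> measure lborel S2 * (w / \<mu>)"
    proof (rule mult_left_mono)
      have "w * \<mu> \<le> w * 1" using w \<mu>2 by (intro mult_left_mono) auto
      then show "w \<le> w / \<mu>" using \<mu>0(2) by (simp add: pos_le_divide_eq)
    qed simp
    also have "\<dots> = measure lborel (E S2)" by (rule E(2)[OF S2b, symmetric])
    also have "\<dots> \<le> measure lborel (f -` T)"
      using lower Tfm E(1)[OF S2b] by (intro measure_mono_fmeasurable) auto
    finally have lo: "(\<beta> - \<epsilon>) * w \<le> measure lborel (f -` T)" .
    have "\<bar>measure lborel (f -` T) - \<beta> * w\<bar> \<le> \<epsilon> * w" using up lo by (simp add: algebra_simps abs_le_iff)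
    then show "\<bar>cut_volume M m q' - cut_volume M m q - hyperplane_measure n p (enclosed M n p) * (m \<bullet> (q' - q))\<bar>
       \<le> \<epsilon> * (m \<bullet> (q' - q))"
      using T(4) mT by (simp add: \<beta>_def w_def)
  qed
qed

text \<open>The barrier shows that the enclosed set is open in the hyperplane; it therefore contains
  a disc about \<open>p\<close>.\<close>

lemma hyperplane_measure_enclosed_pos:
  fixes M :: "'n::finite space set"
  assumes M: "smooth_hypersurface M" and \<nu>: "unit_normal M \<nu>" and n: "n \<in> admissible_directions M p"
  shows "0 < hyperplane_measure n p (enclosed M n p)"
proof -
  note a = admissibleD[OF n]
  obtain Inn Out K \<rho> \<delta> where b: "open Inn" "open Out" "Inn \<inter> Out = {}" "Inn \<subseteq> ball p \<rho>" "- cball p \<rho> \<subseteq> Out"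
    "compact K" "K \<subseteq> M - mboundary M" "K \<inter> (Inn \<union> Out) = {}"
    "hyperplane n p \<inter> Inn = enclosed M n p" "hyperplane n p \<inter> K = slice M n p"
    "hyperplane n p \<subseteq> Inn \<union> Out \<union> K"
    "0 < \<delta>" "\<And>m q. norm (m - n) < \<delta> \<Longrightarrow> norm (q - p) < \<delta> \<Longrightarrow> hyperplane m q \<subseteq> Inn \<union> Out \<union> K"
    "\<And>\<gamma> U. \<gamma> \<in> slice M n p \<Longrightarrow> open U \<Longrightarrow> \<gamma> \<in> U \<Longrightarrow>
       \<exists>B. open B \<and> \<gamma> \<in> B \<and> B \<subseteq> U \<and> connected (B \<inter> Out) \<and> B \<inter> Out \<inter> hyperplane n p \<noteq> {}"
    by (rule enclosed_barrier[OF M \<nu> n]) (rule that; assumption)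
  define L where "L = (SOME L :: real ^ 'n \<Rightarrow> 'n space. linear L \<and> (\<forall>y. norm (L y) = norm y) \<and> range L = perp n)"
  have L: "linear L" "\<And>y. norm (L y) = norm y" "range L = perp n"
    using someI_ex[OF hyperplane_isometry_exists[OF a(1)]] unfolding L_def by blast+
  have contL: "continuous_on UNIV (\<lambda>y. p + L y)"
    using L(1) by (intro continuous_intros linear_continuous_on) (simp add: linear_conv_bounded_linear)
  have nL: "n \<bullet> L y = 0" for y using L(3) by (auto simp: perp_def)
  let ?R = "{y. p + L y \<in> enclosed M n p}"
  have R: "?R = (\<lambda>y. p + L y) -` Inn" using b(9) nL by (auto simp: hyperplane_def)
  then have oR: "open ?R" using open_vimage[OF b(1) contL] by simp
  have "0 \<in> ?R" using a(5) linear_0[OF L(1)] by simp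
  then obtain r where r: "0 < r" "ball 0 r \<subseteq> ?R" using oR openE by blast
  have "?R \<subseteq> cball 0 \<rho>"
  proof
    fix y assume "y \<in> ?R"
    then have "p + L y \<in> ball p \<rho>" using R b(4) by blast
    then show "y \<in> cball 0 \<rho>" using L(2)[of y] by (simp add: dist_norm)
  qed
  then have "bounded ?R" using bounded_cball bounded_subset by blast
  then have fm: "?R \<in> fmeasurable lborel"
    using emeasure_bounded_finite oR by (auto simp: fmeasurable_def)
  have "0 < measure lborel (ball (0 :: real ^ 'n) r)" using content_ball_pos[OF r(1)] .
  also have "\<dots> \<le> measure lborel ?R" using r(2) fm by (intro measure_mono_fmeasurable) auto
  also have "\<dots> = hyperplane_measure n p (enclosed M n p)"
    using oR by (simp add: hyperplane_measure_def Let_def L_def[symmetric])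
  finally show ?thesis .
qed

text \<open>The estimate is antisymmetric in \<open>q\<close> and \<open>q'\<close>; equal heights
  give one and the same plane.\<close>

lemma cut_volume_increment:
  fixes M :: "'n::finite space set"
  assumes M: "smooth_hypersurface M" and \<nu>: "unit_normal M \<nu>" and n: "n \<in> admissible_directions M p"
    and W: "open W" "n \<in> W" "W \<inter> sphere 0 1 \<subseteq> admissible_directions M p"
    and r0: "0 < r0" "ball p r0 \<inter> M = {}" and \<epsilon>: "0 < \<epsilon>"
  shows "\<exists>\<delta>>0. \<forall>m q q'. norm (m - n) < \<delta> \<and> norm (q - p) < \<delta> \<and> norm (q' - p) < \<delta> \<and>
     m \<in> admissible_directions M q \<and> m \<in> admissible_directions M q' \<longrightarrow>
     \<bar>cut_volume M m q' - cut_volume M m q - hyperplane_measure n p (enclosed M n p) * (m \<bullet> (q' - q))\<bar>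
       \<le> \<epsilon> * \<bar>m \<bullet> (q' - q)\<bar>"
proof -
  let ?b = "hyperplane_measure n p (enclosed M n p)"
  obtain \<delta> where \<delta>: "0 < \<delta>" "\<And>m q q'. norm (m - n) < \<delta> \<Longrightarrow> norm (q - p) < \<delta> \<Longrightarrow> norm (q' - p) < \<delta> \<Longrightarrow>
     m \<in> admissible_directions M q \<Longrightarrow> m \<in> admissible_directions M q' \<Longrightarrow> 0 < m \<bullet> (q' - q) \<Longrightarrow>
     \<bar>cut_volume M m q' - cut_volume M m q - ?b * (m \<bullet> (q' - q))\<bar> \<le> \<epsilon> * (m \<bullet> (q' - q))"
    by (rule cut_volume_increment_pos[OF M \<nu> n W r0 \<epsilon>]) (rule that; assumption)
  show ?thesis
  proof (intro exI[of _ \<delta>] conjI allI impI)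
    fix m q q'
    assume h: "norm (m - n) < \<delta> \<and> norm (q - p) < \<delta> \<and> norm (q' - p) < \<delta> \<and>
       m \<in> admissible_directions M q \<and> m \<in> admissible_directions M q'"
    consider "0 < m \<bullet> (q' - q)" | "m \<bullet> (q' - q) = 0" | "0 < m \<bullet> (q - q')"
      by (fastforce simp: inner_diff_right)
    then show "\<bar>cut_volume M m q' - cut_volume M m q - ?b * (m \<bullet> (q' - q))\<bar> \<le> \<epsilon> * \<bar>m \<bullet> (q' - q)\<bar>"
    proof cases
      case 1 then show ?thesis using \<delta>(2)[of m q q'] h by simp
    next
      case 2
      then have "cut_volume M m q' = cut_volume M m q" by (intro cut_volume_cong) (simp add: inner_diff_right)
      then show ?thesis using 2 by simp
    next
      case 3
      have neg: "m \<bullet> (q' - q) = - (m \<bullet> (q - q'))" by (simp add: inner_diff_right)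
      have "\<bar>cut_volume M m q - cut_volume M m q' - ?b * (m \<bullet> (q - q'))\<bar> \<le> \<epsilon> * (m \<bullet> (q - q'))"
        using \<delta>(2)[of m q' q] h 3 by simp
      then show ?thesis using 3 unfolding neg by (simp add: abs_le_iff)
    qed
  qed (rule \<delta>(1))
qed

text \<open>A point with an admissible direction is enclosed, hence not on the slice through it.
  Boundary points of \<open>M\<close> are excluded as limits of interior ones, using that
  \<open>D\<close> is open.\<close>

lemma minimizable_open_disjoint:
  fixes M D :: "'n::finite space set"
  assumes D: "open D" "D \<subseteq> minimizable M"
  shows "D \<inter> M = {}"
proof -
  have int: "x \<notin> M - mboundary M" if "x \<in> D" for x
  proof -
    obtain n where "n \<in> admissible_directions M x"
      using D(2) \<open>x \<in> D\<close> by (auto simp: minimizable_def minimizing_def)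
    then have "x \<in> enclosed M n x" by (rule admissibleD)
    then show ?thesis by (auto simp: enclosed_def slice_def)
  qed
  show ?thesis
  proof (rule equals0I)
    fix x assume x: "x \<in> D \<inter> M"
    then have "x \<in> mboundary M" using int by blast
    then have "x \<in> closure (M - mboundary M)" by (rule mboundary_subset_closure_interior)
    then have "D \<inter> (M - mboundary M) \<noteq> {}" using D(1) x open_Int_closure_eq_empty by blast
    then show False using int by blast
  qed
qed

section \<open>The envelope argument\<close>

text \<open>A directional derivative along points that approach \<open>p\<close> tangentially to
  \<open>Y\<close> rather than on a line; the points supplied by the intermediate value theorem
  below are of this kind.\<close>

lemma has_derivative_sequential:
  fixes h :: "'a::real_normed_vector \<Rightarrow> 'b::real_normed_vector"
  assumes h: "(h has_derivative h') (at p)" and t: "\<And>k. 0 < t k" "t \<longlonglongrightarrow> 0"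
    and q: "(\<lambda>k. (q k - p) /\<^sub>R t k) \<longlonglongrightarrow> Y"
  shows "(\<lambda>k::nat. (h (q k) - h p) /\<^sub>R t k) \<longlonglongrightarrow> h' Y"
proof -
  have bl: "bounded_linear h'" using h by (rule has_derivative_bounded_linear)
  let ?r = "\<lambda>k. (q k - p) /\<^sub>R t k"
  have lim1: "(\<lambda>k. h' (?r k)) \<longlonglongrightarrow> h' Y" by (rule bounded_linear.tendsto[OF bl q])
  have "(\<lambda>k. t k *\<^sub>R ?r k) \<longlonglongrightarrow> 0 *\<^sub>R Y" by (intro tendsto_intros t q)
  moreover have "t k *\<^sub>R ?r k = q k - p" for k using t(1)[of k] by simp
  ultimately have qp: "(\<lambda>k. q k - p) \<longlonglongrightarrow> 0" by simp
  have "(\<lambda>k. (h (q k) - h p) /\<^sub>R t k - h' (?r k)) \<longlonglongrightarrow> 0"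
  proof (rule LIMSEQ_I)
    fix e :: real assume e: "0 < e"
    define c where "c = e / (norm Y + 2)"
    have c: "0 < c" using e by (simp add: c_def add_nonneg_pos)
    obtain d where d: "0 < d" "\<And>y. norm (y - p) < d \<Longrightarrow> norm (h y - h p - h' (y - p)) \<le> c * norm (y - p)"
      using h c unfolding has_derivative_at_alt by blast
    have "\<forall>\<^sub>F k in sequentially. norm (q k - p) < d"
      using tendsto_norm[OF qp] d(1) by (intro order_tendstoD) auto
    moreover have "\<forall>\<^sub>F k in sequentially. norm (?r k) < norm Y + 1"
      using tendsto_norm[OF q] by (intro order_tendstoD) auto
    ultimately have "\<forall>\<^sub>F k in sequentially. norm ((h (q k) - h p) /\<^sub>R t k - h' (?r k)) < e"
    proof eventually_elim
      case (elim k)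
      have "h' (?r k) = h' (q k - p) /\<^sub>R t k" by (rule linear_scale[OF bounded_linear.linear[OF bl]])
      then have "(h (q k) - h p) /\<^sub>R t k - h' (?r k) = (h (q k) - h p - h' (q k - p)) /\<^sub>R t k"
        by (simp only: scaleR_diff_right)
      then have "norm ((h (q k) - h p) /\<^sub>R t k - h' (?r k)) = norm (h (q k) - h p - h' (q k - p)) / t k"
        using t(1)[of k] by (simp add: divide_inverse mult.commute)
      also have "\<dots> \<le> c * norm (q k - p) / t k"
        using d(2)[OF elim(1)] t(1)[of k] by (intro divide_right_mono) auto
      also have "\<dots> = c * norm (?r k)" using t(1)[of k] by (simp add: divide_inverse mult.commute)
      also have "\<dots> \<le> c * (norm Y + 1)" using c elim(2) by (intro mult_left_mono) auto
      also have "\<dots> < c * (norm Y + 2)" using c by simp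
      also have "\<dots> = e" by (simp add: c_def add_nonneg_eq_0_iff)
      finally show ?case .
    qed
    then show "\<exists>no. \<forall>k\<ge>no. norm ((h (q k) - h p) /\<^sub>R t k - h' (?r k) - 0) < e"
      by (simp add: eventually_sequentially)
  qed
  from tendsto_add[OF this lim1] show ?thesis by simp
qed

text \<open>Where one factor vanishes, mere continuity of the other suffices for the product rule.
  The area \<open>\<beta>\<close> is shown to be continuous, not differentiable, which is why the
  hessian is evaluated only on directions orthogonal to n(p).\<close>

lemma has_derivative_mult_at_zero:
  fixes \<beta> g :: "'a::real_normed_vector \<Rightarrow> real"
  assumes g: "(g has_derivative g') (at p)" and g0: "g p = 0" and \<beta>: "isCont \<beta> p"
  shows "((\<lambda>y. \<beta> y * g y) has_derivative (\<lambda>h. \<beta> p * g' h)) (at p)"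
proof -
  have bl: "bounded_linear g'" using g by (rule has_derivative_bounded_linear)
  obtain B where B: "0 < B" "\<And>x. norm (g' x) \<le> norm x * B" using bounded_linear.pos_bounded[OF bl] by blast
  show ?thesis unfolding has_derivative_at_alt
  proof (intro conjI allI impI)
    show "bounded_linear (\<lambda>h. \<beta> p * g' h)" using bl by (rule bounded_linear_const_mult)
    fix e :: real assume e: "0 < e"
    define c where "c = e / (2 * (\<bar>\<beta> p\<bar> + 1))"
    have c: "0 < c" using e by (simp add: c_def add_nonneg_pos)
    obtain d1 where d1: "0 < d1" "\<And>y. norm (y - p) < d1 \<Longrightarrow> norm (g y - g p - g' (y - p)) \<le> c * norm (y - p)"
      using g c unfolding has_derivative_at_alt by blast
    define c2 where "c2 = min 1 (e / (2 * B))"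
    have c2: "0 < c2" "c2 \<le> 1" "c2 * B \<le> e/2" using e B(1) by (auto simp: c2_def min_def field_simps)
    obtain d2 where d2: "0 < d2" "\<And>y. norm (y - p) < d2 \<Longrightarrow> \<bar>\<beta> y - \<beta> p\<bar> < c2"
      using \<beta> c2(1) unfolding continuous_at_eps_delta by (auto simp: dist_norm)
    show "\<exists>d>0. \<forall>y. norm (y - p) < d \<longrightarrow>
        norm (\<beta> y * g y - \<beta> p * g p - \<beta> p * g' (y - p)) \<le> e * norm (y - p)"
    proof (intro exI[of _ "min d1 d2"] conjI allI impI)
      fix y assume y: "norm (y - p) < min d1 d2"
      have b_y: "\<bar>\<beta> y - \<beta> p\<bar> < c2" using d2(2) y by simp
      have gy: "\<bar>g y - g' (y - p)\<bar> \<le> c * norm (y - p)" using d1(2)[of y] y g0 by simp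
      have "\<beta> y * g y - \<beta> p * g p - \<beta> p * g' (y - p) = \<beta> y * (g y - g' (y - p)) + (\<beta> y - \<beta> p) * g' (y - p)"
        using g0 by (simp add: algebra_simps)
      then have "norm (\<beta> y * g y - \<beta> p * g p - \<beta> p * g' (y - p)) \<le> \<bar>\<beta> y\<bar> * \<bar>g y - g' (y - p)\<bar> + \<bar>\<beta> y - \<beta> p\<bar> * \<bar>g' (y - p)\<bar>"
        by (simp add: abs_mult[symmetric] abs_triangle_ineq)
      also have "\<dots> \<le> (\<bar>\<beta> p\<bar> + 1) * (c * norm (y - p)) + c2 * (norm (y - p) * B)"
        using b_y gy B c2 c by (intro add_mono mult_mono) auto
      also have "\<dots> = ((\<bar>\<beta> p\<bar> + 1) * c + c2 * B) * norm (y - p)" by (simp add: algebra_simps)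
      also have "\<dots> \<le> e * norm (y - p)"
      proof (rule mult_right_mono)
        have "(\<bar>\<beta> p\<bar> + 1) * c = e/2" by (simp add: c_def add_nonneg_eq_0_iff field_simps)
        then show "(\<bar>\<beta> p\<bar> + 1) * c + c2 * B \<le> e" using c2(3) by simp
      qed simp
      finally show "norm (\<beta> y * g y - \<beta> p * g p - \<beta> p * g' (y - p)) \<le> e * norm (y - p)" .
    qed (use d1 d2 in simp)
  qed
qed

text \<open>The Riesz vector of the functional, projected to \<open>perp n\<close>; this makes the
  definite description in \<open>form_operator\<close> proper.\<close>

lemma form_operator_perp:
  fixes n :: "'a::euclidean_space"
  assumes n: "norm n = 1" and B: "linear (B X)"
  shows "form_operator (perp n) B X \<in> perp n"
    and "Y \<in> perp n \<Longrightarrow> form_operator (perp n) B X \<bullet> Y = B X Y"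
proof -
  have nn: "n \<bullet> n = 1" using n by (simp add: norm_eq_1)
  define g where "g = (\<Sum>b\<in>Basis. B X b *\<^sub>R b)"
  have g: "B X Y = g \<bullet> Y" for Y unfolding g_def by (rule linear_functional_inner[OF B])
  define Z where "Z = g - (n \<bullet> g) *\<^sub>R n"
  have Z: "Z \<in> perp n \<and> (\<forall>Y\<in>perp n. Z \<bullet> Y = B X Y)"
    using nn by (auto simp: Z_def perp_def g inner_diff_right inner_diff_left)
  have "form_operator (perp n) B X = Z"
    unfolding form_operator_def
  proof (rule the_equality[where P = "\<lambda>Z. Z \<in> perp n \<and> (\<forall>Y\<in>perp n. Z \<bullet> Y = B X Y)", OF Z])
    fix Z' assume Z': "Z' \<in> perp n \<and> (\<forall>Y\<in>perp n. Z' \<bullet> Y = B X Y)"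
    have "Z' - Z \<in> perp n" using Z Z' by (auto simp: perp_def inner_diff_right)
    then have "Z' \<bullet> (Z' - Z) = Z \<bullet> (Z' - Z)" using Z Z' by metis
    then have "(Z' - Z) \<bullet> (Z' - Z) = 0" by (simp add: inner_diff_left)
    then show "Z' = Z" by simp
  qed
  then show "form_operator (perp n) B X \<in> perp n"
    and "Y \<in> perp n \<Longrightarrow> form_operator (perp n) B X \<bullet> Y = B X Y" using Z by auto
qed

text \<open>
  Up to the factor \<open>- \<beta>\<^sup>2\<close>, \<open>C\<close> is a left inverse of \<open>B\<close>; being linear on a finite-dimensional space, it is
  a two-sided one.
\<close>

lemma perp_inverse_of_left_inverse:
  fixes n :: "'a::euclidean_space" and A :: "'a \<Rightarrow> 'a"
  assumes n: "norm n = 1" and A: "linear A" "\<And>Y. n \<bullet> A Y = 0" and \<beta>: "(\<beta>::real) > 0"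
    and B: "\<And>X. X \<in> perp n \<Longrightarrow> B X \<in> perp n" "\<And>X Y. X \<in> perp n \<Longrightarrow> Y \<in> perp n \<Longrightarrow> B X \<bullet> A Y = - \<beta> * (X \<bullet> Y)"
    and C: "\<And>X. X \<in> perp n \<Longrightarrow> C X \<in> perp n" "\<And>X Y. X \<in> perp n \<Longrightarrow> Y \<in> perp n \<Longrightarrow> C X \<bullet> Y = \<beta> * (A Y \<bullet> X)"
  defines "Q \<equiv> \<lambda>X. (1 / \<beta>) *\<^sub>R B X"
  shows "bij_betw Q (perp n) (perp n)"
    and "X \<in> perp n \<Longrightarrow> - (1 / \<beta>) *\<^sub>R C X = inv_into (perp n) Q X"
proof -
  have nn: "n \<bullet> n = 1" using n by (simp add: norm_eq_1)
  have perp_eq: "X = Y" if "X \<in> perp n" "Y \<in> perp n" "\<And>Z. Z \<in> perp n \<Longrightarrow> X \<bullet> Z = Y \<bullet> Z" for X Y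
  proof -
    have "X - Y \<in> perp n" using that(1,2) by (simp add: perp_def inner_diff_right)
    then have "(X - Y) \<bullet> (X - Y) = 0" using that(3)[of "X - Y"] by (simp add: inner_diff_left)
    then show ?thesis by simp
  qed
  have scale: "c *\<^sub>R X \<in> perp n" if "X \<in> perp n" for c X using that by (simp add: perp_def)
  have CB: "C (B X) = (- (\<beta> * \<beta>)) *\<^sub>R X" if X: "X \<in> perp n" for X
  proof (rule perp_eq)
    fix Z assume Z: "Z \<in> perp n"
    show "C (B X) \<bullet> Z = (- (\<beta> * \<beta>)) *\<^sub>R X \<bullet> Z"
      using C(2)[OF B(1)[OF X] Z] B(2)[OF X Z] by (simp add: inner_commute)
  next
    show "C (B X) \<in> perp n" by (rule C(1)[OF B(1)[OF X]])
    show "(- (\<beta> * \<beta>)) *\<^sub>R X \<in> perp n" by (rule scale[OF X])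
  qed
  \<comment> \<open>Extends \<open>C\<close> from \<open>perp n\<close> to a linear map of the whole
    space that fixes \<open>n\<close>, so that surjectivity implies injectivity. On
    \<open>perp n\<close> the map \<open>C\<close> is \<open>\<beta>\<close> times the tangential
    part of the adjoint of \<open>A\<close>.\<close>
  define C' where "C' x = \<beta> *\<^sub>R (adjoint A x - (n \<bullet> adjoint A x) *\<^sub>R n) + (n \<bullet> x) *\<^sub>R n" for x
  have adj: "x \<bullet> A y = adjoint A x \<bullet> y" for x y by (metis adjoint_works[OF A(1)] inner_commute)
  have ladj: "linear (adjoint A)" by (rule adjoint_linear[OF A(1)])
  have linC': "linear C'"
  proof (rule linearI)
    fix x y
    show "C' (x + y) = C' x + C' y"
      by (simp add: C'_def linear_add[OF ladj] inner_add_right scaleR_add_left scaleR_add_right scaleR_diff_right)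
  next
    fix c x
    show "C' (c *\<^sub>R x) = c *\<^sub>R C' x"
      by (simp add: C'_def linear_scale[OF ladj] scaleR_add_right scaleR_diff_right mult_ac)
  qed
  have C'C: "C' x = C x" if x: "x \<in> perp n" for x
  proof (rule perp_eq)
    show "C' x \<in> perp n" using x nn by (simp add: C'_def perp_def inner_add_right inner_diff_right)
    fix Z assume Z: "Z \<in> perp n"
    show "C' x \<bullet> Z = C x \<bullet> Z"
      using C(2)[OF x Z] x Z adj[of x Z]
      by (simp add: C'_def perp_def inner_add_left inner_diff_left inner_commute[of "A Z"])
  qed (use C(1) x in auto)
  have "adjoint A n = 0" using adj[of n "adjoint A n"] A(2) by simp
  then have C'n: "C' n = n" using nn by (simp add: C'_def)
  have "surj C'"
  proof (rule surjI)
    fix y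
    let ?y = "y - (n \<bullet> y) *\<^sub>R n"
    have y': "?y \<in> perp n" using nn by (simp add: perp_def inner_diff_right)
    let ?z = "(- 1 / (\<beta> * \<beta>)) *\<^sub>R ?y"
    have "C' (B ?z) = (- (\<beta> * \<beta>)) *\<^sub>R ?z"
      by (simp only: C'C[OF B(1)[OF scale[OF y']]] CB[OF scale[OF y']])
    also have "\<dots> = ?y" using \<beta> by simp
    finally have "C' (B ?z) = ?y" .
    then show "C' (B ((- 1 / (\<beta> * \<beta>)) *\<^sub>R (y - (n \<bullet> y) *\<^sub>R n)) + (n \<bullet> y) *\<^sub>R n) = y"
      using linC' C'n by (simp add: linear_add linear_scale)
  qed
  then have inj: "inj C'" using linC' linear_surjective_imp_injective by blast
  have BC: "B (C X) = (- (\<beta> * \<beta>)) *\<^sub>R X" if X: "X \<in> perp n" for X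
  proof (rule injD[OF inj])
    have "C' (B (C X)) = (- (\<beta> * \<beta>)) *\<^sub>R C' X"
      using C'C[OF B(1)[OF C(1)[OF X]]] CB[OF C(1)[OF X]] C'C[OF X] by simp
    then show "C' (B (C X)) = C' ((- (\<beta> * \<beta>)) *\<^sub>R X)" by (simp only: linear_scale[OF linC'])
  qed
  have Clin: "C (c *\<^sub>R X) = c *\<^sub>R C X" if X: "X \<in> perp n" for c X
    using C'C[OF X] C'C[OF scale[OF X, of c]] linC' by (simp add: linear_scale)
  have left: "- (1 / \<beta>) *\<^sub>R C (Q X) = X" if X: "X \<in> perp n" for X
    using Clin[OF B(1)[OF X], of "1 / \<beta>"] CB[OF X] \<beta> by (simp add: Q_def)
  have right: "Q (- (1 / \<beta>) *\<^sub>R C X) = X" if X: "X \<in> perp n" for X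
  proof -
    have "Q (C ((- (1 / \<beta>)) *\<^sub>R X)) = X" using BC[OF scale[OF X, of "- (1 / \<beta>)"]] \<beta> by (simp add: Q_def)
    then show ?thesis using Clin[OF X, of "- (1 / \<beta>)"] by simp
  qed
  have Qp: "Q X \<in> perp n" if "X \<in> perp n" for X using B(1)[OF that] scale by (simp add: Q_def)
  have Cp: "- (1 / \<beta>) *\<^sub>R C X \<in> perp n" if "X \<in> perp n" for X using C(1)[OF that] scale by blast
  show bij: "bij_betw Q (perp n) (perp n)"
    by (rule bij_betwI[where g = "\<lambda>X. - (1 / \<beta>) *\<^sub>R C X"]) (use Qp Cp left right in auto)
  show "- (1 / \<beta>) *\<^sub>R C X = inv_into (perp n) Q X" if X: "X \<in> perp n"
    by (rule inv_into_f_eq[OF bij_betw_imp_inj_on[OF bij] Cp[OF X] right[OF X], symmetric])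
qed

lemma frechet_derivative_apply:
  assumes "(f has_derivative f') (at x)" shows "frechet_derivative f (at x) h = f' h"
  using frechet_derivative_at[OF assms] by simp

section \<open>The abstract envelope argument\<close>

text \<open>Geometry enters only through \<open>increment\<close> and the positivity of
  \<open>\<beta>\<close>. \<open>V m q\<close> is meaningful only for \<open>m \<in> E q\<close>, so
  \<open>increment\<close> is guarded by membership at both points; each use below takes a direction
  minimizing at one point and admissible near the other.\<close>

locale envelope =
  fixes D :: "'a::euclidean_space set" and nd :: "'a \<Rightarrow> 'a" and E :: "'a \<Rightarrow> 'a set"
    and V :: "'a \<Rightarrow> 'a \<Rightarrow> real" and \<beta> v :: "'a \<Rightarrow> real"
  assumes D: "open D"
    and E1: "\<And>p m. m \<in> E p \<Longrightarrow> norm m = 1"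
    and ndE: "\<And>p. p \<in> D \<Longrightarrow> nd p \<in> E p"
    and minV: "\<And>p m. p \<in> D \<Longrightarrow> m \<in> E p \<Longrightarrow> V (nd p) p \<le> V m p"
    and twice: "\<And>p. p \<in> D \<Longrightarrow> twice_differentiable_on_sphere_at (E p) (\<lambda>m. V m p) (nd p)"
    and nd_diff: "\<And>p. p \<in> D \<Longrightarrow> nd differentiable at p"
    and \<beta>_pos: "\<And>p. p \<in> D \<Longrightarrow> 0 < \<beta> p"
    and v: "\<And>p. p \<in> D \<Longrightarrow> v p = V (nd p) p"
    and increment: "\<And>p \<epsilon>. p \<in> D \<Longrightarrow> 0 < \<epsilon> \<Longrightarrow> \<exists>\<delta>>0. \<forall>m q q'. norm (m - nd p) < \<delta> \<and> norm (q - p) < \<delta> \<and>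
       norm (q' - p) < \<delta> \<and> m \<in> E q \<and> m \<in> E q' \<longrightarrow>
       \<bar>V m q' - V m q - \<beta> p * (m \<bullet> (q' - q))\<bar> \<le> \<epsilon> * \<bar>m \<bullet> (q' - q)\<bar>"
begin

abbreviation Vh :: "'a \<Rightarrow> 'a \<Rightarrow> real" where "Vh p \<equiv> radial_extension (\<lambda>m. V m p)"

lemma norm_nd: "p \<in> D \<Longrightarrow> norm (nd p) = 1"
  using E1 ndE by blast

lemma Vh_unit: "norm m = 1 \<Longrightarrow> Vh p m = V m p"
  by (simp add: radial_extension_def)

lemma nd_derivative: "p \<in> D \<Longrightarrow> (nd has_derivative frechet_derivative nd (at p)) (at p)"
  using nd_diff frechet_derivative_works by blast

lemma nd_cont: "p \<in> D \<Longrightarrow> isCont nd p"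
  using nd_derivative has_derivative_continuous by blast

text \<open>The neighborhood is cut down to be stable under radial projection, so that estimates for
  unit vectors transfer to the radial extension on an open set.\<close>

lemma E_nbhd:
  assumes "p \<in> D"
  obtains W where "open W" "nd p \<in> W" "W \<inter> sphere 0 1 \<subseteq> E p"
    "\<And>x. x \<in> W \<Longrightarrow> Vh p differentiable at x" "\<And>x. x \<in> W \<Longrightarrow> x /\<^sub>R norm x \<in> W \<inter> sphere 0 1"
proof -
  obtain W1 where W1: "open W1" "nd p \<in> W1" "W1 \<inter> sphere 0 1 \<subseteq> E p"
    and td: "twice_differentiable_at (Vh p) (nd p)"
    using twice[OF assms] unfolding twice_differentiable_on_sphere_at_def by blast
  obtain W2 where W2: "open W2" "nd p \<in> W2" "\<And>x. x \<in> W2 \<Longrightarrow> Vh p differentiable at x"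
    using td unfolding twice_differentiable_at_def eventually_nhds by blast
  have n1: "norm (nd p) = 1" by (rule norm_nd[OF assms])
  obtain r where r: "0 < r" "ball (nd p) r \<subseteq> W1 \<inter> W2" using W1(1,2) W2(1,2) by (meson open_Int openE IntI)
  define s where "s = min (r/2) (1/2)"
  have s: "0 < s" "s \<le> 1/2" "2 * s \<le> r" using r(1) by (auto simp: s_def)
  define W where "W = ball (nd p) r \<inter> {x. x \<noteq> 0} \<inter> (\<lambda>x. x /\<^sub>R norm x) -` ball (nd p) r"
  have "open ({x::'a. x \<noteq> 0} \<inter> (\<lambda>x. x /\<^sub>R norm x) -` ball (nd p) r)"
    by (intro continuous_open_preimage continuous_intros open_ball open_Collect_neq) auto
  then have oW: "open W" unfolding W_def by (metis Int_assoc open_Int open_ball)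
  show ?thesis
  proof (rule that[OF oW])
    show "nd p \<in> W" using n1 r(1) by (auto simp: W_def)
    show "W \<inter> sphere 0 1 \<subseteq> E p" using r(2) W1(3) by (auto simp: W_def)
    show "Vh p differentiable at x" if "x \<in> W" for x using that r(2) W2(3) by (auto simp: W_def)
    show "x /\<^sub>R norm x \<in> W \<inter> sphere 0 1" if "x \<in> W" for x using that by (auto simp: W_def)
  qed
qed

lemma eventually_nd_E:
  assumes "p \<in> D" shows "\<forall>\<^sub>F q in nhds p. q \<in> D \<and> nd q \<in> E p"
proof -
  obtain W where W: "open W" "nd p \<in> W" "W \<inter> sphere 0 1 \<subseteq> E p" using E_nbhd[OF assms] by metis
  have "\<forall>\<^sub>F q in nhds p. q \<in> D" using D assms eventually_nhds by blast
  moreover have "\<forall>\<^sub>F q in nhds p. nd q \<in> W"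
    using nd_cont[OF assms] W(1,2) unfolding continuous_at tendsto_at_iff_tendsto_nhds
    by (rule topological_tendstoD)
  ultimately show ?thesis
    by eventually_elim (use W(3) norm_nd in auto)
qed

lemma eventually_nd_near:
  assumes "p \<in> D" "0 < c" shows "\<forall>\<^sub>F q in nhds p. norm (nd q - nd p) < c"
  using nd_cont[OF assms(1)] assms(2) unfolding continuous_at tendsto_at_iff_tendsto_nhds
  by (auto simp: tendsto_iff dist_norm)

text \<open>The radial extension turns the minimum on the sphere into an unconstrained local
  minimum, so its derivative vanishes in all directions.\<close>

lemma Vh_critical:
  assumes "p \<in> D" shows "(Vh p has_derivative (\<lambda>h. 0)) (at (nd p))"
proof -
  obtain W where W: "open W" "nd p \<in> W" "W \<inter> sphere 0 1 \<subseteq> E p"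
    "\<And>x. x \<in> W \<Longrightarrow> Vh p differentiable at x" "\<And>x. x \<in> W \<Longrightarrow> x /\<^sub>R norm x \<in> W \<inter> sphere 0 1"
    using E_nbhd[OF assms] by metis
  have d: "(Vh p has_derivative frechet_derivative (Vh p) (at (nd p))) (at (nd p))"
    using W(2,4) frechet_derivative_works by blast
  have "Vh p (nd p) \<le> Vh p x" if "x \<in> W" for x
    using minV[OF assms, of "x /\<^sub>R norm x"] W(3) W(5)[OF that] Vh_unit[OF norm_nd[OF assms]]
    by (auto simp: radial_extension_def)
  then have "frechet_derivative (Vh p) (at (nd p)) = (\<lambda>h. 0)"
    using differential_zero_maxmin[OF W(2,1) d] by blast
  then show ?thesis using d by simp
qed

text \<open>v(q) is V(n(q), p) plus the increment from \<open>p\<close> to \<open>q\<close> in the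
  fixed direction n(q). The first term has derivative zero since n(p) is critical; the second is
  governed by the rate.\<close>

lemma v_derivative:
  assumes p: "p \<in> D" shows "(v has_derivative (\<lambda>h. \<beta> p * (nd p \<bullet> h))) (at p)"
proof -
  define f where "f q = V (nd q) q - V (nd q) p" for q
  have f0: "f p = 0" by (simp add: f_def)
  have "(f has_derivative (\<lambda>h. \<beta> p * (nd p \<bullet> h))) (at p)"
    unfolding has_derivative_at_alt
  proof (intro conjI allI impI)
    show "bounded_linear (\<lambda>h. \<beta> p * (nd p \<bullet> h))"
      by (intro bounded_linear_const_mult bounded_linear_inner_right)
    fix e :: real assume e: "0 < e"
    obtain \<delta> where \<delta>: "0 < \<delta>" "\<forall>m q q'. norm (m - nd p) < \<delta> \<and> norm (q - p) < \<delta> \<and>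
       norm (q' - p) < \<delta> \<and> m \<in> E q \<and> m \<in> E q' \<longrightarrow>
       \<bar>V m q' - V m q - \<beta> p * (m \<bullet> (q' - q))\<bar> \<le> e/2 * \<bar>m \<bullet> (q' - q)\<bar>"
      using increment[OF p, of "e/2"] e by auto
    \<comment> \<open>Half of \<open>e\<close> is spent on the increment, half on replacing n(q) by
      n(p) in the linear term.\<close>
    define c where "c = min \<delta> (e / (2 * \<beta> p))"
    have c: "0 < c" "\<beta> p * c \<le> e/2" using \<delta>(1) e \<beta>_pos[OF p] by (auto simp: c_def min_def field_simps)
    have "\<forall>\<^sub>F q in nhds p. norm (nd q - nd p) < c" by (rule eventually_nd_near[OF p c(1)])
    with eventually_nd_E[OF p] have "\<forall>\<^sub>F q in nhds p. q \<in> D \<and> nd q \<in> E p \<and> norm (nd q - nd p) < c"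
      by eventually_elim auto
    then obtain d where d: "0 < d" "\<And>q. norm (q - p) < d \<Longrightarrow> q \<in> D \<and> nd q \<in> E p \<and> norm (nd q - nd p) < c"
      unfolding eventually_nhds_metric by (auto simp: dist_norm)
    show "\<exists>d>0. \<forall>y. norm (y - p) < d \<longrightarrow>
        norm (f y - f p - \<beta> p * (nd p \<bullet> (y - p))) \<le> e * norm (y - p)"
    proof (intro exI[of _ "min d \<delta>"] conjI allI impI)
      fix q assume q: "norm (q - p) < min d \<delta>"
      have h: "q \<in> D" "nd q \<in> E p" "norm (nd q - nd p) < c" using d(2) q by auto
      have "\<bar>f q - \<beta> p * (nd q \<bullet> (q - p))\<bar> \<le> e/2 * \<bar>nd q \<bullet> (q - p)\<bar>"
        using \<delta> h q ndE[OF h(1)] unfolding f_def by (auto simp: c_def)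
      also have "\<dots> \<le> e/2 * norm (q - p)"
        using e Cauchy_Schwarz_ineq2[of "nd q" "q - p"] norm_nd[OF h(1)] by (intro mult_left_mono) auto
      finally have 1: "\<bar>f q - \<beta> p * (nd q \<bullet> (q - p))\<bar> \<le> e/2 * norm (q - p)" .
      have "\<bar>(nd q - nd p) \<bullet> (q - p)\<bar> \<le> c * norm (q - p)"
        using Cauchy_Schwarz_ineq2[of "nd q - nd p" "q - p"] h(3)
        by (meson less_imp_le mult_right_mono norm_ge_zero order_trans)
      then have "\<beta> p * \<bar>(nd q - nd p) \<bullet> (q - p)\<bar> \<le> \<beta> p * (c * norm (q - p))"
        using \<beta>_pos[OF p] by (intro mult_left_mono) auto
      also have "\<dots> \<le> e/2 * norm (q - p)" using mult_right_mono[OF c(2) norm_ge_zero, of "q - p"] by (simp add: mult.assoc)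
      finally have 2: "\<bar>\<beta> p * ((nd q - nd p) \<bullet> (q - p))\<bar> \<le> e/2 * norm (q - p)"
        using \<beta>_pos[OF p] by (simp add: abs_mult)
      have eq: "f q - f p - \<beta> p * (nd p \<bullet> (q - p))
          = (f q - \<beta> p * (nd q \<bullet> (q - p))) + \<beta> p * ((nd q - nd p) \<bullet> (q - p))"
        using f0 by (simp add: inner_diff_left algebra_simps)
      have "\<bar>f q - f p - \<beta> p * (nd p \<bullet> (q - p))\<bar> \<le> e/2 * norm (q - p) + e/2 * norm (q - p)"
        unfolding eq by (rule order_trans[OF abs_triangle_ineq add_mono[OF 1 2]])
      then show "norm (f q - f p - \<beta> p * (nd p \<bullet> (q - p))) \<le> e * norm (q - p)" by simp
    qed (use d \<delta> in simp)
  qed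
  moreover have "((\<lambda>q. Vh p (nd q)) has_derivative (\<lambda>h. 0)) (at p)"
    using has_derivative_compose[OF nd_derivative[OF p] Vh_critical[OF p]] by simp
  ultimately have sum: "((\<lambda>q. f q + Vh p (nd q)) has_derivative (\<lambda>h. \<beta> p * (nd p \<bullet> h))) (at p)"
    using has_derivative_add by fastforce
  have "f q + Vh p (nd q) = v q" if "q \<in> D" for q
    using v[OF that] Vh_unit[OF norm_nd[OF that]] by (simp add: f_def)
  then show ?thesis
    by (intro has_derivative_transform_within_open[OF sum D p]) auto
qed

text \<open>The rate estimates centred at \<open>p\<close> and at \<open>q\<close> are both applied
  to one increment near \<open>q\<close>; dividing by its width compares \<open>\<beta> p\<close>
  with \<open>\<beta> q\<close>.\<close>

lemma \<beta>_cont: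
  assumes p: "p \<in> D" shows "isCont \<beta> p"
  unfolding continuous_at_eps_delta
proof (intro allI impI)
  fix e :: real assume e: "0 < e"
  obtain \<delta> where \<delta>: "0 < \<delta>" "\<forall>m q q'. norm (m - nd p) < \<delta> \<and> norm (q - p) < \<delta> \<and>
       norm (q' - p) < \<delta> \<and> m \<in> E q \<and> m \<in> E q' \<longrightarrow>
       \<bar>V m q' - V m q - \<beta> p * (m \<bullet> (q' - q))\<bar> \<le> e/3 * \<bar>m \<bullet> (q' - q)\<bar>"
    using increment[OF p, of "e/3"] e by auto
  have "\<forall>\<^sub>F q in nhds p. norm (nd q - nd p) < \<delta>/2"
    by (rule eventually_nd_near[OF p]) (use \<delta>(1) in simp)
  with eventually_nd_E[OF p] have "\<forall>\<^sub>F q in nhds p. q \<in> D \<and> norm (nd q - nd p) < \<delta>/2"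
    by eventually_elim auto
  then obtain d where d: "0 < d" "\<And>q. norm (q - p) < d \<Longrightarrow> q \<in> D \<and> norm (nd q - nd p) < \<delta>/2"
    unfolding eventually_nhds_metric by (auto simp: dist_norm)
  show "\<exists>d>0. \<forall>q. dist q p < d \<longrightarrow> dist (\<beta> q) (\<beta> p) < e"
  proof (intro exI[of _ "min d (\<delta>/2)"] conjI allI impI)
    fix q assume "dist q p < min d (\<delta>/2)"
    then have q: "norm (q - p) < d" "norm (q - p) < \<delta>/2" by (auto simp: dist_norm)
    have qD: "q \<in> D" and nq: "norm (nd q - nd p) < \<delta>/2" using d(2)[OF q(1)] by auto
    obtain \<eta> where \<eta>: "0 < \<eta>" "\<forall>m r r'. norm (m - nd q) < \<eta> \<and> norm (r - q) < \<eta> \<and>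
       norm (r' - q) < \<eta> \<and> m \<in> E r \<and> m \<in> E r' \<longrightarrow>
       \<bar>V m r' - V m r - \<beta> q * (m \<bullet> (r' - r))\<bar> \<le> e/3 * \<bar>m \<bullet> (r' - r)\<bar>"
      using increment[OF qD, of "e/3"] e by auto
    define c where "c = min (min \<eta> (\<delta>/2)) 1"
    have c: "0 < c" using \<eta>(1) \<delta>(1) by (simp add: c_def)
    have "\<forall>\<^sub>F r in nhds q. norm (nd r - nd q) < c" by (rule eventually_nd_near[OF qD c])
    with eventually_nd_E[OF qD] have "\<forall>\<^sub>F r in nhds q. r \<in> D \<and> nd r \<in> E q \<and> norm (nd r - nd q) < c"
      by eventually_elim auto
    then obtain d' where d': "0 < d'" "\<And>r. norm (r - q) < d' \<Longrightarrow> r \<in> D \<and> nd r \<in> E q \<and> norm (nd r - nd q) < c"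
      unfolding eventually_nhds_metric by (auto simp: dist_norm)
    define t where "t = min d' c / 2"
    have t: "0 < t" "t < d'" "t < c" using d'(1) c by (auto simp: t_def)
    \<comment> \<open>Moving from \<open>q\<close> along \<open>nd q\<close> makes the width
      \<open>w\<close> positive, and the direction \<open>nd r\<close> is admissible at both
      \<open>q\<close> and \<open>r\<close>.\<close>
    define r where "r = q + t *\<^sub>R nd q"
    have rq: "r - q = t *\<^sub>R nd q" by (simp add: r_def)
    have nrq: "norm (r - q) = t" using t(1) norm_nd[OF qD] by (simp add: rq)
    have r: "r \<in> D" "nd r \<in> E q" "norm (nd r - nd q) < c" using d'(2)[of r] nrq t by auto
    define w where "w = nd r \<bullet> (r - q)"
    have "nd r \<bullet> nd q = 1 - (nd q - nd r) \<bullet> nd q"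
      using norm_nd[OF qD] by (simp add: inner_diff_left norm_eq_1)
    moreover have "(nd q - nd r) \<bullet> nd q \<le> norm (nd q - nd r) * norm (nd q)" by (rule norm_cauchy_schwarz)
    ultimately have "0 < nd r \<bullet> nd q" using r(3) norm_nd[OF qD] by (simp add: c_def norm_minus_commute)
    then have w: "0 < w" using t(1) by (simp add: w_def rq)
    have "norm (nd r - nd q) < \<eta>" "norm (r - q) < \<eta>" using r(3) nrq t(3) by (auto simp: c_def)
    then have 1: "\<bar>V (nd r) r - V (nd r) q - \<beta> q * w\<bar> \<le> e/3 * w"
      using \<eta>(2)[rule_format, of "nd r" q r] \<eta>(1) r(1,2) ndE[OF r(1)] w by (simp add: w_def)
    have "norm (nd r - nd p) \<le> norm (nd r - nd q) + norm (nd q - nd p)"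
      using norm_triangle_ineq[of "nd r - nd q" "nd q - nd p"] by simp
    then have "norm (nd r - nd p) < \<delta>" using r(3) nq by (simp add: c_def)
    moreover have "norm (r - p) \<le> norm (r - q) + norm (q - p)"
      using norm_triangle_ineq[of "r - q" "q - p"] by simp
    then have "norm (r - p) < \<delta>" using nrq t(3) q(2) by (simp add: c_def)
    ultimately have 2: "\<bar>V (nd r) r - V (nd r) q - \<beta> p * w\<bar> \<le> e/3 * w"
      using \<delta>(2)[rule_format, of "nd r" q r] \<delta>(1) q(2) r(1,2) ndE[OF r(1)] w by (simp add: w_def)
    have eq: "(\<beta> q - \<beta> p) * w = (V (nd r) r - V (nd r) q - \<beta> p * w) - (V (nd r) r - V (nd r) q - \<beta> q * w)"
      by (simp add: algebra_simps)
    have "\<bar>(\<beta> q - \<beta> p) * w\<bar> \<le> e/3 * w + e/3 * w"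
      unfolding eq by (rule order_trans[OF abs_triangle_ineq4 add_mono[OF 2 1]])
    then have "\<bar>(\<beta> q - \<beta> p) * w\<bar> \<le> 2 * (e/3 * w)" by simp
    then have "\<bar>\<beta> q - \<beta> p\<bar> * w \<le> (2 * e/3) * w" using w by (simp add: abs_mult)
    then have "\<bar>\<beta> q - \<beta> p\<bar> \<le> 2 * e/3" using w by simp
    then show "dist (\<beta> q) (\<beta> p) < e" using e by (simp add: dist_real_def)
  qed (use d \<delta> in simp)
qed

text \<open>The derivative of \<open>v\<close> in direction \<open>X\<close> is
  \<open>\<beta>\<close> times the inner product of \<open>nd\<close> with \<open>X\<close>, whose
  second factor vanishes at \<open>p\<close>.\<close>

lemma second_derivative_v:
  assumes p: "p \<in> D" and X: "nd p \<bullet> X = 0"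
  shows "second_derivative v p X Y = \<beta> p * (frechet_derivative nd (at p) Y \<bullet> X)"
proof -
  have "((\<lambda>y. nd y \<bullet> X) has_derivative (\<lambda>h. frechet_derivative nd (at p) h \<bullet> X)) (at p)"
    using nd_derivative[OF p] by (auto intro!: derivative_eq_intros)
  then have prod: "((\<lambda>y. \<beta> y * (nd y \<bullet> X)) has_derivative (\<lambda>h. \<beta> p * (frechet_derivative nd (at p) h \<bullet> X))) (at p)"
    using has_derivative_mult_at_zero[where g = "\<lambda>y. nd y \<bullet> X" and \<beta> = \<beta>] X \<beta>_cont[OF p] by blast
  have "\<beta> y * (nd y \<bullet> X) = frechet_derivative v (at y) X" if "y \<in> D" for y
    using frechet_derivative_apply[OF v_derivative[OF that]] by simp
  then have "((\<lambda>y. frechet_derivative v (at y) X) has_derivative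
      (\<lambda>h. \<beta> p * (frechet_derivative nd (at p) h \<bullet> X))) (at p)"
    by (intro has_derivative_transform_within_open[OF prod D p]) auto
  then show ?thesis unfolding second_derivative_def by (rule frechet_derivative_apply)
qed

end

context envelope
begin

text \<open>At \<open>nd q\<close> the gradient of the volume at \<open>q\<close> vanishes, so the
  gradient at \<open>p\<close> is minus that of the difference \<open>\<Delta>\<close>. By the rate
  estimate \<open>\<Delta>\<close> is nearly \<open>\<beta> p\<close> times a function vanishing at
  \<open>nd q\<close>, with an error proportional to that function; hence the estimate survives
  differentiation at that point.\<close>

lemma gradient_at_nearby_minimizer:
  assumes p: "p \<in> D" and \<epsilon>: "0 < \<epsilon>"
  shows "\<exists>\<delta>>0. \<forall>q X. norm (q - p) < \<delta> \<and> nd q \<bullet> (q - p) = 0 \<longrightarrow>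
    \<bar>frechet_derivative (Vh p) (at (nd q)) X + \<beta> p * (X \<bullet> (q - p))\<bar> \<le> \<epsilon> * \<bar>X \<bullet> (q - p)\<bar>"
proof -
  obtain W where W: "open W" "nd p \<in> W" "W \<inter> sphere 0 1 \<subseteq> E p"
    "\<And>x. x \<in> W \<Longrightarrow> Vh p differentiable at x" "\<And>x. x \<in> W \<Longrightarrow> x /\<^sub>R norm x \<in> W \<inter> sphere 0 1"
    using E_nbhd[OF p] by metis
  obtain \<delta>0 where \<delta>0: "0 < \<delta>0" "\<forall>m q q'. norm (m - nd p) < \<delta>0 \<and> norm (q - p) < \<delta>0 \<and>
       norm (q' - p) < \<delta>0 \<and> m \<in> E q \<and> m \<in> E q' \<longrightarrow>
       \<bar>V m q' - V m q - \<beta> p * (m \<bullet> (q' - q))\<bar> \<le> \<epsilon> * \<bar>m \<bullet> (q' - q)\<bar>"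
    using increment[OF p \<epsilon>] by blast
  obtain rW where rW: "0 < rW" "ball (nd p) rW \<subseteq> W" using W(1,2) openE by blast
  have "\<forall>\<^sub>F q in nhds p. norm (nd q - nd p) < min rW \<delta>0"
    by (rule eventually_nd_near[OF p]) (use rW \<delta>0 in simp)
  with eventually_nd_E[OF p] have "\<forall>\<^sub>F q in nhds p. q \<in> D \<and> norm (nd q - nd p) < min rW \<delta>0"
    by eventually_elim auto
  then obtain d where d: "0 < d" "\<And>q. norm (q - p) < d \<Longrightarrow> q \<in> D \<and> norm (nd q - nd p) < min rW \<delta>0"
    unfolding eventually_nhds_metric by (auto simp: dist_norm)
  show ?thesis
  proof (intro exI[of _ "min d \<delta>0"] conjI allI impI)
    fix q X assume "norm (q - p) < min d \<delta>0 \<and> nd q \<bullet> (q - p) = 0"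
    then have q: "norm (q - p) < d" "norm (q - p) < \<delta>0" and orth: "nd q \<bullet> (q - p) = 0" by auto
    have qD: "q \<in> D" and nq: "norm (nd q - nd p) < rW" "norm (nd q - nd p) < \<delta>0" using d(2)[OF q(1)] by auto
    obtain W' where W': "open W'" "nd q \<in> W'" "W' \<inter> sphere 0 1 \<subseteq> E q"
      "\<And>x. x \<in> W' \<Longrightarrow> Vh q differentiable at x" "\<And>x. x \<in> W' \<Longrightarrow> x /\<^sub>R norm x \<in> W' \<inter> sphere 0 1"
      using E_nbhd[OF qD] by metis
    let ?m = "nd q" and ?g = "frechet_derivative (Vh p) (at (nd q))"
    have mW: "?m \<in> W" using nq(1) rW(2) by (auto simp: dist_norm norm_minus_commute)
    have m1: "norm ?m = 1" by (rule norm_nd[OF qD])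
    define \<Delta> where "\<Delta> x = Vh q x - Vh p x" for x
    have dp: "(Vh p has_derivative ?g) (at ?m)" using W(4)[OF mW] frechet_derivative_works by blast
    have d\<Delta>: "(\<Delta> has_derivative (\<lambda>h. 0 - ?g h)) (at ?m)"
      unfolding \<Delta>_def by (rule has_derivative_diff[OF Vh_critical[OF qD] dp])
    have est: "\<bar>\<Delta> x - \<beta> p * ((x /\<^sub>R norm x) \<bullet> (q - p))\<bar> \<le> \<epsilon> * \<bar>(x /\<^sub>R norm x) \<bullet> (q - p)\<bar>"
      if x: "x \<in> W" "x \<in> W'" "norm (x /\<^sub>R norm x - nd p) < \<delta>0" for x
    proof -
      have "x /\<^sub>R norm x \<in> E p" "x /\<^sub>R norm x \<in> E q" using W(3,5) W'(3,5) x by blast+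
      then show ?thesis
        using \<delta>0(2)[rule_format, of "x /\<^sub>R norm x" p q] \<delta>0(1) q(2) x(3) by (simp add: \<Delta>_def radial_extension_def)
    qed
    have "\<bar>\<Delta> ?m - \<beta> p * ((?m /\<^sub>R norm ?m) \<bullet> (q - p))\<bar> \<le> \<epsilon> * \<bar>(?m /\<^sub>R norm ?m) \<bullet> (q - p)\<bar>"
      by (rule est[OF mW W'(2)]) (use m1 nq(2) in simp)
    then have \<Delta>0: "\<Delta> ?m = 0" using m1 orth by simp
    define s where "s k = inverse (real (Suc k))" for k
    have s: "\<And>k. 0 < s k" "s \<longlonglongrightarrow> 0" unfolding s_def using LIMSEQ_inverse_real_of_nat by auto
    define x where "x k = ?m + s k *\<^sub>R X" for k
    have "x \<longlonglongrightarrow> ?m + 0 *\<^sub>R X" unfolding x_def by (intro tendsto_intros s)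
    then have xm: "x \<longlonglongrightarrow> ?m" by simp
    have nx: "(\<lambda>k. norm (x k)) \<longlonglongrightarrow> 1" using tendsto_norm[OF xm] m1 by simp
    have "(\<lambda>k. norm (x k /\<^sub>R norm (x k) - nd p)) \<longlonglongrightarrow> norm (?m /\<^sub>R 1 - nd p)"
      by (intro tendsto_intros xm nx) simp
    then have ev3: "\<forall>\<^sub>F k in sequentially. norm (x k /\<^sub>R norm (x k) - nd p) < \<delta>0"
      using nq(2) by (intro order_tendstoD) auto
    have ev1: "\<forall>\<^sub>F k in sequentially. x k \<in> W" using xm W(1) mW by (rule topological_tendstoD)
    have ev2: "\<forall>\<^sub>F k in sequentially. x k \<in> W'" using xm W'(1,2) by (rule topological_tendstoD)
    let ?c = "X \<bullet> (q - p)"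
    \<comment> \<open>Orthogonality leaves a term linear in \<open>s k\<close>; the radial
      projection contributes only the factor \<open>1 / norm (x k)\<close>, which tends to
      1.\<close>
    have xc: "(x k /\<^sub>R norm (x k)) \<bullet> (q - p) = s k * (?c / norm (x k))" for k
      using orth by (simp add: x_def inner_add_left divide_inverse mult_ac)
    have ev: "\<forall>\<^sub>F k in sequentially. \<bar>(\<Delta> (x k) - \<Delta> ?m) /\<^sub>R s k - \<beta> p * (?c / norm (x k))\<bar> \<le> \<epsilon> * \<bar>?c / norm (x k)\<bar>"
      using ev1 ev2 ev3
    proof eventually_elim
      case (elim k)
      have "\<bar>\<Delta> (x k) - \<beta> p * (s k * (?c / norm (x k)))\<bar> \<le> \<epsilon> * \<bar>s k * (?c / norm (x k))\<bar>"
        using est[OF elim] unfolding xc .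
      also have "\<dots> = s k * (\<epsilon> * \<bar>?c / norm (x k)\<bar>)" using s(1)[of k] by (simp add: abs_mult)
      also have "\<Delta> (x k) - \<beta> p * (s k * (?c / norm (x k)))
          = s k * ((\<Delta> (x k) - \<Delta> ?m) /\<^sub>R s k - \<beta> p * (?c / norm (x k)))"
        using s(1)[of k] \<Delta>0 by (simp add: algebra_simps)
      also have "\<bar>\<dots>\<bar> = s k * \<bar>(\<Delta> (x k) - \<Delta> ?m) /\<^sub>R s k - \<beta> p * (?c / norm (x k))\<bar>"
        using s(1)[of k] by (simp add: abs_mult)
      finally show ?case using s(1)[of k] by (simp only: mult_le_cancel_left_pos)
    qed
    have "(\<lambda>k. (x k - ?m) /\<^sub>R s k) \<longlonglongrightarrow> X"
      using s(1) by (simp add: x_def less_imp_neq[symmetric])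
    from has_derivative_sequential[OF d\<Delta> s this]
    have l1: "(\<lambda>k. (\<Delta> (x k) - \<Delta> ?m) /\<^sub>R s k) \<longlonglongrightarrow> 0 - ?g X" .
    have l2: "(\<lambda>k. ?c / norm (x k)) \<longlonglongrightarrow> ?c / 1" by (intro tendsto_intros nx) simp
    have l3: "(\<lambda>k. \<bar>(\<Delta> (x k) - \<Delta> ?m) /\<^sub>R s k - \<beta> p * (?c / norm (x k))\<bar>) \<longlonglongrightarrow> \<bar>(0 - ?g X) - \<beta> p * (?c / 1)\<bar>"
      by (rule tendsto_rabs[OF tendsto_diff[OF l1 tendsto_mult[OF tendsto_const l2]]])
    have l4: "(\<lambda>k. \<epsilon> * \<bar>?c / norm (x k)\<bar>) \<longlonglongrightarrow> \<epsilon> * \<bar>?c / 1\<bar>"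
      by (rule tendsto_mult[OF tendsto_const tendsto_rabs[OF l2]])
    have "\<bar>(0 - ?g X) - \<beta> p * (?c / 1)\<bar> \<le> \<epsilon> * \<bar>?c / 1\<bar>"
      by (rule tendsto_le[OF sequentially_bot l4 l3 ev])
    then show "\<bar>?g X + \<beta> p * ?c\<bar> \<le> \<epsilon> * \<bar>?c\<bar>" by (simp add: abs_le_iff)
  qed (use d \<delta>0 in simp)
qed

text \<open>
  The minimizing hyperplane of \<open>q = p + (t *\<^sub>R Y + \<sigma> *\<^sub>R nd p)\<close> passes through \<open>p\<close>. For such \<open>q\<close> the volumes
  at \<open>p\<close> and \<open>q\<close> are compared across one and the same hyperplane, so continuity of the area suffices.
\<close>

lemma minimizing_hyperplane_through:
  assumes p: "p \<in> D" and Y: "nd p \<bullet> Y = 0" and \<kappa>: "0 < \<kappa>"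
  shows "\<exists>t \<sigma>. 0 < t \<and> t < \<kappa> \<and> \<bar>\<sigma>\<bar> \<le> \<kappa> * t \<and> nd (p + (t *\<^sub>R Y + \<sigma> *\<^sub>R nd p)) \<bullet> (t *\<^sub>R Y + \<sigma> *\<^sub>R nd p) = 0"
proof -
  let ?n = "nd p"
  have nn: "?n \<bullet> ?n = 1" using norm_nd[OF p] by (simp add: norm_eq_1)
  define c where "c = norm Y + \<kappa>"
  have c: "0 < c" using \<kappa> by (simp add: c_def add_nonneg_pos)
  have "\<forall>\<^sub>F q in nhds p. norm (nd q - nd p) < \<kappa> / c"
    by (rule eventually_nd_near[OF p]) (use \<kappa> c in simp)
  with eventually_nd_E[OF p] have "\<forall>\<^sub>F q in nhds p. q \<in> D \<and> norm (nd q - nd p) < \<kappa> / c"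
    by eventually_elim auto
  then obtain d where d: "0 < d" "\<And>q. norm (q - p) < d \<Longrightarrow> q \<in> D \<and> norm (nd q - nd p) < \<kappa> / c"
    unfolding eventually_nhds_metric by (auto simp: dist_norm)
  define t where "t = min \<kappa> (d / c) / 2"
  have t: "0 < t" "t < \<kappa>" "t * c < d"
  proof -
    show "0 < t" "t < \<kappa>" using \<kappa> c d(1) by (auto simp: t_def)
    have "t \<le> (d / c) / 2" unfolding t_def by (intro divide_right_mono) auto
    then have "t * c \<le> (d / c) / 2 * c" using c by (intro mult_right_mono) auto
    also have "\<dots> = d / 2" using c by simp
    also have "\<dots> < d" using d(1) by simp
    finally show "t * c < d" .
  qed
  define w where "w \<sigma> = t *\<^sub>R Y + \<sigma> *\<^sub>R ?n" for \<sigma>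
  define F where "F \<sigma> = nd (p + w \<sigma>) \<bullet> w \<sigma>" for \<sigma>
  have nw: "norm (w \<sigma>) \<le> t * c" if "\<bar>\<sigma>\<bar> \<le> \<kappa> * t" for \<sigma>
  proof -
    have "norm (w \<sigma>) \<le> norm (t *\<^sub>R Y) + norm (\<sigma> *\<^sub>R ?n)" unfolding w_def by (rule norm_triangle_ineq)
    also have "\<dots> \<le> t * norm Y + \<kappa> * t" using that t(1) norm_nd[OF p] by simp
    finally show ?thesis by (simp add: c_def algebra_simps)
  qed
  have near: "p + w \<sigma> \<in> D" "norm (nd (p + w \<sigma>) - ?n) < \<kappa> / c" if "\<bar>\<sigma>\<bar> \<le> \<kappa> * t" for \<sigma>
    using d(2)[of "p + w \<sigma>"] nw[OF that] t(3) by auto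
  \<comment> \<open>\<open>F\<close> is so close to the identity that it has opposite signs at the
    two ends of the interval, which yields a zero.\<close>
  have dev: "\<bar>F \<sigma> - \<sigma>\<bar> < \<kappa> * t" if "\<bar>\<sigma>\<bar> \<le> \<kappa> * t" for \<sigma>
  proof -
    have "F \<sigma> - \<sigma> = (nd (p + w \<sigma>) - ?n) \<bullet> w \<sigma>"
      using Y nn by (simp add: F_def w_def inner_diff_left inner_add_right algebra_simps)
    then have "\<bar>F \<sigma> - \<sigma>\<bar> \<le> norm (nd (p + w \<sigma>) - ?n) * norm (w \<sigma>)" by (simp add: Cauchy_Schwarz_ineq2)
    also have "\<dots> \<le> norm (nd (p + w \<sigma>) - ?n) * (t * c)" using nw[OF that] by (intro mult_left_mono) auto
    also have "\<dots> < \<kappa> / c * (t * c)" using near(2)[OF that] t(1) c by (intro mult_strict_right_mono) auto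
    also have "\<dots> = \<kappa> * t" using c by simp
    finally show ?thesis .
  qed
  have contnd: "continuous_on D nd" using nd_cont continuous_at_imp_continuous_on by blast
  have contw: "continuous_on {- (\<kappa> * t)..\<kappa> * t} (\<lambda>\<sigma>. p + w \<sigma>)" unfolding w_def by (intro continuous_intros)
  have "continuous_on {- (\<kappa> * t)..\<kappa> * t} (\<lambda>\<sigma>. nd (p + w \<sigma>))"
    by (rule continuous_on_compose2[OF contnd contw]) (use near(1) in \<open>auto simp: abs_le_iff\<close>)
  then have contF: "continuous_on {- (\<kappa> * t)..\<kappa> * t} F"
    unfolding F_def by (intro continuous_on_inner) (auto simp: w_def intro!: continuous_intros)
  have k0: "0 < \<kappa> * t" using \<kappa> t(1) by simp
  have "F (- (\<kappa> * t)) \<le> 0" "0 \<le> F (\<kappa> * t)" using dev[of "- (\<kappa> * t)"] dev[of "\<kappa> * t"] k0 by auto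
  then obtain \<sigma> where "- (\<kappa> * t) \<le> \<sigma>" "\<sigma> \<le> \<kappa> * t" "F \<sigma> = 0"
    using IVT'[of F "- (\<kappa> * t)" 0 "\<kappa> * t"] contF k0 by auto
  then have "0 < t \<and> t < \<kappa> \<and> \<bar>\<sigma>\<bar> \<le> \<kappa> * t \<and> nd (p + (t *\<^sub>R Y + \<sigma> *\<^sub>R nd p)) \<bullet> (t *\<^sub>R Y + \<sigma> *\<^sub>R nd p) = 0"
    using t(1,2) by (simp add: F_def w_def abs_le_iff)
  then show ?thesis by blast
qed

text \<open>Along points \<open>q k\<close> approaching \<open>p\<close> in direction
  \<open>Y\<close> whose minimizing planes pass through \<open>p\<close>, the gradient of the volume
  at \<open>p\<close>, taken at n(q), is differentiated in two ways: by the chain rule through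
  \<open>nd\<close>, and by the nearby-minimizer estimate.\<close>

lemma hessian_along_minimizers:
  assumes p: "p \<in> D" and Y: "nd p \<bullet> Y = 0"
  shows "second_derivative (Vh p) (nd p) X (frechet_derivative nd (at p) Y) = - \<beta> p * (X \<bullet> Y)"
proof -
  define g where "g y = frechet_derivative (Vh p) (at y) X" for y
  have td: "twice_differentiable_at (Vh p) (nd p)"
    using twice[OF p] by (simp add: twice_differentiable_on_sphere_at_def)
  then have "g differentiable at (nd p)" by (simp add: g_def[abs_def] twice_differentiable_at_def)
  then have dg: "(g has_derivative second_derivative (Vh p) (nd p) X) (at (nd p))"
    unfolding second_derivative_def g_def[abs_def] by (simp add: frechet_derivative_works)
  have dgn: "((\<lambda>q. g (nd q)) has_derivative
      (\<lambda>h. second_derivative (Vh p) (nd p) X (frechet_derivative nd (at p) h))) (at p)"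
    by (rule has_derivative_compose[OF nd_derivative[OF p] dg])
  have g0: "g (nd p) = 0" unfolding g_def by (simp add: frechet_derivative_apply[OF Vh_critical[OF p]])
  define \<kappa> where "\<kappa> k = inverse (real (Suc k))" for k
  have \<kappa>: "\<And>k. 0 < \<kappa> k" "\<kappa> \<longlonglongrightarrow> 0" unfolding \<kappa>_def using LIMSEQ_inverse_real_of_nat by auto
  have "\<forall>k. \<exists>t \<sigma>. 0 < t \<and> t < \<kappa> k \<and> \<bar>\<sigma>\<bar> \<le> \<kappa> k * t \<and> nd (p + (t *\<^sub>R Y + \<sigma> *\<^sub>R nd p)) \<bullet> (t *\<^sub>R Y + \<sigma> *\<^sub>R nd p) = 0"
    using minimizing_hyperplane_through[OF p Y \<kappa>(1)] by blast
  then obtain t \<sigma> where t: "\<And>k. 0 < t k" "\<And>k. t k < \<kappa> k" "\<And>k. \<bar>\<sigma> k\<bar> \<le> \<kappa> k * t k"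
    "\<And>k. nd (p + (t k *\<^sub>R Y + \<sigma> k *\<^sub>R nd p)) \<bullet> (t k *\<^sub>R Y + \<sigma> k *\<^sub>R nd p) = 0"
    by metis
  define q where "q k = p + (t k *\<^sub>R Y + \<sigma> k *\<^sub>R nd p)" for k
  have t0: "t \<longlonglongrightarrow> 0"
  proof (rule Lim_null_comparison[OF always_eventually \<kappa>(2)], rule allI)
    show "norm (t k) \<le> \<kappa> k" for k using t(1)[of k] t(2)[of k] by simp
  qed
  have "\<bar>\<sigma> k / t k\<bar> \<le> \<kappa> k" for k using t(1,3)[of k] by (simp add: pos_divide_le_eq)
  then have \<sigma>t: "(\<lambda>k. \<sigma> k / t k) \<longlonglongrightarrow> 0"
    using \<kappa>(2) by (intro Lim_null_comparison[of "\<lambda>k. \<sigma> k / t k" \<kappa>]) auto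
  have qt: "(q k - p) /\<^sub>R t k = Y + (\<sigma> k / t k) *\<^sub>R nd p" for k
    using t(1)[of k] by (simp add: q_def algebra_simps divide_inverse)
  have "(\<lambda>k. Y + (\<sigma> k / t k) *\<^sub>R nd p) \<longlonglongrightarrow> Y + 0 *\<^sub>R nd p" by (intro tendsto_intros \<sigma>t)
  then have lq: "(\<lambda>k. (q k - p) /\<^sub>R t k) \<longlonglongrightarrow> Y" by (simp add: qt)
  let ?G = "second_derivative (Vh p) (nd p) X (frechet_derivative nd (at p) Y)"
  have lg: "(\<lambda>k. g (nd (q k)) /\<^sub>R t k) \<longlonglongrightarrow> ?G"
    using has_derivative_sequential[OF dgn t(1) t0 lq] g0 by simp
  have lx: "(\<lambda>k. X \<bullet> ((q k - p) /\<^sub>R t k)) \<longlonglongrightarrow> X \<bullet> Y" by (intro tendsto_intros lq)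
  have "(\<lambda>k. t k *\<^sub>R ((q k - p) /\<^sub>R t k)) \<longlonglongrightarrow> 0 *\<^sub>R Y" by (intro tendsto_intros t0 lq)
  moreover have "t k *\<^sub>R ((q k - p) /\<^sub>R t k) = q k - p" for k using t(1)[of k] by simp
  ultimately have qp: "(\<lambda>k. q k - p) \<longlonglongrightarrow> 0" by simp
  have bound: "\<bar>?G + \<beta> p * (X \<bullet> Y)\<bar> \<le> \<epsilon> * \<bar>X \<bullet> Y\<bar>" if \<epsilon>: "0 < \<epsilon>" for \<epsilon>
  proof -
    obtain \<delta> where \<delta>: "0 < \<delta>" "\<forall>q X. norm (q - p) < \<delta> \<and> nd q \<bullet> (q - p) = 0 \<longrightarrow>
       \<bar>frechet_derivative (Vh p) (at (nd q)) X + \<beta> p * (X \<bullet> (q - p))\<bar> \<le> \<epsilon> * \<bar>X \<bullet> (q - p)\<bar>"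
      using gradient_at_nearby_minimizer[OF p \<epsilon>] by blast
    have "\<forall>\<^sub>F k in sequentially. norm (q k - p) < \<delta>"
      using tendsto_norm[OF qp] \<delta>(1) by (intro order_tendstoD) auto
    then have ev: "\<forall>\<^sub>F k in sequentially. \<bar>g (nd (q k)) /\<^sub>R t k + \<beta> p * (X \<bullet> ((q k - p) /\<^sub>R t k))\<bar>
        \<le> \<epsilon> * \<bar>X \<bullet> ((q k - p) /\<^sub>R t k)\<bar>"
    proof eventually_elim
      case (elim k)
      have "\<bar>g (nd (q k)) + \<beta> p * (X \<bullet> (q k - p))\<bar> \<le> \<epsilon> * \<bar>X \<bullet> (q k - p)\<bar>"
        using \<delta>(2)[rule_format, of "q k" X] elim t(4)[of k] by (simp add: g_def q_def)
      then have "\<bar>g (nd (q k)) + \<beta> p * (X \<bullet> (q k - p))\<bar> / t k \<le> \<epsilon> * \<bar>X \<bullet> (q k - p)\<bar> / t k"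
        using t(1)[of k] by (intro divide_right_mono) auto
      moreover have "\<bar>g (nd (q k)) + \<beta> p * (X \<bullet> (q k - p))\<bar> / t k = \<bar>(g (nd (q k)) + \<beta> p * (X \<bullet> (q k - p))) / t k\<bar>"
        "\<epsilon> * \<bar>X \<bullet> (q k - p)\<bar> / t k = \<epsilon> * \<bar>(X \<bullet> (q k - p)) / t k\<bar>"
        using t(1)[of k] by (simp_all add: abs_divide)
      moreover have "(g (nd (q k)) + \<beta> p * (X \<bullet> (q k - p))) / t k = g (nd (q k)) /\<^sub>R t k + \<beta> p * (X \<bullet> ((q k - p) /\<^sub>R t k))"
        "(X \<bullet> (q k - p)) / t k = X \<bullet> ((q k - p) /\<^sub>R t k)"
        by (simp_all add: divide_inverse algebra_simps)
      ultimately show ?case by simp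
    qed
    show ?thesis
      by (rule tendsto_le[OF sequentially_bot tendsto_mult[OF tendsto_const tendsto_rabs[OF lx]]
            tendsto_rabs[OF tendsto_add[OF lg tendsto_mult[OF tendsto_const lx]]] ev])
  qed
  have "?G + \<beta> p * (X \<bullet> Y) = 0"
  proof (rule ccontr)
    assume nz: "?G + \<beta> p * (X \<bullet> Y) \<noteq> 0"
    define \<epsilon> where "\<epsilon> = \<bar>?G + \<beta> p * (X \<bullet> Y)\<bar> / (2 * (\<bar>X \<bullet> Y\<bar> + 1))"
    have "0 < \<epsilon>" using nz by (simp add: \<epsilon>_def add_nonneg_pos)
    from bound[OF this] have "\<bar>?G + \<beta> p * (X \<bullet> Y)\<bar> \<le> \<epsilon> * \<bar>X \<bullet> Y\<bar>" .
    also have "\<dots> \<le> \<epsilon> * (\<bar>X \<bullet> Y\<bar> + 1)" using \<open>0 < \<epsilon>\<close> by simp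
    also have "\<dots> = \<bar>?G + \<beta> p * (X \<bullet> Y)\<bar> / 2" by (simp add: \<epsilon>_def add_nonneg_eq_0_iff field_simps)
    finally show False using nz by simp
  qed
  then show ?thesis by simp
qed

text \<open>On the orthogonal complement the hessian of V composed with the derivative of
  \<open>nd\<close> is \<open>- \<beta>\<close>, and that of \<open>v\<close> is
  \<open>\<beta>\<close> times the adjoint of this derivative; the rest is linear algebra.\<close>

theorem envelope_hessian:
  assumes p: "p \<in> D"
  defines "Q \<equiv> \<lambda>X. (1 / \<beta> p) *\<^sub>R sphere_hessian (\<lambda>m. V m p) (nd p) X"
  shows "bij_betw Q (perp (nd p)) (perp (nd p))"
    and "X \<in> perp (nd p) \<Longrightarrow>
      - (1 / \<beta> p) *\<^sub>R form_operator (perp (nd p)) (second_derivative v p) X = inv_into (perp (nd p)) Q X"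
proof -
  let ?A = "frechet_derivative nd (at p)" and ?n = "nd p"
  have linA: "linear ?A" by (rule has_derivative_linear[OF nd_derivative[OF p]])
  \<comment> \<open>The direction stays on the unit sphere, so its derivative is tangent to
    it.\<close>
  have nA: "?n \<bullet> ?A Y = 0" for Y
  proof -
    have "((\<lambda>q. nd q \<bullet> nd q) has_derivative (\<lambda>h. nd p \<bullet> ?A h + ?A h \<bullet> nd p)) (at p)"
      by (rule has_derivative_inner[OF nd_derivative[OF p] nd_derivative[OF p]])
    moreover have "((\<lambda>q. nd q \<bullet> nd q) has_derivative (\<lambda>h. 0)) (at p)"
      by (rule has_derivative_transform_within_open[OF has_derivative_const D p, of 1])
        (simp add: norm_nd norm_eq_1[symmetric])
    ultimately have "(\<lambda>h. nd p \<bullet> ?A h + ?A h \<bullet> nd p) = (\<lambda>h. 0)" by (rule has_derivative_unique)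
    then have "nd p \<bullet> ?A Y + ?A Y \<bullet> nd p = 0" by metis
    then show ?thesis by (simp add: inner_commute)
  qed
  have lin1: "linear (second_derivative (Vh p) ?n X)" for X
  proof -
    have "(\<lambda>y. frechet_derivative (Vh p) (at y) X) differentiable at ?n"
      using twice[OF p] by (simp add: twice_differentiable_on_sphere_at_def twice_differentiable_at_def)
    then show ?thesis unfolding second_derivative_def
      using has_derivative_linear frechet_derivative_works by blast
  qed
  note B = form_operator_perp[where n = "nd p" and B = "second_derivative (Vh p) (nd p)", OF norm_nd[OF p] lin1]
  have lin2: "linear (second_derivative v p X)" if "X \<in> perp ?n" for X
    using second_derivative_v[OF p, of X] that linA
    by (intro linearI) (simp_all add: perp_def linear_add linear_scale inner_add_left algebra_simps)
  note C = form_operator_perp[where n = "nd p" and B = "second_derivative v p", OF norm_nd[OF p] lin2]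
  note main = perp_inverse_of_left_inverse[OF norm_nd[OF p] linA nA \<beta>_pos[OF p],
      of "sphere_hessian (\<lambda>m. V m p) ?n" "form_operator (perp ?n) (second_derivative v p)"]
  have B1: "sphere_hessian (\<lambda>m. V m p) ?n X \<in> perp ?n" for X
    unfolding sphere_hessian_def by (rule B)
  have B2: "sphere_hessian (\<lambda>m. V m p) ?n X \<bullet> ?A Y = - \<beta> p * (X \<bullet> Y)" if "Y \<in> perp ?n" for X Y
    unfolding sphere_hessian_def using B(2)[of "?A Y" X] nA hessian_along_minimizers[OF p, of Y X] that
    by (simp add: perp_def)
  have C2: "form_operator (perp ?n) (second_derivative v p) X \<bullet> Y = \<beta> p * (?A Y \<bullet> X)"
    if "X \<in> perp ?n" "Y \<in> perp ?n" for X Y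
    using C(2)[OF that] second_derivative_v[OF p] that(1) by (simp add: perp_def)
  show "bij_betw Q (perp ?n) (perp ?n)"
    unfolding Q_def by (rule main(1)) (use B1 B2 C(1) C2 in auto)
  show "- (1 / \<beta> p) *\<^sub>R form_operator (perp ?n) (second_derivative v p) X = inv_into (perp ?n) Q X"
    if "X \<in> perp ?n"
    unfolding Q_def by (rule main(2)) (use B1 B2 C(1) C2 that in auto)
qed

end

section \<open>Application to the volume distance\<close>

theorem proposition2p5:
  fixes M D :: "'n::finite space set" and \<nu> \<xi> :: "'n space \<Rightarrow> 'n space"
  assumes "strictly_convex_hypersurface M \<nu>"
    and "affine_normal M \<nu> \<xi>"
    and "open D" and "half_neighborhood M \<xi> D" and "D \<subseteq> minimizable M"
    and "\<And>p. p \<in> D \<Longrightarrow> \<exists>!n. minimizing M n p"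
    and "smooth_on D (min_dir M)"
    and "\<And>p. p \<in> D \<Longrightarrow> twice_differentiable_on_sphere_at (admissible_directions M p)
                            (\<lambda>n. cut_volume M n p) (min_dir M p)"
    and "\<And>p X. p \<in> D \<Longrightarrow> X \<in> perp (min_dir M p) \<Longrightarrow> X \<noteq> 0 \<Longrightarrow> 0 < V_nn M p X \<bullet> X"
  shows "\<forall>p\<in>D. bij_betw (Q_op M p) (perp (min_dir M p)) (perp (min_dir M p)) \<and>
           (\<forall>X\<in>perp (min_dir M p).
              - (1 / section_volume M p) *\<^sub>R restricted_hessian M p X
                = inv_into (perp (min_dir M p)) (Q_op M p) X)"
proof -
  have M: "smooth_hypersurface M" and \<nu>: "unit_normal M \<nu>"
    using assms(1) by (simp_all add: strictly_convex_hypersurface_def)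
  have md: "minimizing M (min_dir M p) p" if "p \<in> D" for p
    unfolding min_dir_def by (rule theI'[OF assms(6)[OF that]])
  have DM: "D \<inter> M = {}" by (rule minimizable_open_disjoint[OF assms(3,5)])
  interpret envelope D "min_dir M" "admissible_directions M" "cut_volume M" "section_volume M" "volume_distance M"
  proof
    show "open D" by (rule assms(3))
    show "norm m = 1" if "m \<in> admissible_directions M p" for p m by (rule admissibleD(1)[OF that])
    fix p assume p: "p \<in> D"
    show n: "min_dir M p \<in> admissible_directions M p" using md[OF p] by (simp add: minimizing_def)
    show "cut_volume M (min_dir M p) p \<le> cut_volume M m p" if "m \<in> admissible_directions M p" for m
      using md[OF p] that by (simp add: minimizing_def)
    show td: "twice_differentiable_on_sphere_at (admissible_directions M p) (\<lambda>m. cut_volume M m p) (min_dir M p)"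
      by (rule assms(8)[OF p])
    show "min_dir M differentiable at p"
      using smooth_on_has_derivative[OF assms(7) p] by (auto simp: differentiable_def)
    show "0 < section_volume M p"
      unfolding section_volume_def by (rule hyperplane_measure_enclosed_pos[OF M \<nu> n])
    show "volume_distance M p = cut_volume M (min_dir M p) p"
      using assms(6)[OF p] md[OF p] unfolding volume_distance_def by (metis someI_ex)
    fix \<epsilon> :: real assume \<epsilon>: "0 < \<epsilon>"
    \<comment> \<open>The open set of admissible directions comes from twice differentiability on
      the sphere, the ball off \<open>M\<close> from the openness of \<open>D\<close>.\<close>
    obtain W where W: "open W" "min_dir M p \<in> W" "W \<inter> sphere 0 1 \<subseteq> admissible_directions M p"
      using td unfolding twice_differentiable_on_sphere_at_def by blast
    obtain r0 where r0: "0 < r0" "ball p r0 \<subseteq> D" using assms(3) p openE by blast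
    then have "ball p r0 \<inter> M = {}" using DM by blast
    from cut_volume_increment[OF M \<nu> n W r0(1) this \<epsilon>]
    show "\<exists>\<delta>>0. \<forall>m q q'. norm (m - min_dir M p) < \<delta> \<and> norm (q - p) < \<delta> \<and> norm (q' - p) < \<delta> \<and>
       m \<in> admissible_directions M q \<and> m \<in> admissible_directions M q' \<longrightarrow>
       \<bar>cut_volume M m q' - cut_volume M m q - section_volume M p * (m \<bullet> (q' - q))\<bar> \<le> \<epsilon> * \<bar>m \<bullet> (q' - q)\<bar>"
      unfolding section_volume_def .
  qed
  have "Q_op M p = (\<lambda>X. (1 / section_volume M p) *\<^sub>R sphere_hessian (\<lambda>m. cut_volume M m p) (min_dir M p) X)" for p
    by (simp add: fun_eq_iff Q_op_def V_nn_def)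
  then show ?thesis
    using envelope_hessian by (simp add: restricted_hessian_def)
qed

end
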